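(* Let $K\subset\mathbb{R}^n$ be a non-trivial closed convex cone. Suppose $(X_i,Y_i)\in\mathbb{R}^n\times\{\pm1\}$, $i\in[m]$, are i.i.d., with $X_1,\dots,X_m$ i.i.d. $\mathcal{N}(0,I_n)$ and $\mathbb{P}(Y_i=1\mid X_i)=1-\mathbb{P}(Y_i=-1\mid X_i)=\mu(X_i^\top\beta_0)$ with $\mu(x)=e^x/(1+e^x)$ and $\beta_0=0$. Let $\ell(\beta)=-\sum_{i=1}^m\log\big[1+\exp(-Y_iX_i^\top\beta)\big]$. There exists a universal constant $C>0$ such that for every $t\ge1$: (1) if $\sqrt m\le\sqrt{2\delta(K)}-C\sqrt t$, then with probability at least $1-e^{-t}$ the cone constrained MLE $\hat\beta_K$ does not exist; (2) if $\sqrt m\ge\sqrt{2\delta(K)}+C\sqrt t$, then with probability at least $1-e^{-t}$ the cone constrained MLE $\hat\beta_K$ exists.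
   Context: The cone constrained MLE $\hat\beta_K$ is any maximizer of $\beta\mapsto\ell(\beta)$ over $\beta\in K$; it "exists" if such a maximizer exists. A closed convex cone is non-trivial if it is not $\{0\}$. For a closed convex cone $K\subset\mathbb{R}^n$, $\delta(K)\equiv\mathbb{E}\|\Pi_K(g)\|^2$ with $g\sim\mathcal{N}(0,I_n)$, where $\Pi_K$ is the Euclidean metric projection onto $K$. *)

theory Defs
  imports "HOL-Probability.Probability"
begin

text \<open>R^n is represented by the extensional functions on {..<n} (dimension n is an
  explicit natural number, because the constant C is universal over all n).\<close>

definition Rn :: "nat \<Rightarrow> (nat \<Rightarrow> real) set" where
  "Rn n = PiE {..<n} (\<lambda>_. UNIV)"

definition vadd :: "nat \<Rightarrow> (nat \<Rightarrow> real) \<Rightarrow> (nat \<Rightarrow> real) \<Rightarrow> (nat \<Rightarrow> real)" where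
  "vadd n x y = restrict (\<lambda>i. x i + y i) {..<n}"

definition vscale :: "nat \<Rightarrow> real \<Rightarrow> (nat \<Rightarrow> real) \<Rightarrow> (nat \<Rightarrow> real)" where
  "vscale n c x = restrict (\<lambda>i. c * x i) {..<n}"

definition vzero :: "nat \<Rightarrow> (nat \<Rightarrow> real)" where
  "vzero n = restrict (\<lambda>i. 0) {..<n}"

definition dotn :: "nat \<Rightarrow> (nat \<Rightarrow> real) \<Rightarrow> (nat \<Rightarrow> real) \<Rightarrow> real" where
  "dotn n x y = (\<Sum>i<n. x i * y i)"

definition sqnormn :: "nat \<Rightarrow> (nat \<Rightarrow> real) \<Rightarrow> real" where
  "sqnormn n x = (\<Sum>i<n. (x i)^2)"

definition sqdistn :: "nat \<Rightarrow> (nat \<Rightarrow> real) \<Rightarrow> (nat \<Rightarrow> real) \<Rightarrow> real" where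
  "sqdistn n x y = (\<Sum>i<n. (x i - y i)^2)"

definition closed_n :: "nat \<Rightarrow> (nat \<Rightarrow> real) set \<Rightarrow> bool" where
  "closed_n n K \<longleftrightarrow> (\<forall>s x. (\<forall>k. s k \<in> K) \<and> x \<in> Rn n \<and>
       (\<lambda>k. sqdistn n (s k) x) \<longlonglongrightarrow> 0 \<longrightarrow> x \<in> K)"

definition convex_n :: "nat \<Rightarrow> (nat \<Rightarrow> real) set \<Rightarrow> bool" where
  "convex_n n K \<longleftrightarrow> (\<forall>x\<in>K. \<forall>y\<in>K. \<forall>u::real. 0 \<le> u \<and> u \<le> 1 \<longrightarrow>
       vadd n (vscale n u x) (vscale n (1 - u) y) \<in> K)"

definition cone_n :: "nat \<Rightarrow> (nat \<Rightarrow> real) set \<Rightarrow> bool" where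
  "cone_n n K \<longleftrightarrow> (\<forall>x\<in>K. \<forall>c::real. 0 \<le> c \<longrightarrow> vscale n c x \<in> K)"

definition closed_convex_cone_n :: "nat \<Rightarrow> (nat \<Rightarrow> real) set \<Rightarrow> bool" where
  "closed_convex_cone_n n K \<longleftrightarrow> K \<subseteq> Rn n \<and> K \<noteq> {} \<and> closed_n n K \<and> convex_n n K \<and> cone_n n K"

definition projn :: "nat \<Rightarrow> (nat \<Rightarrow> real) set \<Rightarrow> (nat \<Rightarrow> real) \<Rightarrow> (nat \<Rightarrow> real)" where
  "projn n K g = (THE p. p \<in> K \<and> (\<forall>q\<in>K. sqdistn n g p \<le> sqdistn n g q))"

definition gauss :: "nat \<Rightarrow> (nat \<Rightarrow> real) measure" where
  "gauss n = PiM {..<n} (\<lambda>_. density lborel std_normal_density)"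

definition stat_dim :: "nat \<Rightarrow> (nat \<Rightarrow> real) set \<Rightarrow> real" where
  "stat_dim n K = (\<integral>g. sqnormn n (projn n K g) \<partial>gauss n)"

text \<open>Law of one sample (X, Y) for beta_0 = 0: mu(0) = 1/2, so Y is uniform on {-1,1}
  and independent of X ~ N(0, I_n).\<close>
definition pair_law :: "nat \<Rightarrow> ((nat \<Rightarrow> real) \<times> real) measure" where
  "pair_law n = gauss n \<Otimes>\<^sub>M measure_pmf (pmf_of_set {-1::real, 1})"

definition sample :: "nat \<Rightarrow> nat \<Rightarrow> (nat \<Rightarrow> (nat \<Rightarrow> real) \<times> real) measure" where
  "sample n m = PiM {..<m} (\<lambda>_. pair_law n)"

definition loglik :: "nat \<Rightarrow> nat \<Rightarrow> (nat \<Rightarrow> (nat \<Rightarrow> real) \<times> real) \<Rightarrow> (nat \<Rightarrow> real) \<Rightarrow> real" where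
  "loglik n m \<omega> \<beta> = - (\<Sum>i<m. ln (1 + exp (- snd (\<omega> i) * dotn n (fst (\<omega> i)) \<beta>)))"

definition mle_exists :: "nat \<Rightarrow> nat \<Rightarrow> (nat \<Rightarrow> real) set \<Rightarrow> (nat \<Rightarrow> (nat \<Rightarrow> real) \<times> real) \<Rightarrow> bool" where
  "mle_exists n m K \<omega> \<longleftrightarrow> (\<exists>\<beta>\<in>K. \<forall>\<beta>'\<in>K. loglik n m \<omega> \<beta>' \<le> loglik n m \<omega> \<beta>)"

text \<open>"With probability at least p, P holds": some measurable event of probability
  at least p on which P holds (inner probability; agrees with the probability when
  the event is measurable).\<close>
definition whp :: "'a measure \<Rightarrow> real \<Rightarrow> ('a \<Rightarrow> bool) \<Rightarrow> bool" where
  "whp M p P \<longleftrightarrow> (\<exists>A\<in>sets M. A \<subseteq> {\<omega>\<in>space M. P \<omega>} \<and> measure M A \<ge> p)"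

end

theory Submission
  imports Defs
begin

text \<open>
  Put \<open>A\<close> for the matrix with rows \<open>Y_i X_i\<close>, which is standard Gaussian. The estimator does not exist
  if \<open>A x > 0\<close> for some \<open>x \<in> K\<close>, and it exists if every unit vector \<open>x \<in> K\<close> has \<open>(A x)_i < 0\<close> for
  some \<open>i\<close>. By duality both parts follow from one statement: for closed convex cones \<open>K\<close> and \<open>L\<close> with
  \<open>sqrt \<delta>(L) \<ge> sqrt \<delta>(K) + C sqrt t\<close>, with high probability every unit vector \<open>x \<in> K\<close> admits a unit
  vector \<open>y \<in> L\<close> with \<open>y \<bullet> A x > 0\<close>. One applies it to \<open>K\<close> and an orthant (of statistical
  dimension \<open>m / 2\<close>), in either order.

  The statement about two cones is Gordon's min-max comparison of \<open>y \<bullet> A x + \<gamma>\<close> with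
  \<open>y \<bullet> h - x \<bullet> g\<close> on finite nets of the unit spheres, together with Gaussian concentration of the norm
  of the projection of a Gaussian vector onto a cone. The comparison is proved by Lindeberg
  replacement along a smoothed min-max function, the concentration by a discretised
  Maurey-Pisier rotation.
\<close>

section \<open>Standard Gaussian vectors\<close>

text \<open>The variable \<open>\<gamma>\<close> is what makes the comparison fit: for unit vectors
  the covariances are 1 + (y . y')(x . x') and y . y' + x . x', whose difference (1 - y . y')(1 - x
  . x') is nonnegative and vanishes for x = x'. Its price is one tail bound. The comparison needs
  finite index sets, hence the nets, but its conclusion ignores their size, so the mesh may be as
  fine as crude moment bounds demand. Neither a min-max nor the norm of a projection is smooth. The
  first is smoothed by logistic factors, whose derivatives have the signs that the comparison wants;
  the second is treated through subgradients. Being 1-Lipschitz, that norm fluctuates by an amount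
  free of the dimension, and so its mean stays within a constant of the square root of the
  statistical dimension; hence the universal constant. In the statement about two cones y may depend
  on x. For existence this suffices: y \<le> 0 with y . A x > 0 exhibits a negative coordinate of A
  x. Non-existence asks for one x serving all rows, which is extracted from the statement for the
  transposed matrix.\<close>

definition stdnorm :: "real measure" where
  "stdnorm = density lborel std_normal_density"

abbreviation gaussian :: "'i set \<Rightarrow> ('i \<Rightarrow> real) measure" where
  "gaussian I \<equiv> PiM I (\<lambda>_. stdnorm)"

lemma gauss_eq_gaussian: "gauss n = gaussian {..<n}"
  by (simp add: gauss_def stdnorm_def)

lemma sets_stdnorm [simp, measurable_cong]: "sets stdnorm = sets borel"
  by (simp add: stdnorm_def)

lemma space_stdnorm [simp]: "space stdnorm = UNIV"
  by (simp add: stdnorm_def)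

lemma prob_space_stdnorm: "prob_space stdnorm"
  unfolding stdnorm_def by (rule prob_space_normal_density) simp

interpretation stdnorm: prob_space stdnorm
  by (rule prob_space_stdnorm)

lemma prob_space_gaussian: "prob_space (gaussian I)"
  by (intro prob_space_PiM prob_space_stdnorm)

lemma integral_stdnorm:
  assumes [measurable]: "f \<in> borel_measurable borel"
  shows "(\<integral>x. f x \<partial>stdnorm) = (\<integral>x. std_normal_density x * f x \<partial>lborel)"
  unfolding stdnorm_def by (subst integral_density) auto

lemma integrable_stdnorm:
  fixes f :: "real \<Rightarrow> real"
  assumes [measurable]: "f \<in> borel_measurable borel"
  shows "integrable stdnorm f \<longleftrightarrow> integrable lborel (\<lambda>x. std_normal_density x * f x)"
  unfolding stdnorm_def by (subst integrable_density) auto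

lemma nn_integral_stdnorm:
  fixes f :: "real \<Rightarrow> ennreal"
  assumes [measurable]: "f \<in> borel_measurable borel"
  shows "(\<integral>\<^sup>+x. f x \<partial>stdnorm) = (\<integral>\<^sup>+x. ennreal (std_normal_density x) * f x \<partial>lborel)"
  unfolding stdnorm_def by (subst nn_integral_density) auto

lemma stdnorm_integrable_power_abs: "integrable stdnorm (\<lambda>x. \<bar>x\<bar> ^ k)"
  by (subst integrable_stdnorm) (auto intro: integrable_std_normal_moment_abs)

lemma stdnorm_integrable_power: "integrable stdnorm (\<lambda>x. x ^ k)"
  by (subst integrable_stdnorm) (auto intro: integrable_std_normal_moment)

lemma stdnorm_mean: "(\<integral>x. x \<partial>stdnorm) = 0"
  using integral_std_normal_moment_odd[of 0] by (subst integral_stdnorm) auto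

lemma stdnorm_second_moment: "(\<integral>x. x\<^sup>2 \<partial>stdnorm) = 1"
  using integral_std_normal_moment_even[of 1] by (subst integral_stdnorm) (auto simp: eval_nat_numeral)

lemma stdnorm_mgf:
  "integrable stdnorm (\<lambda>x. exp (a * x))" "(\<integral>x. exp (a * x) \<partial>stdnorm) = exp (a\<^sup>2 / 2)"
proof -
  have eq: "std_normal_density x * exp (a * x) = exp (a\<^sup>2 / 2) * normal_density a 1 x" for x
    by (simp add: normal_density_def std_normal_density_def exp_add[symmetric] power2_eq_square field_simps
        flip: exp_add exp_minus)
  show "integrable stdnorm (\<lambda>x. exp (a * x))"
    by (subst integrable_stdnorm) (auto simp: eq)
  show "(\<integral>x. exp (a * x) \<partial>stdnorm) = exp (a\<^sup>2 / 2)"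
    by (subst integral_stdnorm) (auto simp: eq)
qed

lemma stdnorm_uminus: "distr stdnorm stdnorm uminus = stdnorm"
proof (rule measure_eqI)
  fix A assume "A \<in> sets (distr stdnorm stdnorm uminus)"
  then have A [measurable]: "A \<in> sets borel" by simp
  have "emeasure (distr stdnorm stdnorm uminus) A = (\<integral>\<^sup>+x. indicator A (- x) \<partial>stdnorm)"
    by (subst nn_integral_indicator[symmetric], simp, subst nn_integral_distr) auto
  also have "\<dots> = (\<integral>\<^sup>+x. ennreal (std_normal_density x) * indicator A (- x) \<partial>lborel)"
    by (subst nn_integral_stdnorm) auto
  also have "\<dots> = (\<integral>\<^sup>+x. ennreal (std_normal_density x) * indicator A x \<partial>lborel)"
    by (subst nn_integral_real_affine[where c="-1" and t=0]) (auto simp: std_normal_density_def)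
  also have "\<dots> = (\<integral>\<^sup>+x. indicator A x \<partial>stdnorm)"
    by (subst nn_integral_stdnorm) auto
  finally show "emeasure (distr stdnorm stdnorm uminus) A = emeasure stdnorm A"
    by simp
qed simp

text \<open>By symmetry the two half-lines share the second moment 1 equally. This is the
  statistical dimension of a half-line.\<close>

lemma stdnorm_second_moment_neg_part: "(\<integral>x. (min x 0)\<^sup>2 \<partial>stdnorm) = 1 / 2"
proof -
  have int: "integrable stdnorm (\<lambda>x. (min x 0)\<^sup>2)" "integrable stdnorm (\<lambda>x. (min (- x) 0)\<^sup>2)"
    by (rule Bochner_Integration.integrable_bound[OF stdnorm_integrable_power[of 2]];
        auto simp: min_def)+
  have "(\<integral>x. (min x 0)\<^sup>2 \<partial>stdnorm) = (\<integral>x. (min x 0)\<^sup>2 \<partial>distr stdnorm stdnorm uminus)"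
    by (simp add: stdnorm_uminus)
  also have "\<dots> = (\<integral>x. (min (- x) 0)\<^sup>2 \<partial>stdnorm)"
    by (subst integral_distr) auto
  finally have "2 * (\<integral>x. (min x 0)\<^sup>2 \<partial>stdnorm) = (\<integral>x. (min x 0)\<^sup>2 + (min (- x) 0)\<^sup>2 \<partial>stdnorm)"
    using int by simp
  also have "\<dots> = (\<integral>x. x\<^sup>2 \<partial>stdnorm)"
    by (intro Bochner_Integration.integral_cong) (auto simp: min_def)
  finally show ?thesis by (simp add: stdnorm_second_moment)
qed

text \<open>A rotation with \<open>c \<noteq> 0\<close> is a composition of two substitutions in one
  variable each, so Fubini and affine changes of variable on the line suffice.\<close>

lemma nn_integral_rotation_stdnorm:
  fixes c s :: real
  assumes c: "c \<noteq> 0" and cs: "c\<^sup>2 + s\<^sup>2 = 1"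
    and f [measurable]: "f \<in> borel_measurable (borel \<Otimes>\<^sub>M borel)"
  shows "(\<integral>\<^sup>+x. \<integral>\<^sup>+y. f (c * x + s * y, c * y - s * x) \<partial>stdnorm \<partial>stdnorm) =
         (\<integral>\<^sup>+x. \<integral>\<^sup>+y. f (x, y) \<partial>stdnorm \<partial>stdnorm)"
proof -
  define q where "q x = ennreal (std_normal_density x)" for x
  have q [measurable]: "q \<in> borel_measurable borel" unfolding q_def by simp
  define h where "h x y = q x * (q y * f (x, y))" for x y
  have h [measurable]: "(\<lambda>(x, y). h x y) \<in> borel_measurable (borel \<Otimes>\<^sub>M borel)"
    unfolding h_def by measurable
  have double: "(\<integral>\<^sup>+x. \<integral>\<^sup>+y. g (x, y) \<partial>stdnorm \<partial>stdnorm) =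
      (\<integral>\<^sup>+x. \<integral>\<^sup>+y. q x * (q y * g (x, y)) \<partial>lborel \<partial>lborel)"
    if [measurable]: "g \<in> borel_measurable (borel \<Otimes>\<^sub>M borel)" for g
    unfolding stdnorm_def q_def
    by (subst nn_integral_density, measurable, subst nn_integral_density, measurable)
      (auto intro!: nn_integral_cong nn_integral_cmult[symmetric])
  have qq: "q x * q y = q (c * x + s * y) * q (c * y - s * x)" for x y
  proof -
    have "(c * x + s * y)\<^sup>2 + (c * y - s * x)\<^sup>2 = (c\<^sup>2 + s\<^sup>2) * (x\<^sup>2 + y\<^sup>2)"
      by (simp add: power2_eq_square algebra_simps)
    then have "x\<^sup>2 + y\<^sup>2 = (c * x + s * y)\<^sup>2 + (c * y - s * x)\<^sup>2" using cs by simp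
    then have "exp (- x\<^sup>2 / 2) * exp (- y\<^sup>2 / 2) =
        exp (- (c * x + s * y)\<^sup>2 / 2) * exp (- (c * y - s * x)\<^sup>2 / 2)"
      by (simp flip: exp_add add_divide_distrib)
    then show ?thesis
      unfolding q_def std_normal_density_def by (simp add: ennreal_mult[symmetric])
  qed
  have "(\<integral>\<^sup>+x. \<integral>\<^sup>+y. f (c * x + s * y, c * y - s * x) \<partial>stdnorm \<partial>stdnorm) =
     (\<integral>\<^sup>+x. \<integral>\<^sup>+y. h (c * x + s * y) (c * y - s * x) \<partial>lborel \<partial>lborel)"
  proof -
    have "q x * (q y * f (c * x + s * y, c * y - s * x)) = h (c * x + s * y) (c * y - s * x)" for x y
      unfolding h_def mult.assoc[symmetric] qq[of x y] ..
    then show ?thesis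
      using double[of "\<lambda>(x, y). f (c * x + s * y, c * y - s * x)"] by simp
  qed
  also have "\<dots> = (\<integral>\<^sup>+y. \<integral>\<^sup>+x. h (c * x + s * y) (c * y - s * x) \<partial>lborel \<partial>lborel)"
    by (rule lborel_pair.Fubini'[symmetric]) simp
  \<comment> \<open>Substitute \<open>u = c * x + s * y\<close> at fixed \<open>y\<close>; the
    second argument then reads \<open>(y - s * u) / c\<close> because
    \<open>1 - s\<^sup>2 = c\<^sup>2\<close>.\<close>
  also have "\<dots> = (\<integral>\<^sup>+y. (1 / \<bar>c\<bar>) * \<integral>\<^sup>+u. h u ((y - s * u) / c) \<partial>lborel \<partial>lborel)"
  proof (rule nn_integral_cong)
    fix y :: real
    have "(y - s * (c * x + s * y)) / c = c * y - s * x" for x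
    proof -
      have "y - s * (c * x + s * y) = y * (1 - s\<^sup>2) - s * c * x" by (simp add: power2_eq_square algebra_simps)
      also have "1 - s\<^sup>2 = c\<^sup>2" using cs by simp
      finally show ?thesis using c by (simp add: power2_eq_square field_simps)
    qed
    then have "(\<integral>\<^sup>+u. h u ((y - s * u) / c) \<partial>lborel) =
        ennreal \<bar>c\<bar> * (\<integral>\<^sup>+x. h (c * x + s * y) (c * y - s * x) \<partial>lborel)"
      using c by (subst nn_integral_real_affine[where c=c and t="s * y"]) (simp_all add: add.commute[of "s * y"])
    then show "(\<integral>\<^sup>+x. h (c * x + s * y) (c * y - s * x) \<partial>lborel) =
        (1 / \<bar>c\<bar>) * (\<integral>\<^sup>+u. h u ((y - s * u) / c) \<partial>lborel)"
      using c by (simp add: mult.assoc[symmetric] ennreal_mult[symmetric])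
  qed
  also have "\<dots> = (1 / \<bar>c\<bar>) * (\<integral>\<^sup>+y. \<integral>\<^sup>+u. h u ((y - s * u) / c) \<partial>lborel \<partial>lborel)"
    by (rule nn_integral_cmult) measurable
  also have "(\<integral>\<^sup>+y. \<integral>\<^sup>+u. h u ((y - s * u) / c) \<partial>lborel \<partial>lborel) =
      (\<integral>\<^sup>+u. \<integral>\<^sup>+y. h u ((y - s * u) / c) \<partial>lborel \<partial>lborel)"
    by (rule lborel_pair.Fubini') simp
  also have "(1 / \<bar>c\<bar>) * \<dots> = (\<integral>\<^sup>+u. (1 / \<bar>c\<bar>) * \<integral>\<^sup>+y. h u ((y - s * u) / c) \<partial>lborel \<partial>lborel)"
    by (rule nn_integral_cmult[symmetric]) measurable
  also have "\<dots> = (\<integral>\<^sup>+u. \<integral>\<^sup>+v. h u v \<partial>lborel \<partial>lborel)"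
  proof (rule nn_integral_cong)
    fix u :: real
    show "(1 / \<bar>c\<bar>) * (\<integral>\<^sup>+y. h u ((y - s * u) / c) \<partial>lborel) = (\<integral>\<^sup>+v. h u v \<partial>lborel)"
      using c by (subst (2) nn_integral_real_affine[where c="1/c" and t="- s * u / c"])
        (auto simp: diff_divide_distrib)
  qed
  also have "\<dots> = (\<integral>\<^sup>+x. \<integral>\<^sup>+y. f (x, y) \<partial>stdnorm \<partial>stdnorm)"
    using double[OF f] by (simp add: h_def)
  finally show ?thesis .
qed

lemma distr_rotation_stdnorm:
  fixes c s :: real
  assumes c: "c \<noteq> 0" and cs: "c\<^sup>2 + s\<^sup>2 = 1"
  shows "distr (stdnorm \<Otimes>\<^sub>M stdnorm) (stdnorm \<Otimes>\<^sub>M stdnorm)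
    (\<lambda>(x, y). (c * x + s * y, c * y - s * x)) = stdnorm \<Otimes>\<^sub>M stdnorm" (is "distr ?P ?P ?r = _")
proof (rule measure_eqI)
  fix A assume "A \<in> sets (distr ?P ?P ?r)"
  then have A [measurable]: "A \<in> sets (borel \<Otimes>\<^sub>M borel)" by (simp cong: sets_pair_measure_cong)
  have "emeasure (distr ?P ?P ?r) A = (\<integral>\<^sup>+z. indicator A (?r z) \<partial>?P)"
    by (subst nn_integral_indicator[symmetric], simp cong: sets_pair_measure_cong, subst nn_integral_distr) auto
  also have "\<dots> = (\<integral>\<^sup>+x. \<integral>\<^sup>+y. indicator A (c * x + s * y, c * y - s * x) \<partial>stdnorm \<partial>stdnorm)"
    by (subst stdnorm.nn_integral_fst[symmetric]) auto
  also have "\<dots> = (\<integral>\<^sup>+x. \<integral>\<^sup>+y. indicator A (x, y) \<partial>stdnorm \<partial>stdnorm)"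
    by (rule nn_integral_rotation_stdnorm[OF c cs, of "indicator A"]) simp
  also have "\<dots> = emeasure ?P A"
    by (subst stdnorm.nn_integral_fst) (auto cong: sets_pair_measure_cong)
  finally show "emeasure (distr ?P ?P ?r) A = emeasure ?P A" .
qed simp

section \<open>Reindexing, splitting and rotating Gaussian vectors\<close>

lemma indep_vars_gaussian_coords:
  "prob_space.indep_vars (gaussian I) (\<lambda>_. stdnorm) (\<lambda>i \<omega>. \<omega> i) I"
proof (cases "I = {}")
  case True
  interpret prob_space "gaussian I" by (rule prob_space_gaussian)
  show ?thesis unfolding indep_vars_def indep_sets_def using True by auto
next
  case False
  interpret prob_space "gaussian I" by (rule prob_space_gaussian)
  have "distr (gaussian I) (gaussian I) (\<lambda>\<omega>. \<lambda>i\<in>I. \<omega> i) = distr (gaussian I) (gaussian I) (\<lambda>\<omega>. \<omega>)"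
    by (rule distr_cong) (auto simp: space_PiM PiE_def extensional_restrict)
  then show ?thesis
    using False distr_PiM_component[of I "\<lambda>_. stdnorm", OF prob_space_stdnorm]
    by (subst indep_vars_iff_distr_eq_PiM')
      (auto cong: PiM_cong intro!: PiM_cong)
qed

lemma distr_gaussian_reindex:
  assumes "inj_on f I" "f \<in> I \<rightarrow> J"
  shows "distr (gaussian J) (gaussian I) (\<lambda>\<omega>. \<lambda>i\<in>I. \<omega> (f i)) = gaussian I"
  using distr_PiM_reindex[of J "\<lambda>_. stdnorm" f I] assms prob_space_stdnorm by simp

text \<open>Different rows read disjoint sets of coordinates, hence are independent, and each is a
  reindexed Gaussian vector. The characterisation of independence by a product law needs a nonempty
  index set, so \<open>I = {}\<close> is done by hand.\<close>

lemma distr_gaussian_blocks: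
  "distr (gaussian (I \<times> J)) (PiM I (\<lambda>_. gaussian J)) (\<lambda>\<omega>. \<lambda>i\<in>I. \<lambda>j\<in>J. \<omega> (i, j)) =
    PiM I (\<lambda>_. gaussian J)"
proof (cases "I = {}")
  case True
  interpret G: prob_space "gaussian (I \<times> J)" by (rule prob_space_gaussian)
  interpret P: prob_space "PiM I (\<lambda>_. gaussian J)"
    by (intro prob_space_PiM prob_space_gaussian)
  interpret D: prob_space "distr (gaussian (I \<times> J)) (PiM I (\<lambda>_. gaussian J)) (\<lambda>\<omega>. \<lambda>i\<in>I. \<lambda>j\<in>J. \<omega> (i, j))"
    by (rule G.prob_space_distr) (use True in simp)
  show ?thesis
  proof (rule measure_eqI)
    fix A assume "A \<in> sets (distr (gaussian (I \<times> J)) (PiM I (\<lambda>_. gaussian J)) (\<lambda>\<omega>. \<lambda>i\<in>I. \<lambda>j\<in>J. \<omega> (i, j)))"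
    then have "A = {} \<or> A = space (PiM I (\<lambda>_. gaussian J))"
      using True by (auto simp: sets_PiM_empty space_PiM_empty)
    then show "emeasure (distr (gaussian (I \<times> J)) (PiM I (\<lambda>_. gaussian J)) (\<lambda>\<omega>. \<lambda>i\<in>I. \<lambda>j\<in>J. \<omega> (i, j))) A =
        emeasure (PiM I (\<lambda>_. gaussian J)) A"
      using P.emeasure_space_1 D.emeasure_space_1 by auto
  qed simp
next
  case False
  interpret prob_space "gaussian (I \<times> J)" by (rule prob_space_gaussian)
  have "indep_vars (\<lambda>i. gaussian ({i} \<times> J)) (\<lambda>i \<omega>. \<lambda>p\<in>{i} \<times> J. \<omega> p) I"
    by (rule indep_vars_restrict[OF indep_vars_gaussian_coords]) (auto simp: disjoint_family_on_def)
  then have "indep_vars (\<lambda>_. gaussian J) (\<lambda>i \<omega>. (\<lambda>\<eta>. \<lambda>j\<in>J. \<eta> (i, j)) (\<lambda>p\<in>{i} \<times> J. \<omega> p)) I"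
    by (rule indep_vars_compose2) measurable
  then have ind: "indep_vars (\<lambda>_. gaussian J) (\<lambda>i \<omega>. \<lambda>j\<in>J. \<omega> (i, j)) I"
    by (rule indep_vars_cong[THEN iffD1, rotated 3]) (auto simp: fun_eq_iff)
  have "distr (gaussian (I \<times> J)) (PiM I (\<lambda>_. gaussian J)) (\<lambda>\<omega>. \<lambda>i\<in>I. \<lambda>j\<in>J. \<omega> (i, j)) =
      PiM I (\<lambda>i. distr (gaussian (I \<times> J)) (gaussian J) (\<lambda>\<omega>. \<lambda>j\<in>J. \<omega> (i, j)))"
    using ind False by (subst (asm) indep_vars_iff_distr_eq_PiM') auto
  also have "\<dots> = PiM I (\<lambda>_. gaussian J)"
    by (intro PiM_cong refl distr_gaussian_reindex) (auto simp: inj_on_def)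
  finally show ?thesis .
qed

lemma distr_gaussian_pair:
  fixes f g :: "'i \<Rightarrow> 'l"
  assumes f: "inj_on f I" "f \<in> I \<rightarrow> L" and g: "inj_on g J" "g \<in> J \<rightarrow> L"
    and disj: "f ` I \<inter> g ` J = {}"
  shows "distr (gaussian L) (gaussian I \<Otimes>\<^sub>M gaussian J) (\<lambda>\<omega>. (\<lambda>i\<in>I. \<omega> (f i), \<lambda>j\<in>J. \<omega> (g j))) =
    gaussian I \<Otimes>\<^sub>M gaussian J"
proof -
  interpret prob_space "gaussian L" by (rule prob_space_gaussian)
  have "indep_var (gaussian (f ` I)) (\<lambda>\<omega>. \<lambda>p\<in>f ` I. \<omega> p) (gaussian (g ` J)) (\<lambda>\<omega>. \<lambda>p\<in>g ` J. \<omega> p)"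
    using f g disj by (intro indep_var_restrict[OF indep_vars_gaussian_coords]) auto
  then have "indep_var (gaussian I) ((\<lambda>\<eta>. \<lambda>i\<in>I. \<eta> (f i)) \<circ> (\<lambda>\<omega>. \<lambda>p\<in>f ` I. \<omega> p))
      (gaussian J) ((\<lambda>\<eta>. \<lambda>j\<in>J. \<eta> (g j)) \<circ> (\<lambda>\<omega>. \<lambda>p\<in>g ` J. \<omega> p))"
    by (rule indep_var_compose) (auto intro!: measurable_restrict)
  moreover have "(\<lambda>\<eta>. \<lambda>i\<in>I. \<eta> (f i)) \<circ> (\<lambda>\<omega>. \<lambda>p\<in>f ` I. \<omega> p) = (\<lambda>\<omega> :: 'l \<Rightarrow> real. \<lambda>i\<in>I. \<omega> (f i))"
    "(\<lambda>\<eta>. \<lambda>j\<in>J. \<eta> (g j)) \<circ> (\<lambda>\<omega>. \<lambda>p\<in>g ` J. \<omega> p) = (\<lambda>\<omega> :: 'l \<Rightarrow> real. \<lambda>j\<in>J. \<omega> (g j))"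
    by (auto simp: fun_eq_iff)
  ultimately have "indep_var (gaussian I) (\<lambda>\<omega>. \<lambda>i\<in>I. \<omega> (f i)) (gaussian J) (\<lambda>\<omega>. \<lambda>j\<in>J. \<omega> (g j))"
    by simp
  then show ?thesis
    by (simp add: indep_var_distribution_eq distr_gaussian_reindex[OF f] distr_gaussian_reindex[OF g])
qed

text \<open>Both the vector of pairs and the pair of vectors are read off one Gaussian vector
  indexed by \<open>I \<times> UNIV\<close> over \<open>bool\<close>. This regrouping lifts the
  planar rotation to vectors.\<close>

lemma distr_gaussian_pairing:
  assumes "finite I"
  shows "distr (PiM I (\<lambda>_. stdnorm \<Otimes>\<^sub>M stdnorm)) (gaussian I \<Otimes>\<^sub>M gaussian I)
    (\<lambda>\<omega>. (\<lambda>i\<in>I. fst (\<omega> i), \<lambda>i\<in>I. snd (\<omega> i))) = gaussian I \<Otimes>\<^sub>M gaussian I"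
proof -
  let ?B = "UNIV :: bool set"
  let ?e = "\<lambda>\<eta>. (\<eta> True, \<eta> False) :: real \<times> real"
  let ?U = "\<lambda>\<omega>. (\<lambda>i\<in>I. fst (\<omega> i), \<lambda>i\<in>I. snd (\<omega> i)) :: ('a \<Rightarrow> real) \<times> ('a \<Rightarrow> real)"
  have e: "distr (gaussian ?B) (stdnorm \<Otimes>\<^sub>M stdnorm) ?e = stdnorm \<Otimes>\<^sub>M stdnorm"
  proof -
    interpret prob_space "gaussian ?B" by (rule prob_space_gaussian)
    have "indep_var (gaussian {True}) (\<lambda>\<omega>. \<lambda>p\<in>{True}. \<omega> p) (gaussian {False}) (\<lambda>\<omega>. \<lambda>p\<in>{False}. \<omega> p)"
      by (intro indep_var_restrict[OF indep_vars_gaussian_coords]) auto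
    then have "indep_var stdnorm ((\<lambda>\<eta>. \<eta> True) \<circ> (\<lambda>\<omega>. \<lambda>p\<in>{True}. \<omega> p))
        stdnorm ((\<lambda>\<eta>. \<eta> False) \<circ> (\<lambda>\<omega>. \<lambda>p\<in>{False}. \<omega> p))"
      by (rule indep_var_compose) auto
    then have "indep_var stdnorm (\<lambda>\<omega>. \<omega> True) stdnorm (\<lambda>\<omega>. \<omega> False)"
      by (simp add: comp_def)
    then show ?thesis
      using distr_PiM_component[of ?B "\<lambda>_. stdnorm" True] distr_PiM_component[of ?B "\<lambda>_. stdnorm" False]
        prob_space_stdnorm
      by (simp add: indep_var_distribution_eq)
  qed
  have [measurable]: "compose I ?e \<in> measurable (PiM I (\<lambda>_. gaussian ?B)) (PiM I (\<lambda>_. stdnorm \<Otimes>\<^sub>M stdnorm))"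
    unfolding compose_def
    by (intro measurable_restrict measurable_Pair;
        rule measurable_compose[OF measurable_component_singleton], assumption, simp)
  have "gaussian I \<Otimes>\<^sub>M gaussian I = distr (gaussian (I \<times> ?B)) (gaussian I \<Otimes>\<^sub>M gaussian I)
      (\<lambda>\<omega>. (\<lambda>i\<in>I. \<omega> (i, True), \<lambda>i\<in>I. \<omega> (i, False)))"
    by (rule distr_gaussian_pair[symmetric]) (auto simp: inj_on_def)
  also have "\<dots> = distr (gaussian (I \<times> ?B)) (gaussian I \<Otimes>\<^sub>M gaussian I)
      (?U \<circ> (compose I ?e \<circ> (\<lambda>\<omega>. \<lambda>i\<in>I. \<lambda>b\<in>?B. \<omega> (i, b))))"
    by (rule distr_cong) (auto simp: compose_def fun_eq_iff)
  also have "\<dots> = distr (distr (distr (gaussian (I \<times> ?B)) (PiM I (\<lambda>_. gaussian ?B)) (\<lambda>\<omega>. \<lambda>i\<in>I. \<lambda>b\<in>?B. \<omega> (i, b)))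
      (PiM I (\<lambda>_. stdnorm \<Otimes>\<^sub>M stdnorm)) (compose I ?e)) (gaussian I \<Otimes>\<^sub>M gaussian I) ?U"
    by (simp add: distr_distr comp_assoc)
  also have "\<dots> = distr (distr (PiM I (\<lambda>_. gaussian ?B))
      (PiM I (\<lambda>_. stdnorm \<Otimes>\<^sub>M stdnorm)) (compose I ?e)) (gaussian I \<Otimes>\<^sub>M gaussian I) ?U"
    by (simp only: distr_gaussian_blocks)
  also have "distr (PiM I (\<lambda>_. gaussian ?B)) (PiM I (\<lambda>_. stdnorm \<Otimes>\<^sub>M stdnorm)) (compose I ?e) =
      PiM I (\<lambda>_. stdnorm \<Otimes>\<^sub>M stdnorm)"
    by (subst distr_PiM_finite_prob_space')
      (auto simp: assms e intro!: prob_space_gaussian prob_space_pair prob_space_stdnorm)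
  finally show ?thesis ..
qed

text \<open>Regrouped into pairs, this is the planar rotation applied independently in every
  coordinate.\<close>

lemma distr_rotation_gaussian:
  fixes c s :: real
  assumes I: "finite I" and c: "c \<noteq> 0" and cs: "c\<^sup>2 + s\<^sup>2 = 1"
  shows "distr (gaussian I \<Otimes>\<^sub>M gaussian I) (gaussian I \<Otimes>\<^sub>M gaussian I)
    (\<lambda>(x, y). (\<lambda>i\<in>I. c * x i + s * y i, \<lambda>i\<in>I. c * y i - s * x i)) = gaussian I \<Otimes>\<^sub>M gaussian I"
    (is "distr ?G ?G ?R = _")
proof -
  let ?Q = "PiM I (\<lambda>_. stdnorm \<Otimes>\<^sub>M stdnorm)"
  let ?r = "\<lambda>(x, y). (c * x + s * y, c * y - s * x)"
  let ?U = "\<lambda>\<omega>. (\<lambda>i\<in>I. fst (\<omega> i), \<lambda>i\<in>I. snd (\<omega> i)) :: ('a \<Rightarrow> real) \<times> ('a \<Rightarrow> real)"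
  have R [measurable]: "?R \<in> measurable ?G ?G" by measurable
  have U [measurable]: "?U \<in> measurable ?Q ?G" by measurable
  have r [measurable]: "compose I ?r \<in> measurable ?Q ?Q" unfolding compose_def by measurable
  have "distr ?G ?G ?R = distr (distr ?Q ?G ?U) ?G ?R"
    by (simp only: distr_gaussian_pairing[OF I])
  also have "\<dots> = distr ?Q ?G (?R \<circ> ?U)"
    by (rule distr_distr) measurable
  also have "\<dots> = distr ?Q ?G (?U \<circ> compose I ?r)"
    by (rule distr_cong) (auto simp: compose_def fun_eq_iff split: prod.split)
  also have "\<dots> = distr (distr ?Q ?Q (compose I ?r)) ?G ?U"
    by (rule distr_distr[symmetric]) measurable
  also have "distr ?Q ?Q (compose I ?r) = ?Q"
    by (subst distr_PiM_finite_prob_space')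
      (auto simp: I distr_rotation_stdnorm[OF c cs] intro!: prob_space_pair prob_space_stdnorm)
  also have "distr ?Q ?G ?U = ?G"
    by (rule distr_gaussian_pairing[OF I])
  finally show ?thesis .
qed

section \<open>Gaussian concentration\<close>

lemma nn_integral_gaussian_prod:
  assumes "finite I" "\<And>i. i \<in> I \<Longrightarrow> f i \<in> borel_measurable borel"
  shows "(\<integral>\<^sup>+x. (\<Prod>i\<in>I. f i (x i)) \<partial>gaussian I) = (\<Prod>i\<in>I. \<integral>\<^sup>+x. f i x \<partial>stdnorm)"
proof -
  interpret product_sigma_finite "\<lambda>_. stdnorm" by unfold_locales
  show ?thesis by (rule product_nn_integral_prod) (use assms in auto)
qed

lemma nn_integral_gaussian_exp:
  assumes "finite I"
  shows "(\<integral>\<^sup>+x. exp (\<Sum>i\<in>I. a i * x i) \<partial>gaussian I) = exp ((\<Sum>i\<in>I. (a i)\<^sup>2) / 2)"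
proof -
  have "(\<integral>\<^sup>+x. exp (\<Sum>i\<in>I. a i * x i) \<partial>gaussian I) = (\<integral>\<^sup>+x. (\<Prod>i\<in>I. ennreal (exp (a i * x i))) \<partial>gaussian I)"
    using assms by (simp add: exp_sum prod_ennreal)
  also have "\<dots> = (\<Prod>i\<in>I. \<integral>\<^sup>+x. ennreal (exp (a i * x)) \<partial>stdnorm)"
    using assms by (rule nn_integral_gaussian_prod) simp
  also have "\<dots> = (\<Prod>i\<in>I. ennreal (exp ((a i)\<^sup>2 / 2)))"
    by (simp add: nn_integral_eq_integral stdnorm_mgf)
  also have "\<dots> = exp ((\<Sum>i\<in>I. (a i)\<^sup>2) / 2)"
    using assms by (simp add: prod_ennreal exp_sum[symmetric] sum_divide_distrib)
  finally show ?thesis .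
qed

text \<open>Rests on exp (- z) \<ge> 1 - z for z = a |x|. The bound tends to 1 as a tends to 0, so
  its power disappears in the limit taken in \<open>gaussian_exp_difference\<close>; the plain
  estimate by exp (a x) + exp (- a x) would leave a factor 2 per coordinate.\<close>

lemma stdnorm_exp_abs_le:
  assumes "0 \<le> a"
  shows "(\<integral>\<^sup>+x. exp (a * \<bar>x\<bar>) \<partial>stdnorm) \<le> 2 * exp (a\<^sup>2 / 2) - 1 + a * (\<integral>x. \<bar>x\<bar> \<partial>stdnorm)"
proof -
  have int: "integrable stdnorm (\<lambda>x. exp (a * x) + exp (- a * x) - 1 + a * \<bar>x\<bar>)"
    using stdnorm_mgf(1)[of a] stdnorm_mgf(1)[of "- a"] stdnorm_integrable_power_abs[of 1] by simp
  have le: "exp (a * \<bar>x\<bar>) \<le> exp (a * x) + exp (- a * x) - 1 + a * \<bar>x\<bar>" for x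
  proof -
    have "1 + a * x \<le> exp (a * x)" "1 + - a * x \<le> exp (- a * x)" by (rule exp_ge_add_one_self)+
    moreover have "a * \<bar>x\<bar> = a * x \<or> a * \<bar>x\<bar> = - a * x" by (auto simp: abs_if)
    ultimately show ?thesis by (elim disjE; simp only:; linarith)
  qed
  have "(\<integral>\<^sup>+x. exp (a * \<bar>x\<bar>) \<partial>stdnorm) \<le> (\<integral>\<^sup>+x. exp (a * x) + exp (- a * x) - 1 + a * \<bar>x\<bar> \<partial>stdnorm)"
    by (intro nn_integral_mono ennreal_leI le)
  also have "\<dots> = ennreal (\<integral>x. exp (a * x) + exp (- a * x) - 1 + a * \<bar>x\<bar> \<partial>stdnorm)"
    using le by (intro nn_integral_eq_integral int AE_I2) (meson exp_ge_zero order_trans)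
  also have "(\<integral>x. exp (a * x) + exp (- a * x) - 1 + a * \<bar>x\<bar> \<partial>stdnorm) =
      2 * exp (a\<^sup>2 / 2) - 1 + a * (\<integral>x. \<bar>x\<bar> \<partial>stdnorm)"
    using stdnorm_mgf[of a] stdnorm_mgf[of "- a"] stdnorm_integrable_power_abs[of 1]
    by (simp add: stdnorm.prob_space[unfolded space_stdnorm])
  finally show ?thesis .
qed

text \<open>Jensen's inequality with \<open>N\<close> equal weights.\<close>

lemma exp_sum_le_mean_exp:
  fixes a :: "nat \<Rightarrow> real"
  assumes "N > 0"
  shows "exp (\<Sum>k<N. a k) \<le> (\<Sum>k<N. exp (N * a k)) / N"
proof -
  have "exp (\<Sum>k<N. (1 / N) *\<^sub>R (N * a k)) \<le> (\<Sum>k<N. (1 / N) * exp (N * a k))"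
    by (rule convex_on_sum[OF _ _ exp_convex]) (use assms in auto)
  then show ?thesis using assms by (simp add: sum_divide_distrib)
qed

text \<open>\<open>N\<close> rotations by \<open>\<theta>\<close> make a quarter turn. The 4 comes
  from the crude pi \<le> 4, and the last bound says that the contraction by the cosines, added over
  all steps, is only of order 1 / N.\<close>

lemma sin_cos_step_bounds:
  assumes N: "N > 0" and th: "\<theta> = pi / (2 * real N)"
  shows "(real N * sin \<theta>)\<^sup>2 \<le> 4" "0 \<le> real N * (1 - cos \<theta>)" "real N * (1 - cos \<theta>) \<le> 2 / real N"
proof -
  have th0: "0 \<le> \<theta>" using assms by simp
  have nt: "real N * \<theta> = pi / 2" using assms by simp
  have pi: "pi \<le> 4" by (rule pi_less_4[THEN less_imp_le])
  have "\<bar>sin \<theta>\<bar> \<le> \<theta>" using abs_sin_x_le_abs_x[of \<theta>] th0 by simp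
  then have "real N * \<bar>sin \<theta>\<bar> \<le> real N * \<theta>" by (intro mult_left_mono) auto
  then have "\<bar>real N * sin \<theta>\<bar> \<le> 2" using nt pi by (simp add: abs_mult)
  then show "(real N * sin \<theta>)\<^sup>2 \<le> 4" using abs_le_square_iff[of "real N * sin \<theta>" 2] by simp
  show "0 \<le> real N * (1 - cos \<theta>)" by simp
  have half: "1 - cos \<theta> = 2 * (sin (\<theta> / 2))\<^sup>2"
    using cos_double_sin[of "\<theta> / 2"] by simp
  have "\<bar>sin (\<theta> / 2)\<bar> \<le> \<bar>\<theta> / 2\<bar>" by (rule abs_sin_x_le_abs_x)
  then have "(sin (\<theta> / 2))\<^sup>2 \<le> (\<theta> / 2)\<^sup>2" using abs_le_square_iff by blast
  then have "1 - cos \<theta> \<le> \<theta>\<^sup>2 / 2" unfolding half by (simp add: power2_eq_square)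
  then have "real N * (1 - cos \<theta>) \<le> real N * (\<theta>\<^sup>2 / 2)" by (intro mult_left_mono) auto
  also have "\<dots> = (pi / 2)\<^sup>2 / (2 * real N)"
    using N unfolding th by (simp add: power2_eq_square field_simps)
  also have "\<dots> \<le> 2\<^sup>2 / (2 * real N)"
    using pi by (intro divide_right_mono power_mono) auto
  finally show "real N * (1 - cos \<theta>) \<le> 2 / real N" by simp
qed

text \<open>The right side is the square of 2 sinh (z / 2). Used to turn bounds on two exponential
  moments into a variance bound.\<close>

lemma square_le_exp_plus_exp_minus: "z\<^sup>2 \<le> exp z + exp (- z) - (2::real)"
proof -
  \<comment> \<open>With p(u) = 1 + u + u^2 / 2: exp u \<ge> p(u), and exp (- u) \<le> 1 / p(u)
    \<le> p(- u), since p(u) p(- u) = 1 + u^4 / 4.\<close>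
  have *: "2 * u \<le> exp u - exp (- u)" if "0 \<le> u" for u :: real
  proof -
    let ?p = "1 + u + u\<^sup>2 / 2"
    have p: "?p \<le> exp u" using exp_lower_Taylor_quadratic[OF that] by simp
    have p0: "0 < ?p" using that by (simp add: add_pos_nonneg)
    have "exp (- u) \<le> 1 / ?p"
      using p p0 by (simp add: exp_minus inverse_eq_divide frac_le)
    also have "\<dots> \<le> 1 - u + u\<^sup>2 / 2"
    proof -
      have "(1 - u + u\<^sup>2 / 2) * ?p = 1 + (u\<^sup>2)\<^sup>2 / 4" by (simp add: power2_eq_square field_simps)
      then show ?thesis using p0 by (simp add: divide_le_eq)
    qed
    finally show ?thesis using p by simp
  qed
  have "\<bar>z\<bar>\<^sup>2 \<le> (exp (\<bar>z\<bar> / 2) - exp (- (\<bar>z\<bar> / 2)))\<^sup>2"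
    using *[of "\<bar>z\<bar> / 2"] by (intro power_mono) auto
  also have "\<dots> = exp \<bar>z\<bar> + exp (- \<bar>z\<bar>) - 2"
  proof -
    let ?p = "exp (\<bar>z\<bar> / 2)" and ?q = "exp (- (\<bar>z\<bar> / 2))"
    have "(?p - ?q)\<^sup>2 = ?p * ?p + ?q * ?q - 2 * (?p * ?q)"
      by (simp add: power2_eq_square algebra_simps)
    moreover have "?p * ?p = exp \<bar>z\<bar>" "?q * ?q = exp (- \<bar>z\<bar>)" "?p * ?q = 1"
      by (simp_all flip: exp_add)
    ultimately show ?thesis by simp
  qed
  finally show ?thesis by (cases "0 \<le> z") auto
qed

text \<open>Discretisation of the Maurey-Pisier rotation argument: the subgradient inequality replaces
  the derivative along the path, so \<open>F\<close> need not be differentiable.\<close>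

lemma gaussian_exp_difference_step:
  fixes F :: "('i \<Rightarrow> real) \<Rightarrow> real" and S :: "('i \<Rightarrow> real) \<Rightarrow> 'i \<Rightarrow> real"
  assumes I: "finite I"
    and F [measurable]: "F \<in> borel_measurable (gaussian I)"
    and S [measurable]: "\<And>i. i \<in> I \<Longrightarrow> (\<lambda>x. S x i) \<in> borel_measurable (gaussian I)"
    and S1: "\<And>x. x \<in> space (gaussian I) \<Longrightarrow> (\<Sum>i\<in>I. (S x i)\<^sup>2) \<le> 1"
    and sub: "\<And>x y. x \<in> space (gaussian I) \<Longrightarrow> y \<in> space (gaussian I) \<Longrightarrow>
      F x - F y \<le> (\<Sum>i\<in>I. S x i * (x i - y i))"
    and l: "0 \<le> l" and N: "(N :: nat) > 0"
  shows "(\<integral>\<^sup>+x. \<integral>\<^sup>+y. exp (l * (F x - F y)) \<partial>gaussian I \<partial>gaussian I) \<le>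
    exp (2 * l\<^sup>2) * (2 * exp ((2 * l / N)\<^sup>2 / 2) - 1 + (2 * l / N) * (\<integral>x. \<bar>x\<bar> \<partial>stdnorm)) ^ card I"
proof -
  interpret G: prob_space "gaussian I" by (rule prob_space_gaussian)
  let ?G = "gaussian I"
  define \<theta> where "\<theta> = pi / (2 * real N)"
  note b = sin_cos_step_bounds[OF N \<theta>_def]
  \<comment> \<open>(\<open>X k\<close>, \<open>Z k\<close>) is (x, y) rotated by the angle
    \<open>k * \<theta>\<close>: \<open>X\<close> travels from x to y along a quarter circle and
    \<open>Z\<close> is its direction of travel.\<close>
  define X where "X k = (\<lambda>(x, y). \<lambda>i\<in>I. cos (k * \<theta>) * x i + sin (k * \<theta>) * y i)"
    for k :: nat and x y
  define Z where "Z k = (\<lambda>(x, y). \<lambda>i\<in>I. cos (k * \<theta>) * y i - sin (k * \<theta>) * x i)"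
    for k :: nat and x y
  \<comment> \<open>The subgradient bound for the drop of \<open>F\<close> when u is rotated by
    \<open>\<theta>\<close> towards v.\<close>
  define a where "a = (\<lambda>(u, v). \<Sum>i\<in>I. S u i * (u i - (cos \<theta> * u i + sin \<theta> * v i)))"
  have a_meas [measurable]: "a \<in> borel_measurable (?G \<Otimes>\<^sub>M ?G)"
    unfolding a_def by measurable
  have XZ_meas [measurable]: "X k \<in> measurable (?G \<Otimes>\<^sub>M ?G) ?G" "Z k \<in> measurable (?G \<Otimes>\<^sub>M ?G) ?G" for k
    unfolding X_def Z_def by measurable
  have XZ_space: "X k p \<in> space ?G" "Z k p \<in> space ?G" for k p
    by (auto simp: X_def Z_def space_PiM split: prod.split)
  have step: "F (X k p) - F (X (Suc k) p) \<le> a (X k p, Z k p)" for k p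
  proof -
    have "X (Suc k) p i = cos \<theta> * X k p i + sin \<theta> * Z k p i" if "i \<in> I" for i
      using that by (cases p) (simp add: X_def Z_def distrib_right cos_add sin_add algebra_simps)
    then have "(\<Sum>i\<in>I. S (X k p) i * (X k p i - X (Suc k) p i)) = a (X k p, Z k p)"
      unfolding a_def by (auto intro: sum.cong)
    then show ?thesis using sub[OF XZ_space(1) XZ_space(1), of k p "Suc k" p] by simp
  qed
  have ends: "X 0 (x, y) = x" "X N (x, y) = y" if "x \<in> space ?G" "y \<in> space ?G" for x y
    using that N by (auto simp: X_def \<theta>_def space_PiM PiE_def extensional_restrict)
  have pt: "ennreal (exp (l * (F x - F y))) \<le> (\<Sum>k<N. ennreal (exp (l * N * a (X k (x, y), Z k (x, y))) / N))"
    if "x \<in> space ?G" "y \<in> space ?G" for x y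
  proof -
    have "F x - F y = (\<Sum>k<N. F (X k (x, y)) - F (X (Suc k) (x, y)))"
      using ends[OF that] by (simp only: sum_lessThan_telescope'[where f = "\<lambda>k. F (X k (x, y))"])
    also have "\<dots> \<le> (\<Sum>k<N. a (X k (x, y), Z k (x, y)))"
      by (intro sum_mono step)
    finally have "l * (F x - F y) \<le> (\<Sum>k<N. l * a (X k (x, y), Z k (x, y)))"
      using l by (simp add: sum_distrib_left[symmetric] mult_left_mono)
    then have "exp (l * (F x - F y)) \<le> exp (\<Sum>k<N. l * a (X k (x, y), Z k (x, y)))" by simp
    also have "\<dots> \<le> (\<Sum>k<N. exp (N * (l * a (X k (x, y), Z k (x, y))))) / N"
      by (rule exp_sum_le_mean_exp[OF N])
    finally have "ennreal (exp (l * (F x - F y))) \<le>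
        ennreal (\<Sum>k<N. exp (l * N * a (X k (x, y), Z k (x, y))) / N)"
      by (intro ennreal_leI) (simp add: sum_divide_distrib mult.assoc mult.left_commute)
    then show ?thesis by (simp add: sum_ennreal)
  qed
  \<comment> \<open>Position and direction at every time have the law of (x, y), so all
    \<open>N\<close> increments have the same integral. Only starting points \<open>k < N\<close>
    occur, which keeps the cosine nonzero.\<close>
  have rot: "(\<integral>\<^sup>+p. g (X k p, Z k p) \<partial>(?G \<Otimes>\<^sub>M ?G)) = (\<integral>\<^sup>+p. g p \<partial>(?G \<Otimes>\<^sub>M ?G))"
    if k: "k < N" and g [measurable]: "g \<in> borel_measurable (?G \<Otimes>\<^sub>M ?G)" for k g
  proof -
    have "real k * \<theta> < pi / 2" "0 \<le> real k * \<theta>"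
      using k by (auto simp: \<theta>_def field_simps)
    then have c: "cos (k * \<theta>) \<noteq> 0" using cos_gt_zero_pi[of "k * \<theta>"] by (auto simp: less_eq_real_def)
    have "(\<integral>\<^sup>+p. g p \<partial>(?G \<Otimes>\<^sub>M ?G)) = (\<integral>\<^sup>+p. g p \<partial>(distr (?G \<Otimes>\<^sub>M ?G) (?G \<Otimes>\<^sub>M ?G) (\<lambda>p. (X k p, Z k p))))"
      using distr_rotation_gaussian[OF I c, of "sin (k * \<theta>)"]
      unfolding X_def Z_def by (simp add: split_beta')
    also have "\<dots> = (\<integral>\<^sup>+p. g (X k p, Z k p) \<partial>(?G \<Otimes>\<^sub>M ?G))"
      by (rule nn_integral_distr) measurable
    finally show ?thesis ..
  qed
  have "(\<integral>\<^sup>+x. \<integral>\<^sup>+y. exp (l * (F x - F y)) \<partial>?G \<partial>?G) \<le>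
      (\<integral>\<^sup>+x. \<integral>\<^sup>+y. (\<Sum>k<N. ennreal (exp (l * N * a (X k (x, y), Z k (x, y))) / N)) \<partial>?G \<partial>?G)"
    by (intro nn_integral_mono pt)
  also have "\<dots> = (\<integral>\<^sup>+p. (\<Sum>k<N. ennreal (exp (l * N * a (X k p, Z k p)) / N)) \<partial>(?G \<Otimes>\<^sub>M ?G))"
    by (subst G.nn_integral_fst[symmetric]) auto
  also have "\<dots> = (\<Sum>k<N. \<integral>\<^sup>+p. ennreal (exp (l * N * a (X k p, Z k p)) / N) \<partial>(?G \<Otimes>\<^sub>M ?G))"
    by (intro nn_integral_sum) measurable
  also have "\<dots> = (\<Sum>k<N. \<integral>\<^sup>+p. ennreal (exp (l * N * a p) / N) \<partial>(?G \<Otimes>\<^sub>M ?G))"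
  proof (intro sum.cong refl)
    fix k assume "k \<in> {..<N}"
    then show "(\<integral>\<^sup>+p. ennreal (exp (l * N * a (X k p, Z k p)) / N) \<partial>(?G \<Otimes>\<^sub>M ?G)) =
        (\<integral>\<^sup>+p. ennreal (exp (l * N * a p) / N) \<partial>(?G \<Otimes>\<^sub>M ?G))"
      by (intro rot[of k "\<lambda>p. ennreal (exp (l * N * a p) / N)"]) auto
  qed
  also have "\<dots> = of_nat N * (\<integral>\<^sup>+p. ennreal (1 / N) * ennreal (exp (l * N * a p)) \<partial>(?G \<Otimes>\<^sub>M ?G))"
    by (simp add: ennreal_mult[symmetric])
  also have "\<dots> = of_nat N * (ennreal (1 / N) * (\<integral>\<^sup>+p. exp (l * N * a p) \<partial>(?G \<Otimes>\<^sub>M ?G)))"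
    by (subst nn_integral_cmult) auto
  also have "\<dots> = (\<integral>\<^sup>+p. exp (l * N * a p) \<partial>(?G \<Otimes>\<^sub>M ?G))"
    using N by (simp add: mult.assoc[symmetric] ennreal_of_nat_eq_real_of_nat ennreal_mult[symmetric])
  also have "\<dots> = (\<integral>\<^sup>+u. \<integral>\<^sup>+v. exp (l * N * a (u, v)) \<partial>?G \<partial>?G)"
    by (subst G.nn_integral_fst[symmetric]) auto
  also have "\<dots> \<le> (\<integral>\<^sup>+u. exp (2 * l\<^sup>2) * (\<Prod>i\<in>I. ennreal (exp (2 * l / N * \<bar>u i\<bar>))) \<partial>?G)"
  proof (rule nn_integral_mono)
    fix u assume u: "u \<in> space ?G"
    \<comment> \<open>The exponent splits into a part along \<open>u\<close>, with coefficient of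
      order 1 / N, and a part linear in the independent Gaussian \<open>v\<close>, of variance at
      most \<open>4 * l\<^sup>2\<close>; the latter produces the factor
      \<open>exp (2 * l\<^sup>2)\<close>.\<close>
    let ?c = "- (l * N * sin \<theta>)"
    have "l * N * a (u, v) = l * (N * (1 - cos \<theta>)) * (\<Sum>i\<in>I. S u i * u i) + (\<Sum>i\<in>I. (?c * S u i) * v i)" for v
      by (simp add: a_def sum_distrib_left sum.distrib[symmetric] algebra_simps)
    then have "(\<integral>\<^sup>+v. exp (l * N * a (u, v)) \<partial>?G) =
        (\<integral>\<^sup>+v. ennreal (exp (l * (N * (1 - cos \<theta>)) * (\<Sum>i\<in>I. S u i * u i))) * exp (\<Sum>i\<in>I. (?c * S u i) * v i) \<partial>?G)"
      by (simp add: exp_add ennreal_mult)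
    also have "\<dots> = exp (l * (N * (1 - cos \<theta>)) * (\<Sum>i\<in>I. S u i * u i)) * ennreal (exp ((\<Sum>i\<in>I. (?c * S u i)\<^sup>2) / 2))"
      by (subst nn_integral_cmult, measurable) (simp only: nn_integral_gaussian_exp[OF I])
    also have "\<dots> \<le> exp (\<Sum>i\<in>I. 2 * l / N * \<bar>u i\<bar>) * ennreal (exp (2 * l\<^sup>2))"
    proof (intro mult_mono ennreal_leI exp_le_cancel_iff[THEN iffD2])
      have Sle: "\<bar>S u i\<bar> \<le> 1" if "i \<in> I" for i
      proof -
        have "(S u i)\<^sup>2 \<le> (\<Sum>i\<in>I. (S u i)\<^sup>2)" using I that by (intro member_le_sum) auto
        then have "(S u i)\<^sup>2 \<le> 1" using S1[OF u] by simp
        then show ?thesis by (simp add: abs_square_le_1)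
      qed
      have "(\<Sum>i\<in>I. S u i * u i) \<le> (\<Sum>i\<in>I. \<bar>u i\<bar>)"
      proof (intro sum_mono)
        fix i assume "i \<in> I"
        have "S u i * u i \<le> \<bar>S u i\<bar> * \<bar>u i\<bar>" by (simp add: abs_mult[symmetric])
        also have "\<dots> \<le> 1 * \<bar>u i\<bar>" by (intro mult_right_mono Sle \<open>i \<in> I\<close>) auto
        finally show "S u i * u i \<le> \<bar>u i\<bar>" by simp
      qed
      then have "l * (N * (1 - cos \<theta>)) * (\<Sum>i\<in>I. S u i * u i) \<le> l * (N * (1 - cos \<theta>)) * (\<Sum>i\<in>I. \<bar>u i\<bar>)"
        using l b(2) by (intro mult_left_mono) auto
      also have "\<dots> \<le> l * (2 / N) * (\<Sum>i\<in>I. \<bar>u i\<bar>)"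
        using l b(3) by (intro mult_right_mono mult_left_mono sum_nonneg) auto
      finally show "l * (N * (1 - cos \<theta>)) * (\<Sum>i\<in>I. S u i * u i) \<le> (\<Sum>i\<in>I. 2 * l / N * \<bar>u i\<bar>)"
        by (simp add: sum_distrib_left sum_divide_distrib mult.commute)
      have "(\<Sum>i\<in>I. (?c * S u i)\<^sup>2) = l\<^sup>2 * (N * sin \<theta>)\<^sup>2 * (\<Sum>i\<in>I. (S u i)\<^sup>2)"
        by (simp add: sum_distrib_left power_mult_distrib mult_ac)
      also have "\<dots> \<le> l\<^sup>2 * 4 * 1"
        using b(1) S1[OF u] by (intro mult_mono mult_left_mono) (auto intro: sum_nonneg)
      finally show "(\<Sum>i\<in>I. (?c * S u i)\<^sup>2) / 2 \<le> 2 * l\<^sup>2" by simp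
    qed auto
    also have "\<dots> = exp (2 * l\<^sup>2) * (\<Prod>i\<in>I. ennreal (exp (2 * l / N * \<bar>u i\<bar>)))"
      using I by (simp add: exp_sum prod_ennreal mult.commute)
    finally show "(\<integral>\<^sup>+v. exp (l * N * a (u, v)) \<partial>?G) \<le> exp (2 * l\<^sup>2) * (\<Prod>i\<in>I. ennreal (exp (2 * l / N * \<bar>u i\<bar>)))" .
  qed
  also have "\<dots> = exp (2 * l\<^sup>2) * (\<integral>\<^sup>+x. exp (2 * l / N * \<bar>x\<bar>) \<partial>stdnorm) ^ card I"
    using nn_integral_gaussian_prod[OF I, of "\<lambda>_ x. ennreal (exp (2 * l / N * \<bar>x\<bar>))"]
    by (subst nn_integral_cmult, measurable)
  also have "\<dots> \<le> exp (2 * l\<^sup>2) * ennreal (2 * exp ((2 * l / N)\<^sup>2 / 2) - 1 + (2 * l / N) * (\<integral>x. \<bar>x\<bar> \<partial>stdnorm)) ^ card I"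
    using l by (intro mult_left_mono power_mono stdnorm_exp_abs_le) auto
  also have "\<dots> = exp (2 * l\<^sup>2) * (2 * exp ((2 * l / N)\<^sup>2 / 2) - 1 + (2 * l / N) * (\<integral>x. \<bar>x\<bar> \<partial>stdnorm)) ^ card I"
  proof -
    have "1 \<le> exp ((2 * l / N)\<^sup>2 / 2)" by simp
    moreover have "0 \<le> (2 * l / N) * (\<integral>x. \<bar>x\<bar> \<partial>stdnorm)" using l by simp
    ultimately have "0 \<le> 2 * exp ((2 * l / N)\<^sup>2 / 2) - 1 + (2 * l / N) * (\<integral>x. \<bar>x\<bar> \<partial>stdnorm)" by linarith
    then show ?thesis by (simp only: ennreal_power ennreal_mult[symmetric] zero_le_power exp_ge_zero)
  qed
  finally show ?thesis .
qed

text \<open>The limit of ever finer rotations: the power in the previous bound tends to 1.\<close>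

lemma gaussian_exp_difference:
  fixes F :: "('i \<Rightarrow> real) \<Rightarrow> real" and S :: "('i \<Rightarrow> real) \<Rightarrow> 'i \<Rightarrow> real"
  assumes I: "finite I"
    and F: "F \<in> borel_measurable (gaussian I)"
    and S: "\<And>i. i \<in> I \<Longrightarrow> (\<lambda>x. S x i) \<in> borel_measurable (gaussian I)"
    and S1: "\<And>x. x \<in> space (gaussian I) \<Longrightarrow> (\<Sum>i\<in>I. (S x i)\<^sup>2) \<le> 1"
    and sub: "\<And>x y. x \<in> space (gaussian I) \<Longrightarrow> y \<in> space (gaussian I) \<Longrightarrow>
      F x - F y \<le> (\<Sum>i\<in>I. S x i * (x i - y i))"
    and l: "0 \<le> l"
  shows "(\<integral>\<^sup>+x. \<integral>\<^sup>+y. exp (l * (F x - F y)) \<partial>gaussian I \<partial>gaussian I) \<le> exp (2 * l\<^sup>2)"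
proof -
  let ?B = "\<integral>x. \<bar>x\<bar> \<partial>stdnorm"
  define r where "r N = exp (2 * l\<^sup>2) * (2 * exp ((2 * l * (1 / N))\<^sup>2 / 2) - 1 + (2 * l * (1 / N)) * ?B) ^ card I"
    for N :: real
  have "(\<lambda>N. r (real (Suc N))) \<longlonglongrightarrow> exp (2 * l\<^sup>2) * (2 * exp ((2 * l * 0)\<^sup>2 / 2) - 1 + (2 * l * 0) * ?B) ^ card I"
    unfolding r_def by (intro tendsto_intros LIMSEQ_Suc[OF lim_1_over_n]) simp
  then have lim: "(\<lambda>N. ennreal (r (real (Suc N)))) \<longlonglongrightarrow> ennreal (exp (2 * l\<^sup>2))"
    by (intro tendsto_ennrealI) simp
  have "(\<integral>\<^sup>+x. \<integral>\<^sup>+y. exp (l * (F x - F y)) \<partial>gaussian I \<partial>gaussian I) \<le> r (real (Suc N))" for N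
    unfolding r_def times_divide_eq_right mult_1_right
    by (rule gaussian_exp_difference_step[where S = S, OF I F S S1 sub l]) simp_all
  then show ?thesis by (intro LIMSEQ_le_const[OF lim]) blast
qed

text \<open>Jensen's inequality, from exp z \<ge> 1 + z. The nonnegative integral is used because
  integrability of the exponential is not yet known where this is applied.\<close>

lemma nn_integral_exp_centered_ge_1:
  assumes "prob_space M" and f: "integrable M f" and 0: "(\<integral>x. f x \<partial>M) = 0"
  shows "1 \<le> (\<integral>\<^sup>+x. exp (f x) \<partial>M)"
proof (cases "(\<integral>\<^sup>+x. ennreal (exp (f x)) \<partial>M) = \<infinity>")
  case False
  interpret prob_space M by fact
  have int: "integrable M (\<lambda>x. exp (f x))"
    using False f by (intro integrableI_nonneg) (auto simp: top.not_eq_extremum)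
  have "1 = (\<integral>x. 1 + f x \<partial>M)" using f 0 by (simp add: prob_space)
  also have "\<dots> \<le> (\<integral>x. exp (f x) \<partial>M)"
    using f int by (intro integral_mono) auto
  finally show ?thesis by (subst nn_integral_eq_integral) (auto simp: int ennreal_leI[of 1, simplified])
qed simp

text \<open>For independent copies, the exponential moment of \<open>F x - F y\<close> is the
  product of the centered moments at \<open>l\<close> and \<open>- l\<close>. Both factors are at
  least 1, so each is bounded by the bound on the product.\<close>

lemma gaussian_exp_centered:
  fixes F :: "('i \<Rightarrow> real) \<Rightarrow> real" and S :: "('i \<Rightarrow> real) \<Rightarrow> 'i \<Rightarrow> real"
  assumes I: "finite I"
    and F: "integrable (gaussian I) F"
    and S: "\<And>i. i \<in> I \<Longrightarrow> (\<lambda>x. S x i) \<in> borel_measurable (gaussian I)"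
    and S1: "\<And>x. x \<in> space (gaussian I) \<Longrightarrow> (\<Sum>i\<in>I. (S x i)\<^sup>2) \<le> 1"
    and sub: "\<And>x y. x \<in> space (gaussian I) \<Longrightarrow> y \<in> space (gaussian I) \<Longrightarrow>
      F x - F y \<le> (\<Sum>i\<in>I. S x i * (x i - y i))"
    and mu: "\<mu> = (\<integral>x. F x \<partial>gaussian I)"
  shows "(\<integral>\<^sup>+x. exp (l * (F x - \<mu>)) \<partial>gaussian I) \<le> exp (2 * l\<^sup>2)"
proof -
  interpret G: prob_space "gaussian I" by (rule prob_space_gaussian)
  let ?G = "gaussian I"
  have F' [measurable]: "F \<in> borel_measurable ?G" using F by simp
  have split: "(\<integral>\<^sup>+x. \<integral>\<^sup>+y. exp (k * (F x - F y)) \<partial>?G \<partial>?G) =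
      (\<integral>\<^sup>+x. exp (k * (F x - \<mu>)) \<partial>?G) * (\<integral>\<^sup>+y. exp (- k * (F y - \<mu>)) \<partial>?G)" for k
  proof -
    have "exp (k * (F x - F y)) = exp (k * (F x - \<mu>)) * exp (- k * (F y - \<mu>))" for x y
      by (simp add: exp_add[symmetric] algebra_simps)
    then have "(\<integral>\<^sup>+x. \<integral>\<^sup>+y. exp (k * (F x - F y)) \<partial>?G \<partial>?G) =
        (\<integral>\<^sup>+x. \<integral>\<^sup>+y. ennreal (exp (k * (F x - \<mu>))) * ennreal (exp (- k * (F y - \<mu>))) \<partial>?G \<partial>?G)"
      by (simp add: ennreal_mult)
    also have "\<dots> = (\<integral>\<^sup>+x. ennreal (exp (k * (F x - \<mu>))) * (\<integral>\<^sup>+y. ennreal (exp (- k * (F y - \<mu>))) \<partial>?G) \<partial>?G)"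
      by (intro nn_integral_cong nn_integral_cmult) measurable
    also have "\<dots> = (\<integral>\<^sup>+x. exp (k * (F x - \<mu>)) \<partial>?G) * (\<integral>\<^sup>+y. exp (- k * (F y - \<mu>)) \<partial>?G)"
      by (rule nn_integral_multc) measurable
    finally show ?thesis .
  qed
  have ge1: "1 \<le> (\<integral>\<^sup>+x. exp (k * (F x - \<mu>)) \<partial>?G)" for k
    using F mu by (intro nn_integral_exp_centered_ge_1 prob_space_gaussian) (auto simp: G.prob_space)
  have diff: "(\<integral>\<^sup>+x. exp (k * (F x - \<mu>)) \<partial>?G) * (\<integral>\<^sup>+y. exp (- k * (F y - \<mu>)) \<partial>?G) \<le> exp (2 * k\<^sup>2)"
    if "0 \<le> k" for k
    using gaussian_exp_difference[OF I F' S S1 sub that] unfolding split[of k] .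
  show ?thesis
  proof (cases "0 \<le> l")
    case True
    have "(\<integral>\<^sup>+x. exp (l * (F x - \<mu>)) \<partial>?G) * 1 \<le> (\<integral>\<^sup>+x. exp (l * (F x - \<mu>)) \<partial>?G) * (\<integral>\<^sup>+y. exp (- l * (F y - \<mu>)) \<partial>?G)"
      by (intro mult_left_mono ge1) simp
    then show ?thesis using diff[OF True] by simp
  next
    case False
    have "1 * (\<integral>\<^sup>+x. exp (l * (F x - \<mu>)) \<partial>?G) \<le> (\<integral>\<^sup>+x. exp (- l * (F x - \<mu>)) \<partial>?G) * (\<integral>\<^sup>+y. exp (l * (F y - \<mu>)) \<partial>?G)"
      by (intro mult_right_mono ge1) simp
    then show ?thesis using diff[of "- l"] False by simp
  qed
qed

lemma gaussian_concentration:
  fixes F :: "('i \<Rightarrow> real) \<Rightarrow> real" and S :: "('i \<Rightarrow> real) \<Rightarrow> 'i \<Rightarrow> real"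
  assumes I: "finite I"
    and F: "integrable (gaussian I) F"
    and S: "\<And>i. i \<in> I \<Longrightarrow> (\<lambda>x. S x i) \<in> borel_measurable (gaussian I)"
    and S1: "\<And>x. x \<in> space (gaussian I) \<Longrightarrow> (\<Sum>i\<in>I. (S x i)\<^sup>2) \<le> 1"
    and sub: "\<And>x y. x \<in> space (gaussian I) \<Longrightarrow> y \<in> space (gaussian I) \<Longrightarrow>
      F x - F y \<le> (\<Sum>i\<in>I. S x i * (x i - y i))"
    and mu: "\<mu> = (\<integral>x. F x \<partial>gaussian I)"
  shows gaussian_upper_tail:
      "0 \<le> s \<Longrightarrow> measure (gaussian I) {x \<in> space (gaussian I). F x \<ge> \<mu> + s} \<le> exp (- s\<^sup>2 / 8)"
    and gaussian_lower_tail: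
      "0 \<le> s \<Longrightarrow> measure (gaussian I) {x \<in> space (gaussian I). F x \<le> \<mu> - s} \<le> exp (- s\<^sup>2 / 8)"
    and gaussian_variance_le: "(\<integral>x. (F x - \<mu>)\<^sup>2 \<partial>gaussian I) \<le> 16"
proof -
  interpret G: prob_space "gaussian I" by (rule prob_space_gaussian)
  let ?G = "gaussian I"
  have F' [measurable]: "F \<in> borel_measurable ?G" using F by simp
  note E = gaussian_exp_centered[OF I F S S1 sub mu]
  have int: "integrable ?G (\<lambda>x. exp (l * (F x - \<mu>)))" for l
    using E[of l] by (intro integrableI_nonneg) (auto simp: order_le_less_trans[OF _ ennreal_less_top])
  have le: "(\<integral>x. exp (l * (F x - \<mu>)) \<partial>?G) \<le> exp (2 * l\<^sup>2)" for l
    using E[of l] by (simp add: nn_integral_eq_integral int)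
  \<comment> \<open>Chernoff's bound with l = s / 4, the minimiser of 2 l^2 - l s; the sign
    \<open>k\<close> covers both tails at once.\<close>
  have tail: "measure ?G {x \<in> space ?G. s \<le> k * (F x - \<mu>)} \<le> exp (- s\<^sup>2 / 8)"
    if k: "k = 1 \<or> k = -1" and s: "0 \<le> s" for k s :: real
  proof -
    have "measure ?G {x \<in> space ?G. s \<le> k * (F x - \<mu>)} \<le>
        measure ?G {x \<in> space ?G. exp (s\<^sup>2 / 4) \<le> exp (s / 4 * k * (F x - \<mu>))}"
    proof (rule G.finite_measure_mono)
      have "s * s \<le> s * (k * (F x - \<mu>))" if "s \<le> k * (F x - \<mu>)" for x
        using that s by (rule mult_left_mono)
      then show "{x \<in> space ?G. s \<le> k * (F x - \<mu>)} \<subseteq>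
        {x \<in> space ?G. exp (s\<^sup>2 / 4) \<le> exp (s / 4 * k * (F x - \<mu>))}"
        by (auto simp: power2_eq_square mult.assoc)
    qed measurable
    also have "\<dots> \<le> (\<integral>x. exp (s / 4 * k * (F x - \<mu>)) \<partial>?G) / exp (s\<^sup>2 / 4)"
      by (rule integral_Markov_inequality_measure[OF int, of "{}", simplified])  simp
    also have "\<dots> \<le> exp (2 * (s / 4 * k)\<^sup>2) / exp (s\<^sup>2 / 4)"
      by (intro divide_right_mono le) simp
    also have "\<dots> = exp (- s\<^sup>2 / 8)"
      using k by (auto simp: exp_diff[symmetric] power2_eq_square)
    finally show ?thesis .
  qed
  show "measure ?G {x \<in> space ?G. F x \<ge> \<mu> + s} \<le> exp (- s\<^sup>2 / 8)" if "0 \<le> s"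
    using tail[of 1 s] that by (simp add: algebra_simps)
  show "measure ?G {x \<in> space ?G. F x \<le> \<mu> - s} \<le> exp (- s\<^sup>2 / 8)" if "0 \<le> s"
    using tail[of "-1" s] that by (simp add: algebra_simps)
  \<comment> \<open>The exponential moments at 1 and -1 bound the variance by 2 exp 2 - 2, and exp 2
    \<le> 9 turns this into 16.\<close>
  have sq: "z\<^sup>2 \<le> exp (1 * z) + exp (-1 * z) - 2" for z :: real
    using square_le_exp_plus_exp_minus[of z] by simp
  have sqint: "integrable ?G (\<lambda>x. (F x - \<mu>)\<^sup>2)"
    by (rule Bochner_Integration.integrable_bound[where f = "\<lambda>x. exp (1 * (F x - \<mu>)) + exp (-1 * (F x - \<mu>))"])
      (use int[of 1] int[of "-1"] sq in \<open>auto simp: abs_if intro!: AE_I2 order_trans[OF sq]\<close>)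
  have "(\<integral>x. (F x - \<mu>)\<^sup>2 \<partial>?G) \<le> (\<integral>x. exp (1 * (F x - \<mu>)) + exp (-1 * (F x - \<mu>)) - 2 \<partial>?G)"
    using int[of 1] int[of "-1"] by (intro integral_mono sqint sq) auto
  also have "\<dots> = (\<integral>x. exp (1 * (F x - \<mu>)) \<partial>?G) + (\<integral>x. exp (-1 * (F x - \<mu>)) \<partial>?G) - 2"
    using int[of 1] int[of "-1"] by (simp add: G.prob_space)
  also have "\<dots> \<le> exp 2 + exp 2 - 2"
    using le[of 1] le[of "-1"] by simp
  also have "\<dots> \<le> 16"
  proof -
    have "exp (1::real) \<le> 3" using exp_le by simp
    then have "exp (1::real) * exp 1 \<le> 3 * 3" by (intro mult_mono) auto
    then have "exp (2::real) \<le> 9" by (simp add: exp_add[symmetric])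
    then show ?thesis by simp
  qed
  finally show "(\<integral>x. (F x - \<mu>)\<^sup>2 \<partial>?G) \<le> 16" .
qed

section \<open>A smoothed min-max function\<close>

text \<open>Decreasing in \<open>z\<close>: a smooth stand-in for the indicator of the negative
  numbers, sharpened later by scaling the argument.\<close>

definition logistic :: "real \<Rightarrow> real" where
  "logistic z = 1 / (1 + exp z)"

lemma logistic_pos: "0 < logistic z" and logistic_less_1: "logistic z < 1"
  by (auto simp: logistic_def add_pos_pos)

lemma logistic_measurable [measurable]: "logistic \<in> borel_measurable borel"
  unfolding logistic_def by measurable

lemma DERIV_logistic: "(logistic has_real_derivative (logistic z)\<^sup>2 - logistic z) (at z)"
proof -
  have nz: "1 + exp z \<noteq> 0" using exp_gt_zero[of z] by linarith
  have "((\<lambda>z. 1 / (1 + exp z)) has_real_derivative - exp z / (1 + exp z)\<^sup>2) (at z)"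
    using nz by (auto intro!: derivative_eq_intros simp: power2_eq_square)
  moreover have "- exp z / (1 + exp z)\<^sup>2 = (1 / (1 + exp z))\<^sup>2 - 1 / (1 + exp z)"
  proof -
    have "- (E - 1) / E\<^sup>2 = (1 / E)\<^sup>2 - 1 / E" if "E \<noteq> 0" for E :: real
      using that by (simp add: power2_eq_square field_simps)
    from this[OF nz] show ?thesis by simp
  qed
  ultimately show ?thesis unfolding logistic_def by simp
qed

text \<open>\<open>d\<close> and \<open>dd\<close> are the first two derivatives. All derivatives
  are polynomials in \<open>logistic\<close>, whose values lie between 0 and 1; hence remainder
  bounds uniform in \<open>a\<close>.\<close>

lemma logistic_taylor:
  defines "d \<equiv> \<lambda>z. (logistic z)\<^sup>2 - logistic z"
  defines "dd \<equiv> \<lambda>z. (2 * logistic z - 1) * d z"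
  shows "\<bar>d a\<bar> \<le> 1" "d a \<le> 0" "\<bar>dd a\<bar> \<le> 1"
    and "\<bar>logistic (a + h) - logistic a\<bar> \<le> \<bar>h\<bar>"
    and "\<bar>logistic (a + h) - logistic a - d a * h\<bar> \<le> \<bar>h\<bar>\<^sup>2"
    and "\<bar>logistic (a + h) - logistic a - d a * h - dd a * h\<^sup>2 / 2\<bar> \<le> \<bar>h\<bar> ^ 3"
proof -
  define ddd where "ddd z = 2 * (d z)\<^sup>2 + (2 * logistic z - 1) * dd z" for z
  have d_bound: "- 1 / 4 \<le> d z" "d z \<le> 0" for z
  proof -
    have "0 \<le> (logistic z - 1 / 2)\<^sup>2" by simp
    then show "- 1 / 4 \<le> d z" by (simp add: d_def power2_eq_square algebra_simps)
    show "d z \<le> 0" using logistic_pos[of z] logistic_less_1[of z]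
      by (simp add: d_def power2_eq_square)
  qed
  have ad: "\<bar>d z\<bar> \<le> 1 / 4" for z using d_bound[of z] by (simp add: abs_le_iff)
  have al: "\<bar>2 * logistic z - 1\<bar> \<le> 1" for z
    using logistic_pos[of z] logistic_less_1[of z] by linarith
  have add: "\<bar>dd z\<bar> \<le> 1 / 4" for z
    unfolding dd_def abs_mult using mult_mono[OF al ad, of z z] by simp
  have addd: "\<bar>ddd z\<bar> \<le> 1" for z
  proof -
    have "\<bar>(2 * logistic z - 1) * dd z\<bar> \<le> 1 * (1 / 4)"
      unfolding abs_mult by (intro mult_mono al add) auto
    then have *: "(2 * logistic z - 1) * dd z \<le> 1 / 4" "- (1 / 4) \<le> (2 * logistic z - 1) * dd z"
      by linarith+
    have "(d z)\<^sup>2 \<le> (1 / 4)\<^sup>2"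
      using power_mono[OF ad[of z], of 2] by simp
    then have "(d z)\<^sup>2 \<le> 1 / 16" by (simp add: power_divide)
    moreover have "0 \<le> (d z)\<^sup>2" by simp
    ultimately show ?thesis
      unfolding ddd_def abs_le_iff using * by (intro conjI; linarith)
  qed
  show "\<bar>d a\<bar> \<le> 1" "d a \<le> 0" "\<bar>dd a\<bar> \<le> 1" using ad[of a] d_bound[of a] add[of a] by auto
  have D1: "(logistic has_real_derivative d z) (at z)" for z
    unfolding d_def by (rule DERIV_logistic)
  have D2: "(d has_real_derivative dd z) (at z)" for z
  proof -
    have "((\<lambda>z. logistic z * logistic z - logistic z) has_real_derivative
        (d z * logistic z + d z * logistic z) - d z) (at z)"
      by (intro DERIV_diff DERIV_mult D1)
    then show ?thesis unfolding d_def dd_def by (simp add: power2_eq_square algebra_simps)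
  qed
  have D3: "(dd has_real_derivative ddd z) (at z)" for z
  proof -
    have "((\<lambda>z. (2 * logistic z - 1) * d z) has_real_derivative
        (2 * d z - 0) * d z + dd z * (2 * logistic z - 1)) (at z)"
      by (intro DERIV_mult DERIV_diff DERIV_cmult DERIV_const D1 D2)
    then show ?thesis unfolding ddd_def
      by (simp add: dd_def[abs_def] power2_eq_square algebra_simps)
  qed
  define diff where "diff m = (if m = 0 then logistic else if m = 1 then d else if m = 2 then dd else ddd)"
    for m :: nat
  have D: "(diff m has_real_derivative diff (Suc m) z) (at z)" if "m < 3" for m z
  proof -
    have "m = 0 \<or> m = 1 \<or> m = 2" using that by auto
    then show ?thesis using D1 D2 D3 by (auto simp: diff_def)
  qed
  have taylor: "\<exists>t. logistic (a + h) = (\<Sum>m<n. diff m a / fact m * h ^ m) + diff n t / fact n * h ^ n"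
    if "n \<le> 3" for n
  proof -
    have "\<exists>t. \<bar>t\<bar> \<le> \<bar>h\<bar> \<and> (\<lambda>x. logistic (a + x)) h =
        (\<Sum>m<n. (\<lambda>x. diff m (a + x)) 0 / fact m * h ^ m) + (\<lambda>x. diff n (a + x)) t / fact n * h ^ n"
    proof (rule Maclaurin_bi_le[where diff = "\<lambda>m x. diff m (a + x)"])
      show "(\<lambda>x. diff 0 (a + x)) = (\<lambda>x. logistic (a + x))" by (simp add: diff_def)
      have "((\<lambda>x. diff m (a + x)) has_real_derivative diff (Suc m) (a + t)) (at t)" if "m < n" for m t
        using DERIV_shift[of "diff m" "diff (Suc m) (a + t)" t a] D[of m "a + t"] that \<open>n \<le> 3\<close>
        by (simp add: add.commute)
      then show "\<forall>m t. m < n \<and> \<bar>t\<bar> \<le> \<bar>h\<bar> \<longrightarrow>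
          ((\<lambda>x. diff m (a + x)) has_real_derivative diff (Suc m) (a + t)) (at t)" by blast
    qed
    then show ?thesis by auto
  qed
  obtain t where "logistic (a + h) = logistic a + d t * h"
    using taylor[of 1] by (auto simp: diff_def)
  then have "\<bar>logistic (a + h) - logistic a\<bar> = \<bar>d t\<bar> * \<bar>h\<bar>" by (simp add: abs_mult)
  also have "\<dots> \<le> 1 * \<bar>h\<bar>" using ad[of t] by (intro mult_right_mono) auto
  finally show "\<bar>logistic (a + h) - logistic a\<bar> \<le> \<bar>h\<bar>" by simp
  obtain t where "logistic (a + h) = logistic a + d a * h + dd t / 2 * h\<^sup>2"
    using taylor[of 2] by (auto simp: diff_def numeral_2_eq_2)
  then have "\<bar>logistic (a + h) - logistic a - d a * h\<bar> = \<bar>dd t / 2\<bar> * \<bar>h\<bar>\<^sup>2" by (simp add: abs_mult)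
  also have "\<dots> \<le> 1 * \<bar>h\<bar>\<^sup>2" using add[of t] by (intro mult_right_mono) auto
  finally show "\<bar>logistic (a + h) - logistic a - d a * h\<bar> \<le> \<bar>h\<bar>\<^sup>2" by simp
  obtain t where "logistic (a + h) = logistic a + d a * h + dd a / 2 * h\<^sup>2 + ddd t / 6 * h ^ 3"
    using taylor[of 3] by (auto simp: diff_def eval_nat_numeral)
  then have "\<bar>logistic (a + h) - logistic a - d a * h - dd a * h\<^sup>2 / 2\<bar> = \<bar>ddd t / 6\<bar> * \<bar>h\<bar> ^ 3"
    by (simp add: abs_mult power_abs)
  also have "\<dots> \<le> 1 * \<bar>h\<bar> ^ 3" using addd[of t] by (intro mult_right_mono) auto
  finally show "\<bar>logistic (a + h) - logistic a - d a * h - dd a * h\<^sup>2 / 2\<bar> \<le> \<bar>h\<bar> ^ 3" by simp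
qed

section \<open>Uniform third-order Taylor expansions and their product rule\<close>

definition linear_part :: "'p set \<Rightarrow> ('p \<Rightarrow> real) \<Rightarrow> ('p \<Rightarrow> real) \<Rightarrow> real" where
  "linear_part P G v = (\<Sum>p\<in>P. G p * v p)"

definition quadratic_part :: "'p set \<Rightarrow> ('p \<Rightarrow> 'p \<Rightarrow> real) \<Rightarrow> ('p \<Rightarrow> real) \<Rightarrow> real" where
  "quadratic_part P H v = (\<Sum>p\<in>P. \<Sum>q\<in>P. H p q * (v p * v q))"

definition l1norm :: "'p set \<Rightarrow> ('p \<Rightarrow> real) \<Rightarrow> real" where
  "l1norm P v = (\<Sum>p\<in>P. \<bar>v p\<bar>)"

text \<open>The lower-order remainder bounds are part of the notion because they make it stable under
  products.\<close>

definition taylor3 ::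
  "'p set \<Rightarrow> real \<Rightarrow> (('p \<Rightarrow> real) \<Rightarrow> real) \<Rightarrow> ('p \<Rightarrow> real) \<Rightarrow> ('p \<Rightarrow> real) \<Rightarrow> ('p \<Rightarrow> 'p \<Rightarrow> real) \<Rightarrow> bool"
  where "taylor3 P C f w G H \<longleftrightarrow> 0 \<le> C \<and> (\<forall>p\<in>P. \<bar>G p\<bar> \<le> C) \<and> (\<forall>p\<in>P. \<forall>q\<in>P. \<bar>H p q\<bar> \<le> C) \<and>
    (\<forall>z. \<bar>f z\<bar> \<le> C) \<and>
    (\<forall>v. \<bar>f (\<lambda>p. w p + v p) - f w\<bar> \<le> C * l1norm P v) \<and>
    (\<forall>v. \<bar>f (\<lambda>p. w p + v p) - f w - linear_part P G v\<bar> \<le> C * (l1norm P v)\<^sup>2) \<and>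
    (\<forall>v. \<bar>f (\<lambda>p. w p + v p) - f w - linear_part P G v - quadratic_part P H v / 2\<bar> \<le> C * l1norm P v ^ 3)"

lemma l1norm_nonneg: "0 \<le> l1norm P v"
  by (simp add: l1norm_def sum_nonneg)

lemma abs_le_l1norm: "finite P \<Longrightarrow> p \<in> P \<Longrightarrow> \<bar>v p\<bar> \<le> l1norm P v"
  unfolding l1norm_def by (rule member_le_sum) auto

lemma linear_part_bound:
  assumes "\<forall>p\<in>P. \<bar>G p\<bar> \<le> C"
  shows "\<bar>linear_part P G v\<bar> \<le> C * l1norm P v"
proof -
  have "\<bar>linear_part P G v\<bar> \<le> (\<Sum>p\<in>P. \<bar>G p\<bar> * \<bar>v p\<bar>)"
    unfolding linear_part_def by (rule order_trans[OF sum_abs]) (simp add: abs_mult)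
  also have "\<dots> \<le> (\<Sum>p\<in>P. C * \<bar>v p\<bar>)"
    using assms by (intro sum_mono mult_right_mono) auto
  finally show ?thesis by (simp add: l1norm_def sum_distrib_left)
qed

lemma quadratic_part_bound:
  assumes "\<forall>p\<in>P. \<forall>q\<in>P. \<bar>H p q\<bar> \<le> C"
  shows "\<bar>quadratic_part P H v\<bar> \<le> C * (l1norm P v)\<^sup>2"
proof -
  have "\<bar>quadratic_part P H v\<bar> \<le> (\<Sum>p\<in>P. \<Sum>q\<in>P. \<bar>H p q\<bar> * (\<bar>v p\<bar> * \<bar>v q\<bar>))"
    unfolding quadratic_part_def
    by (rule order_trans[OF sum_abs]) (intro sum_mono order_trans[OF sum_abs], simp add: abs_mult)
  also have "\<dots> \<le> (\<Sum>p\<in>P. \<Sum>q\<in>P. C * (\<bar>v p\<bar> * \<bar>v q\<bar>))"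
    using assms by (intro sum_mono mult_right_mono) auto
  also have "\<dots> = C * (l1norm P v)\<^sup>2"
    by (simp only: l1norm_def power2_eq_square sum_product) (simp only: sum_distrib_left)
  finally show ?thesis .
qed

text \<open>Leibniz' rule up to second order. The factor 4 counts terms: the new second-order
  coefficients and the cubic remainder are sums of four products, each controlled by
  \<open>C * D\<close>.\<close>

lemma taylor3_mult:
  assumes f: "taylor3 P C f w G H" and g: "taylor3 P D g w G' H'"
  shows "taylor3 P (4 * (C * D)) (\<lambda>z. f z * g z) w (\<lambda>p. f w * G' p + g w * G p)
    (\<lambda>p q. f w * H' p q + g w * H p q + G p * G' q + G q * G' p)"
proof -
  have C: "0 \<le> C" and D: "0 \<le> D" and fC: "\<bar>f z\<bar> \<le> C" and gD: "\<bar>g z\<bar> \<le> D" for z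
    using f g by (auto simp: taylor3_def)
  have GC: "\<forall>p\<in>P. \<bar>G p\<bar> \<le> C" "\<forall>p\<in>P. \<bar>G' p\<bar> \<le> D"
    and HC: "\<forall>p\<in>P. \<forall>q\<in>P. \<bar>H p q\<bar> \<le> C" "\<forall>p\<in>P. \<forall>q\<in>P. \<bar>H' p q\<bar> \<le> D"
    using f g by (auto simp: taylor3_def)
  have CD: "0 \<le> C * D" using C D by simp
  have ml: "\<bar>x * y\<bar> \<le> a * b" if "\<bar>x\<bar> \<le> a" "\<bar>y\<bar> \<le> b" for x y a b :: real
    unfolding abs_mult using that by (intro mult_mono) auto
  have G'': "\<bar>f w * G' p + g w * G p\<bar> \<le> 4 * (C * D)" if "p \<in> P" for p
  proof -
    have "\<bar>f w * G' p\<bar> \<le> C * D" "\<bar>g w * G p\<bar> \<le> D * C"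
      using GC that fC gD by (auto intro!: ml)
    then show ?thesis using CD by (simp add: mult.commute abs_le_iff)
  qed
  have H'': "\<bar>f w * H' p q + g w * H p q + G p * G' q + G q * G' p\<bar> \<le> 4 * (C * D)"
    if "p \<in> P" "q \<in> P" for p q
  proof -
    have "\<bar>f w * H' p q\<bar> \<le> C * D" "\<bar>g w * H p q\<bar> \<le> D * C" "\<bar>G p * G' q\<bar> \<le> C * D" "\<bar>G q * G' p\<bar> \<le> C * D"
      using GC HC that fC gD by (auto intro!: ml)
    then show ?thesis using CD by (simp add: mult.commute abs_le_iff)
  qed
  have fg: "\<bar>f z * g z\<bar> \<le> 4 * (C * D)" for z
    using ml[OF fC gD, of z z] CD by linarith
  {
    fix v
    let ?s = "l1norm P v"
    let ?f1 = "f (\<lambda>p. w p + v p)" and ?g1 = "g (\<lambda>p. w p + v p)"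
    let ?lf = "linear_part P G v" and ?lg = "linear_part P G' v"
    let ?qf = "quadratic_part P H v / 2" and ?qg = "quadratic_part P H' v / 2"
    have s: "0 \<le> ?s" by (rule l1norm_nonneg)
    have f1: "\<bar>?f1 - f w\<bar> \<le> C * ?s" and f2: "\<bar>?f1 - f w - ?lf\<bar> \<le> C * ?s\<^sup>2"
      and f3: "\<bar>?f1 - f w - ?lf - ?qf\<bar> \<le> C * ?s ^ 3"
      and g1: "\<bar>?g1 - g w\<bar> \<le> D * ?s" and g2: "\<bar>?g1 - g w - ?lg\<bar> \<le> D * ?s\<^sup>2"
      and g3: "\<bar>?g1 - g w - ?lg - ?qg\<bar> \<le> D * ?s ^ 3"
      using f g by (auto simp: taylor3_def)
    have lg: "\<bar>?lg\<bar> \<le> D * ?s" by (rule linear_part_bound[OF GC(2)])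
    have qg: "\<bar>?qg\<bar> \<le> D * ?s\<^sup>2"
      using quadratic_part_bound[OF HC(2), of v] D by simp
    have lin: "linear_part P (\<lambda>p. f w * G' p + g w * G p) v = f w * ?lg + g w * ?lf"
      by (simp add: linear_part_def sum_distrib_left sum.distrib algebra_simps)
    have cross: "(\<Sum>p\<in>P. \<Sum>q\<in>P. (G p * G' q + G q * G' p) * (v p * v q)) = 2 * (?lf * ?lg)"
    proof -
      have "(\<Sum>p\<in>P. \<Sum>q\<in>P. (G p * v p) * (G' q * v q)) = ?lf * ?lg"
        by (simp add: linear_part_def sum_product)
      moreover have "(\<Sum>p\<in>P. \<Sum>q\<in>P. (G' p * v p) * (G q * v q)) = ?lg * ?lf"
        by (simp add: linear_part_def sum_product)
      moreover have "(\<Sum>p\<in>P. \<Sum>q\<in>P. (G p * G' q + G q * G' p) * (v p * v q)) =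
          (\<Sum>p\<in>P. \<Sum>q\<in>P. (G p * v p) * (G' q * v q)) + (\<Sum>p\<in>P. \<Sum>q\<in>P. (G' p * v p) * (G q * v q))"
        by (simp add: sum.distrib[symmetric] algebra_simps)
      ultimately show ?thesis by (simp add: mult.commute)
    qed
    have quad: "quadratic_part P (\<lambda>p q. f w * H' p q + g w * H p q + G p * G' q + G q * G' p) v / 2 =
        f w * ?qg + g w * ?qf + ?lf * ?lg"
    proof -
      have "quadratic_part P (\<lambda>p q. f w * H' p q + g w * H p q + G p * G' q + G q * G' p) v =
          f w * quadratic_part P H' v + g w * quadratic_part P H v +
          (\<Sum>p\<in>P. \<Sum>q\<in>P. (G p * G' q + G q * G' p) * (v p * v q))"
        by (simp add: quadratic_part_def sum_distrib_left sum.distrib[symmetric] algebra_simps)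
      then show ?thesis unfolding cross by (simp add: field_simps)
    qed
    have e1: "?f1 * ?g1 - f w * g w = ?f1 * (?g1 - g w) + g w * (?f1 - f w)"
      by (simp add: algebra_simps)
    have r1: "\<bar>?f1 * ?g1 - f w * g w\<bar> \<le> 4 * (C * D) * ?s"
    proof -
      have a: "\<bar>?f1 * (?g1 - g w)\<bar> \<le> C * (D * ?s)" "\<bar>g w * (?f1 - f w)\<bar> \<le> D * (C * ?s)"
        by (intro ml fC gD f1 g1)+
      have "0 \<le> C * D * ?s" using CD s by simp
      then show ?thesis unfolding e1 using a by (simp add: abs_le_iff mult_ac)
    qed
    have e2: "?f1 * ?g1 - f w * g w - linear_part P (\<lambda>p. f w * G' p + g w * G p) v =
        ?f1 * (?g1 - g w - ?lg) + (?f1 - f w) * ?lg + g w * (?f1 - f w - ?lf)"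
      unfolding lin by (simp add: algebra_simps)
    have r2: "\<bar>?f1 * ?g1 - f w * g w - linear_part P (\<lambda>p. f w * G' p + g w * G p) v\<bar> \<le> 4 * (C * D) * ?s\<^sup>2"
    proof -
      have a: "\<bar>?f1 * (?g1 - g w - ?lg)\<bar> \<le> C * (D * ?s\<^sup>2)" "\<bar>(?f1 - f w) * ?lg\<bar> \<le> (C * ?s) * (D * ?s)"
        "\<bar>g w * (?f1 - f w - ?lf)\<bar> \<le> D * (C * ?s\<^sup>2)"
        by (intro ml fC gD f1 f2 g2 lg)+
      have "0 \<le> C * D * ?s\<^sup>2" using CD by simp
      then show ?thesis unfolding e2 using a by (simp add: abs_le_iff power2_eq_square mult_ac)
    qed
    \<comment> \<open>Arranged so that the orders of smallness in each product add up to 3;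
      \<open>?f1\<close> and \<open>g w\<close> count as order 0 and are bounded by \<open>C\<close>
      and \<open>D\<close>.\<close>
    have e3: "?f1 * ?g1 - f w * g w - linear_part P (\<lambda>p. f w * G' p + g w * G p) v -
          quadratic_part P (\<lambda>p q. f w * H' p q + g w * H p q + G p * G' q + G q * G' p) v / 2 =
        ?f1 * (?g1 - g w - ?lg - ?qg) + g w * (?f1 - f w - ?lf - ?qf) + ?lg * (?f1 - f w - ?lf) + ?qg * (?f1 - f w)"
      unfolding lin quad by (simp add: algebra_simps)
    have r3: "\<bar>?f1 * ?g1 - f w * g w - linear_part P (\<lambda>p. f w * G' p + g w * G p) v -
        quadratic_part P (\<lambda>p q. f w * H' p q + g w * H p q + G p * G' q + G q * G' p) v / 2\<bar> \<le> 4 * (C * D) * ?s ^ 3"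
    proof -
      have a: "\<bar>?f1 * (?g1 - g w - ?lg - ?qg)\<bar> \<le> C * (D * ?s ^ 3)" "\<bar>g w * (?f1 - f w - ?lf - ?qf)\<bar> \<le> D * (C * ?s ^ 3)"
        "\<bar>?lg * (?f1 - f w - ?lf)\<bar> \<le> (D * ?s) * (C * ?s\<^sup>2)" "\<bar>?qg * (?f1 - f w)\<bar> \<le> (D * ?s\<^sup>2) * (C * ?s)"
        by (intro ml fC gD f1 f2 f3 g3 lg qg)+
      have "0 \<le> C * D * ?s ^ 3" using CD s by simp
      then show ?thesis unfolding e3 using a
        by (simp add: abs_le_iff power2_eq_square power3_eq_cube mult_ac)
    qed
    note r1 r2 r3
  }
  then show ?thesis unfolding taylor3_def using CD G'' H'' fg by auto
qed

lemma taylor3_one_minus: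
  assumes f: "taylor3 P C f w G H"
  shows "taylor3 P (1 + C) (\<lambda>z. 1 - f z) w (\<lambda>p. - G p) (\<lambda>p q. - H p q)"
proof -
  have lin: "linear_part P (\<lambda>p. - G p) v = - linear_part P G v" for v
    by (simp add: linear_part_def sum_negf)
  have quad: "quadratic_part P (\<lambda>p q. - H p q) v = - quadratic_part P H v" for v
    by (simp add: quadratic_part_def sum_negf)
  have ab: "\<bar>(1 - f z) - (1 - f w)\<bar> = \<bar>f z - f w\<bar>" for z
    by simp
  have ac: "\<bar>(1 - f z) - (1 - f w) - - x\<bar> = \<bar>f z - f w - x\<bar>" for z x by linarith
  have ad: "\<bar>(1 - f z) - (1 - f w) - - x - - y / 2\<bar> = \<bar>f z - f w - x - y / 2\<bar>" for z x y by linarith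
  have le: "C * x \<le> (1 + C) * x" if "0 \<le> x" for x using that by (simp add: algebra_simps)
  show ?thesis
    unfolding taylor3_def lin quad ab ac ad
  proof (intro conjI allI ballI)
    show "\<bar>f (\<lambda>p. w p + v p) - f w\<bar> \<le> (1 + C) * l1norm P v" for v
      using f le[OF l1norm_nonneg, of P v] unfolding taylor3_def by (meson order_trans)
    show "\<bar>f (\<lambda>p. w p + v p) - f w - linear_part P G v\<bar> \<le> (1 + C) * (l1norm P v)\<^sup>2" for v
      using f le[OF zero_le_power[OF l1norm_nonneg], of P v 2] unfolding taylor3_def by (meson order_trans)
    show "\<bar>f (\<lambda>p. w p + v p) - f w - linear_part P G v - quadratic_part P H v / 2\<bar> \<le> (1 + C) * l1norm P v ^ 3" for v
      using f le[OF zero_le_power[OF l1norm_nonneg], of P v 3] unfolding taylor3_def by (meson order_trans)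
    show "\<bar>1 - f z\<bar> \<le> 1 + C" for z
    proof -
      have "\<bar>f z\<bar> \<le> C" using f by (auto simp: taylor3_def)
      then show ?thesis by linarith
    qed
  qed (use f in \<open>auto simp: taylor3_def add_increasing\<close>)
qed

lemma taylor3_one: "taylor3 P 1 (\<lambda>_. 1) w (\<lambda>_. 0) (\<lambda>_ _. 0)"
  by (simp add: taylor3_def linear_part_def quadratic_part_def l1norm_nonneg)

lemma taylor3_logistic_coord:
  assumes P: "finite P" "r \<in> P"
  shows "taylor3 P 1 (\<lambda>z. logistic (z r)) w
    (\<lambda>p. if p = r then (logistic (w r))\<^sup>2 - logistic (w r) else 0)
    (\<lambda>p q. if p = r \<and> q = r then (2 * logistic (w r) - 1) * ((logistic (w r))\<^sup>2 - logistic (w r)) else 0)"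
    (is "taylor3 P 1 ?f w ?G ?H")
proof -
  have lin: "linear_part P ?G v = ((logistic (w r))\<^sup>2 - logistic (w r)) * v r" for v
    using P by (simp add: linear_part_def if_distrib[of "\<lambda>x. x * _"] sum.delta cong: if_cong)
  have quad: "quadratic_part P ?H v = (2 * logistic (w r) - 1) * ((logistic (w r))\<^sup>2 - logistic (w r)) * (v r)\<^sup>2" for v
  proof -
    have "quadratic_part P ?H v = (\<Sum>p\<in>P. if p = r then (\<Sum>q\<in>P. if q = r then
        (2 * logistic (w r) - 1) * ((logistic (w r))\<^sup>2 - logistic (w r)) * (v r * v r) else 0) else 0)"
      unfolding quadratic_part_def by (auto intro!: sum.cong)
    then show ?thesis using P by (simp add: power2_eq_square)
  qed
  have vr: "\<bar>v r\<bar> \<le> l1norm P v" for v by (rule abs_le_l1norm[OF P])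
  note t = logistic_taylor
  show ?thesis
    unfolding taylor3_def lin quad
  proof (intro conjI allI ballI)
    show "\<bar>logistic (w r + v r) - logistic (w r)\<bar> \<le> 1 * l1norm P v" for v
      using t(4)[of "w r" "v r"] vr[of v] by simp
    show "\<bar>logistic (w r + v r) - logistic (w r) - ((logistic (w r))\<^sup>2 - logistic (w r)) * v r\<bar> \<le> 1 * (l1norm P v)\<^sup>2" for v
      using t(5)[of "w r" "v r"] power_mono[OF vr, of v 2] by simp
    show "\<bar>logistic (w r + v r) - logistic (w r) - ((logistic (w r))\<^sup>2 - logistic (w r)) * v r -
        (2 * logistic (w r) - 1) * ((logistic (w r))\<^sup>2 - logistic (w r)) * (v r)\<^sup>2 / 2\<bar> \<le> 1 * l1norm P v ^ 3" for v
      using t(6)[of "w r" "v r"] power_mono[OF vr, of v 3] by simp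
    show "\<bar>logistic (z r)\<bar> \<le> 1" for z
      using logistic_pos[of "z r"] logistic_less_1[of "z r"] by simp
    show "\<bar>?G p\<bar> \<le> 1" for p using t(1)[of "w r"] by auto
    show "\<bar>?H p q\<bar> \<le> 1" for p q using t(3)[of "w r"] by auto
  qed auto
qed

section \<open>The smoothed min-max and the signs of its derivatives\<close>

definition soft_row :: "'j set \<Rightarrow> 'i \<Rightarrow> ('i \<times> 'j \<Rightarrow> real) \<Rightarrow> real" where
  "soft_row J i z = (\<Prod>j\<in>J. logistic (z (i, j)))"

text \<open>A smooth version of the indicator that the minimum over \<open>I\<close> of the maximum
  over \<open>J\<close> is positive: \<open>soft_row\<close> is close to 1 only if all entries of
  the row are clearly negative.\<close>

definition soft_minmax :: "'i set \<Rightarrow> 'j set \<Rightarrow> ('i \<times> 'j \<Rightarrow> real) \<Rightarrow> real" where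
  "soft_minmax I J z = (\<Prod>i\<in>I. 1 - soft_row J i z)"

lemma soft_row_bounds: "0 \<le> soft_row J i z" "soft_row J i z \<le> 1"
  unfolding soft_row_def using logistic_pos logistic_less_1
  by (auto intro!: prod_nonneg prod_le_1 simp: less_imp_le)

lemma soft_minmax_bounds: "0 \<le> soft_minmax I J z" "soft_minmax I J z \<le> 1"
  unfolding soft_minmax_def using soft_row_bounds[of J _ z]
  by (auto intro!: prod_nonneg prod_le_1)

lemma soft_minmax_measurable [measurable]:
  assumes [measurable]: "\<And>p. p \<in> I \<times> J \<Longrightarrow> Z p \<in> borel_measurable M"
  shows "(\<lambda>\<omega>. soft_minmax I J (\<lambda>p. Z p \<omega>)) \<in> borel_measurable M"
  unfolding soft_minmax_def soft_row_def by measurable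

text \<open>\<open>C\<close> is chosen before \<open>w\<close>, as the replacement argument adds up
  remainders at random base points. Sign and support of the derivatives are recorded for the cross
  terms that arise when the rows are multiplied.\<close>

lemma soft_row_taylor3:
  assumes P: "finite P" and "finite J" "\<And>j. j \<in> J \<Longrightarrow> (i, j) \<in> P"
  shows "\<exists>C. \<forall>w. \<exists>G H. taylor3 P C (soft_row J i) w G H \<and> (\<forall>p. G p \<le> 0) \<and>
    (\<forall>p. fst p \<noteq> i \<longrightarrow> G p = 0) \<and> (\<forall>p q. fst p \<noteq> i \<or> fst q \<noteq> i \<longrightarrow> H p q = 0)"
  using assms(2,3)
proof (induction J rule: finite_induct)
  case empty
  show ?case unfolding soft_row_def
    by (intro exI[of _ 1] allI exI[of _ "\<lambda>_. 0"] exI[of _ "\<lambda>_ _. 0"]) (simp add: taylor3_one)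
next
  case (insert j J)
  then obtain C where C: "\<And>w. \<exists>G H. taylor3 P C (soft_row J i) w G H \<and> (\<forall>p. G p \<le> 0) \<and>
    (\<forall>p. fst p \<noteq> i \<longrightarrow> G p = 0) \<and> (\<forall>p q. fst p \<noteq> i \<or> fst q \<noteq> i \<longrightarrow> H p q = 0)"
    by auto
  have eq: "soft_row (insert j J) i = (\<lambda>z. logistic (z (i, j)) * soft_row J i z)"
    using insert by (simp add: soft_row_def fun_eq_iff)
  show ?case
  proof (intro exI[of _ "4 * (1 * C)"] allI)
    fix w
    obtain G H where GH: "taylor3 P C (soft_row J i) w G H" "\<forall>p. G p \<le> 0"
      "\<forall>p. fst p \<noteq> i \<longrightarrow> G p = 0" "\<forall>p q. fst p \<noteq> i \<or> fst q \<noteq> i \<longrightarrow> H p q = 0"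
      using C[of w] by blast
    have "(i, j) \<in> P" using insert by simp
    note t = taylor3_mult[OF taylor3_logistic_coord[OF P this, of w] GH(1)]
    let ?r = "(i, j)"
    show "\<exists>G H. taylor3 P (4 * (1 * C)) (soft_row (insert j J) i) w G H \<and> (\<forall>p. G p \<le> 0) \<and>
      (\<forall>p. fst p \<noteq> i \<longrightarrow> G p = 0) \<and> (\<forall>p q. fst p \<noteq> i \<or> fst q \<noteq> i \<longrightarrow> H p q = 0)"
      unfolding eq
    proof (intro exI conjI allI impI, rule t)
      fix p
      have "logistic (w ?r) * G p \<le> 0"
        using logistic_pos[of "w ?r"] GH(2)[rule_format, of p] by (simp add: mult_le_0_iff less_imp_le)
      moreover have "soft_row J i w * (if p = ?r then (logistic (w ?r))\<^sup>2 - logistic (w ?r) else 0) \<le> 0"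
        using soft_row_bounds(1)[of J i w] logistic_taylor(2)[of "w ?r"] by (simp add: mult_le_0_iff)
      ultimately show "logistic (w ?r) * G p + soft_row J i w * (if p = ?r then (logistic (w ?r))\<^sup>2 - logistic (w ?r) else 0) \<le> 0"
        by simp
    qed (use GH(3,4) in auto)
  qed
qed

text \<open>Entries of different rows sit in different factors \<open>1 - soft_row\<close>, each
  nonnegative and nondecreasing, so their mixed second derivative is nonnegative. Two entries of one
  row share a factor, and no sign is claimed for them.\<close>

lemma soft_minmax_taylor3:
  assumes "finite I" and J: "finite J" and P: "finite P" and "\<And>i j. i \<in> I \<Longrightarrow> j \<in> J \<Longrightarrow> (i, j) \<in> P"
  shows "\<exists>C. \<forall>w. \<exists>G H. taylor3 P C (soft_minmax I J) w G H \<and> (\<forall>p. 0 \<le> G p) \<and>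
    (\<forall>p q. fst p \<noteq> fst q \<longrightarrow> 0 \<le> H p q)"
  using assms(1,4)
proof (induction I rule: finite_induct)
  case empty
  show ?case unfolding soft_minmax_def
    by (intro exI[of _ 1] allI exI[of _ "\<lambda>_. 0"] exI[of _ "\<lambda>_ _. 0"]) (simp add: taylor3_one)
next
  case (insert i I)
  then obtain C where C: "\<And>w. \<exists>G H. taylor3 P C (soft_minmax I J) w G H \<and> (\<forall>p. 0 \<le> G p) \<and>
    (\<forall>p q. fst p \<noteq> fst q \<longrightarrow> 0 \<le> H p q)"
    by auto
  obtain D where D: "\<And>w. \<exists>G H. taylor3 P D (soft_row J i) w G H \<and> (\<forall>p. G p \<le> 0) \<and>
    (\<forall>p. fst p \<noteq> i \<longrightarrow> G p = 0) \<and> (\<forall>p q. fst p \<noteq> i \<or> fst q \<noteq> i \<longrightarrow> H p q = 0)"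
    using soft_row_taylor3[OF P J, of i] insert.prems by auto
  have eq: "soft_minmax (insert i I) J = (\<lambda>z. (1 - soft_row J i z) * soft_minmax I J z)"
    using insert by (simp add: soft_minmax_def fun_eq_iff)
  show ?case
  proof (intro exI[of _ "4 * ((1 + D) * C)"] allI)
    fix w
    obtain G H where GH: "taylor3 P C (soft_minmax I J) w G H" "\<forall>p. 0 \<le> G p"
      "\<forall>p q. fst p \<noteq> fst q \<longrightarrow> 0 \<le> H p q"
      using C[of w] by blast
    obtain G' H' where GH': "taylor3 P D (soft_row J i) w G' H'" "\<forall>p. G' p \<le> 0"
      "\<forall>p. fst p \<noteq> i \<longrightarrow> G' p = 0" "\<forall>p q. fst p \<noteq> i \<or> fst q \<noteq> i \<longrightarrow> H' p q = 0"
      using D[of w] by blast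
    note t = taylor3_mult[OF taylor3_one_minus[OF GH'(1)] GH(1)]
    have r: "0 \<le> 1 - soft_row J i w" "0 \<le> soft_minmax I J w"
      using soft_row_bounds[of J i w] soft_minmax_bounds[of I J w] by auto
    show "\<exists>G H. taylor3 P (4 * ((1 + D) * C)) (soft_minmax (insert i I) J) w G H \<and> (\<forall>p. 0 \<le> G p) \<and>
      (\<forall>p q. fst p \<noteq> fst q \<longrightarrow> 0 \<le> H p q)"
      unfolding eq
    proof (intro exI conjI allI impI, rule t)
      fix p show "0 \<le> (1 - soft_row J i w) * G p + soft_minmax I J w * - G' p"
        using r GH(2)[rule_format, of p] GH'(2)[rule_format, of p]
        by (intro add_nonneg_nonneg mult_nonneg_nonneg) simp_all
    next
      fix p q :: "'a \<times> 'b" assume pq: "fst p \<noteq> fst q"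
      \<comment> \<open>The new factor depends on row \<open>i\<close> alone, so it has no mixed
        derivative across rows; the cross terms multiply first derivatives of equal sign.\<close>
      then have "H' p q = 0" using GH'(4)[rule_format, of p q] by auto
      moreover have "0 \<le> (1 - soft_row J i w) * H p q" "0 \<le> - G' p * G q" "0 \<le> - G' q * G p"
        using r GH(2)[rule_format, of p] GH(2)[rule_format, of q] GH'(2)[rule_format, of p]
          GH'(2)[rule_format, of q] GH(3)[rule_format, OF pq]
        by (simp_all add: mult_nonpos_nonneg)
      ultimately show "0 \<le> (1 - soft_row J i w) * H p q + soft_minmax I J w * - H' p q + - G' p * G q + - G' q * G p"
        by simp
    qed
  qed
qed

section \<open>Gordon's comparison inequality\<close>

lemma integrable_gaussian_component:
  fixes f :: "real \<Rightarrow> real"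
  assumes d: "d \<in> D" and f: "integrable stdnorm f"
  shows "integrable (gaussian D) (\<lambda>\<xi>. f (\<xi> d))"
proof -
  have "integrable (distr (gaussian D) stdnorm (\<lambda>\<xi>. \<xi> d)) f"
    using distr_PiM_component[of D "\<lambda>_. stdnorm" d] prob_space_stdnorm d f by simp
  moreover have "(\<lambda>\<xi>. \<xi> d) \<in> measurable (gaussian D) stdnorm" using d by measurable
  moreover have "f \<in> borel_measurable stdnorm" using f by simp
  ultimately show ?thesis by (simp add: integrable_distr_eq)
qed

lemma integral_gaussian_component:
  fixes f :: "real \<Rightarrow> real"
  assumes d: "d \<in> D" and f: "f \<in> borel_measurable borel"
  shows "(\<integral>\<xi>. f (\<xi> d) \<partial>gaussian D) = (\<integral>x. f x \<partial>stdnorm)"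
proof -
  have "(\<integral>x. f x \<partial>stdnorm) = (\<integral>x. f x \<partial>distr (gaussian D) stdnorm (\<lambda>\<xi>. \<xi> d))"
    using distr_PiM_component[of D "\<lambda>_. stdnorm" d] prob_space_stdnorm d by simp
  also have "\<dots> = (\<integral>\<xi>. f (\<xi> d) \<partial>gaussian D)"
    using d f by (intro integral_distr) measurable
  finally show ?thesis ..
qed

lemma integrable_gaussian_product:
  assumes d: "d \<in> D" and e: "e \<in> D"
  shows "integrable (gaussian D) (\<lambda>\<xi>. \<xi> d * \<xi> e)"
proof (rule Bochner_Integration.integrable_bound)
  show "integrable (gaussian D) (\<lambda>\<xi>. (\<xi> d)\<^sup>2 + (\<xi> e)\<^sup>2)"
    using integrable_gaussian_component[OF d stdnorm_integrable_power[of 2]]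
      integrable_gaussian_component[OF e stdnorm_integrable_power[of 2]] by simp
  have "\<bar>x * y\<bar> \<le> x\<^sup>2 + y\<^sup>2" for x y :: real
  proof -
    have "0 \<le> (\<bar>x\<bar> - \<bar>y\<bar>)\<^sup>2" by simp
    then have "2 * (\<bar>x\<bar> * \<bar>y\<bar>) \<le> x\<^sup>2 + y\<^sup>2" by (simp add: power2_diff)
    moreover have "0 \<le> \<bar>x\<bar> * \<bar>y\<bar>" by simp
    ultimately show ?thesis unfolding abs_mult by linarith
  qed
  then show "AE \<xi> in gaussian D. norm (\<xi> d * \<xi> e) \<le> norm ((\<xi> d)\<^sup>2 + (\<xi> e)\<^sup>2)"
    by (intro AE_I2) (simp add: abs_of_nonneg)
qed (use d e in measurable)

lemma integral_gaussian_product: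
  assumes D: "finite D" and d: "d \<in> D" and e: "e \<in> D"
  shows "(\<integral>\<xi>. \<xi> d * \<xi> e \<partial>gaussian D) = (if d = e then 1 else 0)"
proof (cases "d = e")
  case True
  then show ?thesis
    using integral_gaussian_component[OF d, of "\<lambda>x. x\<^sup>2"] stdnorm_second_moment
    by (simp add: power2_eq_square)
next
  case False
  interpret product_sigma_finite "\<lambda>_. stdnorm" by unfold_locales
  let ?f = "\<lambda>i x. if i = d \<or> i = e then x else 1 :: real"
  have "(\<integral>\<xi>. \<xi> d * \<xi> e \<partial>gaussian D) = (\<integral>\<xi>. (\<Prod>i\<in>D. ?f i (\<xi> i)) \<partial>gaussian D)"
  proof (rule Bochner_Integration.integral_cong[OF refl])
    fix \<xi> :: "'a \<Rightarrow> real"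
    have "(\<Prod>i\<in>D. ?f i (\<xi> i)) = (\<Prod>i\<in>{d, e}. \<xi> i)"
      using D d e by (intro prod.mono_neutral_cong_right) auto
    then show "\<xi> d * \<xi> e = (\<Prod>i\<in>D. ?f i (\<xi> i))" using False by simp
  qed
  also have "\<dots> = (\<Prod>i\<in>D. \<integral>x. ?f i x \<partial>stdnorm)"
  proof (rule product_integral_prod[OF D])
    show "integrable stdnorm (?f i)" for i
      using stdnorm_integrable_power[of 1] by (cases "i = d \<or> i = e") auto
  qed
  also have "\<dots> = 0"
    using D d stdnorm_mean by (intro prod_zero bexI[of _ d]) auto
  finally show ?thesis using False by simp
qed

text \<open>From here on \<open>linear_part\<close> has a second role: with coefficients
  \<open>c\<close> and a Gaussian vector \<open>\<xi>\<close> it is a centered Gaussian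
  variable.\<close>

lemma linear_part_measurable [measurable]:
  "(\<lambda>\<xi>. linear_part D c \<xi>) \<in> borel_measurable (gaussian D)"
  unfolding linear_part_def by measurable

lemma integrable_linear_part: "integrable (gaussian D) (linear_part D c)"
  unfolding linear_part_def
  using integrable_gaussian_component[of _ D, OF _ stdnorm_integrable_power[of 1]] by simp

lemma integral_linear_part: "(\<integral>\<xi>. linear_part D c \<xi> \<partial>gaussian D) = 0"
  unfolding linear_part_def
  using integrable_gaussian_component[of _ D, OF _ stdnorm_integrable_power[of 1]]
    integral_gaussian_component[of _ D "\<lambda>x. x"] stdnorm_mean
  by (subst Bochner_Integration.integral_sum) auto

lemma integrable_linear_part_mult:
  "integrable (gaussian D) (\<lambda>\<xi>. linear_part D c \<xi> * linear_part D c' \<xi>)"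
proof -
  have "linear_part D c \<xi> * linear_part D c' \<xi> = (\<Sum>d\<in>D. \<Sum>e\<in>D. c d * c' e * (\<xi> d * \<xi> e))" for \<xi>
    by (simp add: linear_part_def sum_product mult_ac)
  then show ?thesis using integrable_gaussian_product[of _ D] by simp
qed

lemma integral_linear_part_mult:
  assumes D: "finite D"
  shows "(\<integral>\<xi>. linear_part D c \<xi> * linear_part D c' \<xi> \<partial>gaussian D) = (\<Sum>d\<in>D. c d * c' d)"
proof -
  have "linear_part D c \<xi> * linear_part D c' \<xi> = (\<Sum>d\<in>D. \<Sum>e\<in>D. c d * c' e * (\<xi> d * \<xi> e))" for \<xi>
    by (simp add: linear_part_def sum_product mult_ac)
  then have "(\<integral>\<xi>. linear_part D c \<xi> * linear_part D c' \<xi> \<partial>gaussian D) =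
      (\<Sum>d\<in>D. \<Sum>e\<in>D. c d * c' e * (\<integral>\<xi>. \<xi> d * \<xi> e \<partial>gaussian D))"
    using integrable_gaussian_product[of _ D] by simp
  also have "\<dots> = (\<Sum>d\<in>D. \<Sum>e\<in>D. if e = d then c d * c' e else 0)"
    using D by (intro sum.cong refl) (auto simp: integral_gaussian_product)
  also have "\<dots> = (\<Sum>d\<in>D. c d * c' d)"
    using D by simp
  finally show ?thesis .
qed

text \<open>Crude, through the largest entry: below, third moments only have to be finite.\<close>

lemma sum_power3_le:
  fixes x :: "'d \<Rightarrow> real"
  assumes D: "finite D" and x: "\<And>d. d \<in> D \<Longrightarrow> 0 \<le> x d"
  shows "(\<Sum>d\<in>D. x d) ^ 3 \<le> real (card D) ^ 3 * (\<Sum>d\<in>D. x d ^ 3)"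
proof (cases "D = {}")
  case False
  define m where "m = Max (x ` D)"
  have "m \<in> x ` D" unfolding m_def using D False by (intro Max_in) auto
  then obtain e where e: "e \<in> D" "m = x e" by auto
  have le: "x d \<le> x e" if "d \<in> D" for d
    using that D e(2) unfolding m_def by (metis Max_ge finite_imageI imageI)
  have "(\<Sum>d\<in>D. x d) \<le> card D * x e" using sum_bounded_above[of D x "x e"] le by simp
  then have "(\<Sum>d\<in>D. x d) ^ 3 \<le> (card D * x e) ^ 3"
    using x by (intro power_mono sum_nonneg)
  also have "\<dots> = real (card D) ^ 3 * x e ^ 3" by (simp add: power_mult_distrib)
  also have "x e ^ 3 \<le> (\<Sum>d\<in>D. x d ^ 3)" using D e x by (intro member_le_sum) auto
  finally show ?thesis by (simp add: mult_left_mono)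
qed simp

lemma integrable_l1norm_cube:
  assumes D: "finite D" and P: "finite P"
  shows "integrable (gaussian D) (\<lambda>\<xi>. l1norm P (\<lambda>p. linear_part D (a p) \<xi>) ^ 3)"
proof (rule Bochner_Integration.integrable_bound)
  let ?A = "\<Sum>p\<in>P. \<Sum>d\<in>D. \<bar>a p d\<bar>"
  show "integrable (gaussian D) (\<lambda>\<xi>. ?A ^ 3 * (real (card D) ^ 3 * (\<Sum>d\<in>D. \<bar>\<xi> d\<bar> ^ 3)))"
    using integrable_gaussian_component[of _ D, OF _ stdnorm_integrable_power_abs[of 3]] by simp
  show "(\<lambda>\<xi>. l1norm P (\<lambda>p. linear_part D (a p) \<xi>) ^ 3) \<in> borel_measurable (gaussian D)"
    unfolding l1norm_def by measurable
  have "l1norm P (\<lambda>p. linear_part D (a p) \<xi>) ^ 3 \<le> ?A ^ 3 * (real (card D) ^ 3 * (\<Sum>d\<in>D. \<bar>\<xi> d\<bar> ^ 3))" for \<xi>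
  proof -
    have "l1norm P (\<lambda>p. linear_part D (a p) \<xi>) \<le> (\<Sum>p\<in>P. (\<Sum>d\<in>D. \<bar>a p d\<bar>) * (\<Sum>d\<in>D. \<bar>\<xi> d\<bar>))"
      unfolding l1norm_def
    proof (rule sum_mono)
      fix p
      have "\<bar>linear_part D (a p) \<xi>\<bar> \<le> (\<Sum>d\<in>D. \<bar>a p d\<bar> * \<bar>\<xi> d\<bar>)"
        unfolding linear_part_def by (rule order_trans[OF sum_abs]) (simp add: abs_mult)
      also have "\<dots> \<le> (\<Sum>d\<in>D. \<bar>a p d\<bar> * (\<Sum>d\<in>D. \<bar>\<xi> d\<bar>))"
        using D by (intro sum_mono mult_left_mono member_le_sum) auto
      finally show "\<bar>linear_part D (a p) \<xi>\<bar> \<le> (\<Sum>d\<in>D. \<bar>a p d\<bar>) * (\<Sum>d\<in>D. \<bar>\<xi> d\<bar>)"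
        by (simp add: sum_distrib_right)
    qed
    then have "l1norm P (\<lambda>p. linear_part D (a p) \<xi>) ^ 3 \<le> (?A * (\<Sum>d\<in>D. \<bar>\<xi> d\<bar>)) ^ 3"
      by (intro power_mono l1norm_nonneg) (simp add: sum_distrib_right)
    also have "\<dots> = ?A ^ 3 * (\<Sum>d\<in>D. \<bar>\<xi> d\<bar>) ^ 3" by (simp add: power_mult_distrib)
    also have "\<dots> \<le> ?A ^ 3 * (real (card D) ^ 3 * (\<Sum>d\<in>D. \<bar>\<xi> d\<bar> ^ 3))"
      using D by (intro mult_left_mono sum_power3_le zero_le_power sum_nonneg) auto
    finally show ?thesis .
  qed
  moreover have "0 \<le> l1norm P (\<lambda>p. linear_part D (a p) \<xi>) ^ 3" for \<xi>
    by (intro zero_le_power l1norm_nonneg)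
  ultimately show "AE \<xi> in gaussian D. norm (l1norm P (\<lambda>p. linear_part D (a p) \<xi>) ^ 3) \<le>
      norm (?A ^ 3 * (real (card D) ^ 3 * (\<Sum>d\<in>D. \<bar>\<xi> d\<bar> ^ 3)))"
    by (intro AE_I2) (simp only: real_norm_def abs_of_nonneg, rule order_trans[OF _ abs_ge_self])
qed

text \<open>The linear term has mean zero and the quadratic term sees only covariances, so up to
  order \<open>r ^ 3\<close> the law enters through its covariances alone.\<close>

lemma taylor3_gaussian:
  assumes t: "taylor3 P C f w G H" and D: "finite D" and P: "finite P" and r: "0 \<le> r"
    and fm: "(\<lambda>\<xi>. f (\<lambda>p. w p + r * linear_part D (a p) \<xi>)) \<in> borel_measurable (gaussian D)"
  shows "\<bar>(\<integral>\<xi>. f (\<lambda>p. w p + r * linear_part D (a p) \<xi>) \<partial>gaussian D) - f w -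
      r\<^sup>2 / 2 * (\<Sum>p\<in>P. \<Sum>q\<in>P. H p q * (\<Sum>d\<in>D. a p d * a q d))\<bar>
    \<le> C * r ^ 3 * (\<integral>\<xi>. l1norm P (\<lambda>p. linear_part D (a p) \<xi>) ^ 3 \<partial>gaussian D)"
proof -
  interpret prob_space "gaussian D" by (rule prob_space_gaussian)
  let ?G = "gaussian D"
  let ?X = "\<lambda>\<xi> p. linear_part D (a p) \<xi>"
  let ?v = "\<lambda>\<xi> p. r * linear_part D (a p) \<xi>"
  have C: "0 \<le> C" and fC: "\<bar>f z\<bar> \<le> C" for z using t by (auto simp: taylor3_def)
  have intf: "integrable ?G (\<lambda>\<xi>. f (\<lambda>p. w p + ?v \<xi> p))"
    using fC by (intro integrable_const_bound[where B = C] fm) auto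
  have lin: "linear_part P G (?v \<xi>) = r * (\<Sum>p\<in>P. G p * ?X \<xi> p)" for \<xi>
    by (simp add: linear_part_def[of P] sum_distrib_left mult_ac)
  have quad: "quadratic_part P H (?v \<xi>) = r\<^sup>2 * (\<Sum>p\<in>P. \<Sum>q\<in>P. H p q * (?X \<xi> p * ?X \<xi> q))" for \<xi>
    by (simp add: quadratic_part_def sum_distrib_left power2_eq_square mult_ac)
  have intl: "integrable ?G (\<lambda>\<xi>. linear_part P G (?v \<xi>))"
    unfolding lin using integrable_linear_part[of D] by simp
  have intq: "integrable ?G (\<lambda>\<xi>. quadratic_part P H (?v \<xi>))"
    unfolding quad using integrable_linear_part_mult[of D] by simp
  have El: "(\<integral>\<xi>. linear_part P G (?v \<xi>) \<partial>?G) = 0"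
    unfolding lin using integrable_linear_part[of D] integral_linear_part[of D] by simp
  have Eq: "(\<integral>\<xi>. quadratic_part P H (?v \<xi>) \<partial>?G) = r\<^sup>2 * (\<Sum>p\<in>P. \<Sum>q\<in>P. H p q * (\<Sum>d\<in>D. a p d * a q d))"
    unfolding quad using integrable_linear_part_mult[of D] integral_linear_part_mult[OF D] by simp
  have "(\<integral>\<xi>. f (\<lambda>p. w p + ?v \<xi> p) - f w - linear_part P G (?v \<xi>) - quadratic_part P H (?v \<xi>) / 2 \<partial>?G) =
      (\<integral>\<xi>. f (\<lambda>p. w p + ?v \<xi> p) \<partial>?G) - f w - r\<^sup>2 / 2 * (\<Sum>p\<in>P. \<Sum>q\<in>P. H p q * (\<Sum>d\<in>D. a p d * a q d))"
    using intf intl intq by (simp add: El Eq prob_space)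
  moreover have "\<bar>\<integral>\<xi>. f (\<lambda>p. w p + ?v \<xi> p) - f w - linear_part P G (?v \<xi>) - quadratic_part P H (?v \<xi>) / 2 \<partial>?G\<bar>
      \<le> (\<integral>\<xi>. C * r ^ 3 * l1norm P (?X \<xi>) ^ 3 \<partial>?G)"
  proof (rule order_trans[OF integral_abs_bound integral_mono])
    show "integrable ?G (\<lambda>\<xi>. \<bar>f (\<lambda>p. w p + ?v \<xi> p) - f w - linear_part P G (?v \<xi>) - quadratic_part P H (?v \<xi>) / 2\<bar>)"
      using intf intl intq by simp
    show "integrable ?G (\<lambda>\<xi>. C * r ^ 3 * l1norm P (?X \<xi>) ^ 3)"
      using integrable_l1norm_cube[OF D P] by simp
    fix \<xi>
    have "l1norm P (?v \<xi>) = r * l1norm P (?X \<xi>)"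
      using r by (simp add: l1norm_def abs_mult sum_distrib_left)
    moreover have "\<bar>f (\<lambda>p. w p + ?v \<xi> p) - f w - linear_part P G (?v \<xi>) - quadratic_part P H (?v \<xi>) / 2\<bar> \<le> C * l1norm P (?v \<xi>) ^ 3"
      using t by (simp add: taylor3_def)
    ultimately show "\<bar>f (\<lambda>p. w p + ?v \<xi> p) - f w - linear_part P G (?v \<xi>) - quadratic_part P H (?v \<xi>) / 2\<bar> \<le> C * r ^ 3 * l1norm P (?X \<xi>) ^ 3"
      by (simp add: power_mult_distrib mult.assoc)
  qed
  ultimately show ?thesis by simp
qed

section \<open>Lindeberg replacement\<close>

lemma gaussian_add_scaled:
  fixes h :: "('d \<Rightarrow> real) \<Rightarrow> real"
  assumes D: "finite D" and h [measurable]: "h \<in> borel_measurable (gaussian D)" and hB: "\<And>x. \<bar>h x\<bar> \<le> B"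
    and s: "0 \<le> s" and t: "0 < t"
  shows "(\<integral>x. h (\<lambda>d\<in>D. sqrt (s + t) * x d) \<partial>gaussian D) =
    (\<integral>y. \<integral>x. h (\<lambda>d\<in>D. sqrt s * y d + sqrt t * x d) \<partial>gaussian D \<partial>gaussian D)"
proof -
  let ?G = "gaussian D"
  interpret G: prob_space ?G by (rule prob_space_gaussian)
  interpret GG: pair_prob_space ?G ?G ..
  define r where "r = sqrt (s + t)"
  have r: "0 < r" "r\<^sup>2 = s + t" using s t by (auto simp: r_def)
  \<comment> \<open>The rotation with cosine sqrt (t / (s + t)) turns one vector scaled by
    \<open>r\<close> into the sum of two independent pieces; \<open>0 < t\<close> keeps this cosine
    nonzero.\<close>
  define c where "c = sqrt t / r"
  define c' where "c' = sqrt s / r"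
  have c: "c \<noteq> 0" "c\<^sup>2 + c'\<^sup>2 = 1" "r * c = sqrt t" "r * c' = sqrt s"
    using r s t by (auto simp: c_def c'_def power_divide add_divide_distrib[symmetric])
  have rm [measurable]: "(\<lambda>x. \<lambda>d\<in>D. r * x d) \<in> measurable ?G ?G" by measurable
  have "(\<integral>x. h (\<lambda>d\<in>D. r * x d) \<partial>?G) = (\<integral>p. h (\<lambda>d\<in>D. r * fst p d) \<partial>(?G \<Otimes>\<^sub>M ?G))"
  proof -
    have "(\<integral>p. h (\<lambda>d\<in>D. r * fst p d) \<partial>(?G \<Otimes>\<^sub>M ?G)) = (\<integral>x. \<integral>y. h (\<lambda>d\<in>D. r * fst (x, y) d) \<partial>?G \<partial>?G)"
      by (subst GG.integral_fst') (auto intro!: GG.integrable_const_bound[where B = B] hB)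
    then show ?thesis by (simp add: G.prob_space)
  qed
  also have "\<dots> = (\<integral>p. h (\<lambda>d\<in>D. r * fst p d) \<partial>distr (?G \<Otimes>\<^sub>M ?G) (?G \<Otimes>\<^sub>M ?G)
      (\<lambda>(x, y). (\<lambda>i\<in>D. c * x i + c' * y i, \<lambda>i\<in>D. c * y i - c' * x i)))"
    by (simp only: distr_rotation_gaussian[OF D c(1,2)])
  also have "\<dots> = (\<integral>p. h (\<lambda>d\<in>D. sqrt s * snd p d + sqrt t * fst p d) \<partial>(?G \<Otimes>\<^sub>M ?G))"
  proof (subst integral_distr)
    have "r * (c * x + c' * y) = sqrt s * y + sqrt t * x" for x y
      by (simp add: distrib_left mult.assoc[symmetric] c(3,4))
    then show "(\<integral>p. h (\<lambda>d\<in>D. r * fst (case p of (x, y) \<Rightarrow> (\<lambda>i\<in>D. c * x i + c' * y i, \<lambda>i\<in>D. c * y i - c' * x i)) d) \<partial>(?G \<Otimes>\<^sub>M ?G)) =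
        (\<integral>p. h (\<lambda>d\<in>D. sqrt s * snd p d + sqrt t * fst p d) \<partial>(?G \<Otimes>\<^sub>M ?G))"
      by (auto intro!: Bochner_Integration.integral_cong arg_cong[of _ _ h] simp: fun_eq_iff)
  qed measurable
  also have "\<dots> = (\<integral>y. \<integral>x. h (\<lambda>d\<in>D. sqrt s * snd (x, y) d + sqrt t * fst (x, y) d) \<partial>?G \<partial>?G)"
    by (subst GG.integral_snd) (auto intro!: GG.integrable_const_bound[where B = B] hB simp: case_prod_beta')
  finally show ?thesis by (simp add: r_def)
qed

text \<open>The second-order terms differ by sums of \<open>H p q\<close> times a difference of
  covariances: this is zero within a row and a product of nonnegative numbers across rows.
  \<open>K\<close> collects the two cubic remainders and does not depend on
  \<open>w\<close>.\<close>

lemma soft_minmax_comparison_step: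
  fixes a :: "'i \<times> 'j \<Rightarrow> 'd \<Rightarrow> real" and b :: "'i \<times> 'j \<Rightarrow> 'e \<Rightarrow> real"
  assumes I: "finite I" and J: "finite J" and D: "finite D" and E: "finite E"
    and same: "\<And>p q. p \<in> I \<times> J \<Longrightarrow> q \<in> I \<times> J \<Longrightarrow> fst p = fst q \<Longrightarrow>
      (\<Sum>d\<in>D. a p d * a q d) = (\<Sum>e\<in>E. b p e * b q e)"
    and different: "\<And>p q. p \<in> I \<times> J \<Longrightarrow> q \<in> I \<times> J \<Longrightarrow> fst p \<noteq> fst q \<Longrightarrow>
      (\<Sum>e\<in>E. b p e * b q e) \<le> (\<Sum>d\<in>D. a p d * a q d)"
  shows "\<exists>K\<ge>0. \<forall>w r. 0 \<le> r \<longrightarrow>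
    (\<integral>\<zeta>. soft_minmax I J (\<lambda>p. w p + r * linear_part E (b p) \<zeta>) \<partial>gaussian E) - K * r ^ 3 \<le>
    (\<integral>\<xi>. soft_minmax I J (\<lambda>p. w p + r * linear_part D (a p) \<xi>) \<partial>gaussian D)"
proof -
  let ?P = "I \<times> J"
  let ?f = "soft_minmax I J"
  have P: "finite ?P" using I J by simp
  obtain C where C: "\<And>w. \<exists>G H. taylor3 ?P C ?f w G H \<and> (\<forall>p. 0 \<le> G p) \<and> (\<forall>p q. fst p \<noteq> fst q \<longrightarrow> 0 \<le> H p q)"
    using soft_minmax_taylor3[OF I J P] by auto
  let ?A = "\<integral>\<xi>. l1norm ?P (\<lambda>p. linear_part D (a p) \<xi>) ^ 3 \<partial>gaussian D"
  let ?B = "\<integral>\<xi>. l1norm ?P (\<lambda>p. linear_part E (b p) \<xi>) ^ 3 \<partial>gaussian E"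
  have "0 \<le> C" using C[of undefined] by (auto simp: taylor3_def)
  moreover have "0 \<le> ?A" "0 \<le> ?B"
    by (intro Bochner_Integration.integral_nonneg zero_le_power l1norm_nonneg)+
  ultimately have K: "0 \<le> C * (?A + ?B)" by simp
  show ?thesis
  proof (intro exI[of _ "C * (?A + ?B)"] conjI K allI impI)
    fix w and r :: real assume r: "0 \<le> r"
    obtain G H where GH: "taylor3 ?P C ?f w G H" "\<And>p q. fst p \<noteq> fst q \<Longrightarrow> 0 \<le> H p q"
      using C[of w] by blast
    have m: "(\<lambda>\<xi>. ?f (\<lambda>p. w p + r * linear_part D (a p) \<xi>)) \<in> borel_measurable (gaussian D)"
      "(\<lambda>\<xi>. ?f (\<lambda>p. w p + r * linear_part E (b p) \<xi>)) \<in> borel_measurable (gaussian E)"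
      by measurable
    have "(\<Sum>p\<in>?P. \<Sum>q\<in>?P. H p q * (\<Sum>e\<in>E. b p e * b q e)) \<le> (\<Sum>p\<in>?P. \<Sum>q\<in>?P. H p q * (\<Sum>d\<in>D. a p d * a q d))"
    proof (intro sum_mono)
      fix p q assume pq: "p \<in> ?P" "q \<in> ?P"
      show "H p q * (\<Sum>e\<in>E. b p e * b q e) \<le> H p q * (\<Sum>d\<in>D. a p d * a q d)"
      proof (cases "fst p = fst q")
        case True
        then show ?thesis using same[OF pq] by simp
      next
        case False
        show ?thesis by (intro mult_left_mono different pq False GH(2))
      qed
    qed
    then have "r\<^sup>2 / 2 * (\<Sum>p\<in>?P. \<Sum>q\<in>?P. H p q * (\<Sum>e\<in>E. b p e * b q e)) \<le>
        r\<^sup>2 / 2 * (\<Sum>p\<in>?P. \<Sum>q\<in>?P. H p q * (\<Sum>d\<in>D. a p d * a q d))"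
      by (rule mult_left_mono) simp
    moreover have "C * (?A + ?B) * r ^ 3 = C * r ^ 3 * ?A + C * r ^ 3 * ?B"
      by (simp add: algebra_simps)
    ultimately show "(\<integral>\<zeta>. ?f (\<lambda>p. w p + r * linear_part E (b p) \<zeta>) \<partial>gaussian E) - C * (?A + ?B) * r ^ 3 \<le>
        (\<integral>\<xi>. ?f (\<lambda>p. w p + r * linear_part D (a p) \<xi>) \<partial>gaussian D)"
      using taylor3_gaussian[OF GH(1) D P r m(1)] taylor3_gaussian[OF GH(1) E P r m(2)] by linarith
  qed
qed

lemma linear_part_restrict_cmult:
  "linear_part D c (\<lambda>d\<in>D. r * x d) = r * linear_part D c x"
  by (simp add: linear_part_def sum_distrib_left mult_ac)

lemma linear_part_restrict_add:
  "linear_part D c (\<lambda>d\<in>D. r * x d + s * y d) = r * linear_part D c x + s * linear_part D c y"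
  by (simp add: linear_part_def sum_distrib_left sum.distrib algebra_simps)

lemma soft_minmax_gaussian_add:
  assumes D: "finite D" and s: "0 \<le> s" and t: "0 < t"
  shows "(\<integral>x. soft_minmax I J (\<lambda>p. u p + sqrt (s + t) * linear_part D (a p) x) \<partial>gaussian D) =
    (\<integral>y. \<integral>x. soft_minmax I J (\<lambda>p. (u p + sqrt s * linear_part D (a p) y) + sqrt t * linear_part D (a p) x)
      \<partial>gaussian D \<partial>gaussian D)"
proof -
  let ?h = "\<lambda>x. soft_minmax I J (\<lambda>p. u p + linear_part D (a p) x)"
  have "\<bar>?h x\<bar> \<le> 1" for x
    using soft_minmax_bounds[of I J "\<lambda>p. u p + linear_part D (a p) x"] by simp
  then show ?thesis
    using gaussian_add_scaled[OF D _ _ s t, of ?h 1]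
    by (simp add: linear_part_restrict_add linear_part_restrict_cmult add.assoc)
qed

text \<open>Lindeberg's replacement argument, with the Gaussian vector split into \<open>N\<close> independent pieces of
  variance \<open>1/N\<close>; each replacement costs \<open>O(N powr (-3/2))\<close>.\<close>

lemma soft_minmax_comparison:
  fixes a :: "'i \<times> 'j \<Rightarrow> 'd \<Rightarrow> real" and b :: "'i \<times> 'j \<Rightarrow> 'e \<Rightarrow> real"
  assumes I: "finite I" and J: "finite J" and D: "finite D" and E: "finite E"
    and same: "\<And>p q. p \<in> I \<times> J \<Longrightarrow> q \<in> I \<times> J \<Longrightarrow> fst p = fst q \<Longrightarrow>
      (\<Sum>d\<in>D. a p d * a q d) = (\<Sum>e\<in>E. b p e * b q e)"
    and different: "\<And>p q. p \<in> I \<times> J \<Longrightarrow> q \<in> I \<times> J \<Longrightarrow> fst p \<noteq> fst q \<Longrightarrow>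
      (\<Sum>e\<in>E. b p e * b q e) \<le> (\<Sum>d\<in>D. a p d * a q d)"
  shows "(\<integral>\<zeta>. soft_minmax I J (\<lambda>p. w p + linear_part E (b p) \<zeta>) \<partial>gaussian E) \<le>
    (\<integral>\<xi>. soft_minmax I J (\<lambda>p. w p + linear_part D (a p) \<xi>) \<partial>gaussian D)"
proof -
  let ?f = "soft_minmax I J"
  let ?GD = "gaussian D" and ?GE = "gaussian E"
  interpret GD: prob_space ?GD by (rule prob_space_gaussian)
  interpret GE: prob_space ?GE by (rule prob_space_gaussian)
  interpret DE: pair_prob_space ?GD ?GE ..
  obtain K where K: "0 \<le> K \<and> (\<forall>w r. 0 \<le> r \<longrightarrow>
    (\<integral>\<zeta>. ?f (\<lambda>p. w p + r * linear_part E (b p) \<zeta>) \<partial>?GE) - K * r ^ 3 \<le>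
    (\<integral>\<xi>. ?f (\<lambda>p. w p + r * linear_part D (a p) \<xi>) \<partial>?GD))"
    using soft_minmax_comparison_step[OF I J D E same different] ..
  note step = K[THEN conjunct2, rule_format]
  have f1: "\<bar>?f z\<bar> \<le> 1" for z using soft_minmax_bounds[of I J z] by simp
  have av1: "\<bar>\<integral>\<zeta>. ?f (Z \<zeta>) \<partial>?GE\<bar> \<le> 1" if [measurable]: "(\<lambda>\<zeta>. ?f (Z \<zeta>)) \<in> borel_measurable ?GE" for Z
  proof -
    have "\<bar>\<integral>\<zeta>. ?f (Z \<zeta>) \<partial>?GE\<bar> \<le> (\<integral>\<zeta>. 1 \<partial>?GE)"
      by (rule order_trans[OF integral_abs_bound integral_mono])
        (use f1 in \<open>auto intro!: GE.integrable_const_bound[where B = 1] simp del: GE.prob_space\<close>)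
    then show ?thesis by (simp add: GE.prob_space)
  qed
  \<comment> \<open>The mixture with variance \<open>t\<close> on the \<open>b\<close> side and
    \<open>s\<close> on the \<open>a\<close> side; \<open>T 0 1\<close> and \<open>T 1 0\<close> are
    the two sides of the claim.\<close>
  define T where "T s t = (\<integral>\<zeta>. \<integral>\<xi>. ?f (\<lambda>p. (w p + sqrt t * linear_part E (b p) \<zeta>) + sqrt s * linear_part D (a p) \<xi>) \<partial>?GD \<partial>?GE)"
    for s t
  \<comment> \<open>Variance \<open>e\<close> moves from the \<open>b\<close> forms to the
    \<open>a\<close> forms: a piece of that variance is split off on either side, and the comparison
    step applies to it with all the rest frozen in \<open>u\<close>.\<close>
  have T_step: "T s (t + e) - K * sqrt e ^ 3 \<le> T (s + e) t" if s: "0 \<le> s" and t: "0 \<le> t" and e: "0 < e" for s t e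
  proof -
    define u where "u \<zeta> y p = w p + sqrt t * linear_part E (b p) \<zeta> + sqrt s * linear_part D (a p) y" for \<zeta> y p
    have u_meas [measurable]: "(\<lambda>q. u (snd q) (fst q) p) \<in> borel_measurable (?GD \<Otimes>\<^sub>M ?GE)" for p
      unfolding u_def by measurable
    define R where "R \<zeta> y = (\<integral>z. ?f (\<lambda>p. u \<zeta> y p + sqrt e * linear_part E (b p) z) \<partial>?GE)" for \<zeta> y
    define Q where "Q \<zeta> y = (\<integral>x. ?f (\<lambda>p. u \<zeta> y p + sqrt e * linear_part D (a p) x) \<partial>?GD)" for \<zeta> y
    have R_meas: "(\<lambda>q. R (snd q) (fst q)) \<in> borel_measurable (?GD \<Otimes>\<^sub>M ?GE)"
      unfolding R_def u_def by measurable
    have Q_meas: "(\<lambda>q. Q (snd q) (fst q)) \<in> borel_measurable (?GD \<Otimes>\<^sub>M ?GE)"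
      unfolding Q_def u_def by measurable
    have R1: "\<bar>R \<zeta> y\<bar> \<le> 1" for \<zeta> y
      unfolding R_def by (rule av1) measurable
    have Q1: "\<bar>Q \<zeta> y\<bar> \<le> 1" for \<zeta> y
    proof -
      have "\<bar>Q \<zeta> y\<bar> \<le> (\<integral>\<zeta>. 1 \<partial>?GD)" unfolding Q_def
        by (rule order_trans[OF integral_abs_bound integral_mono])
          (use f1 in \<open>auto intro!: GD.integrable_const_bound[where B = 1] simp del: GD.prob_space\<close>)
      then show ?thesis by (simp add: GD.prob_space)
    qed
    have intR: "integrable (?GD \<Otimes>\<^sub>M ?GE) (\<lambda>q. R (snd q) (fst q))"
      using R1 R_meas by (intro DE.integrable_const_bound[where B = 1]) auto
    have intQ: "integrable (?GD \<Otimes>\<^sub>M ?GE) (\<lambda>q. Q (snd q) (fst q))"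
      using Q1 Q_meas by (intro DE.integrable_const_bound[where B = 1]) auto
    have RQ: "R \<zeta> y - K * sqrt e ^ 3 \<le> Q \<zeta> y" for \<zeta> y
      unfolding R_def Q_def by (rule step) (use e in simp)
    have TQ: "T (s + e) t = (\<integral>\<zeta>. \<integral>y. Q \<zeta> y \<partial>?GD \<partial>?GE)"
      unfolding T_def Q_def u_def soft_minmax_gaussian_add[OF D s e] ..
    have int_f: "integrable (?GD \<Otimes>\<^sub>M ?GE) (\<lambda>(x, y). ?f (\<lambda>p. (w p + r * linear_part E (b p) y) + r' * linear_part D (a p) x))" for r r'
      using f1 by (intro DE.integrable_const_bound[where B = 1]) (auto simp: split_beta')
    have "T s (t + e) = (\<integral>\<xi>. \<integral>\<zeta>. ?f (\<lambda>p. (w p + sqrt (t + e) * linear_part E (b p) \<zeta>) + sqrt s * linear_part D (a p) \<xi>) \<partial>?GE \<partial>?GD)"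
      unfolding T_def by (rule DE.Fubini_integral[OF int_f])
    also have "\<dots> = (\<integral>\<xi>. \<integral>\<zeta>. ?f (\<lambda>p. (w p + sqrt s * linear_part D (a p) \<xi>) + sqrt (t + e) * linear_part E (b p) \<zeta>) \<partial>?GE \<partial>?GD)"
      by (simp add: add_ac)
    also have "\<dots> = (\<integral>\<xi>. \<integral>\<zeta>. R \<zeta> \<xi> \<partial>?GE \<partial>?GD)"
      unfolding soft_minmax_gaussian_add[OF E t e] R_def u_def by (simp add: add_ac)
    also have "\<dots> = (\<integral>\<zeta>. \<integral>\<xi>. R \<zeta> \<xi> \<partial>?GD \<partial>?GE)"
      using intR by (intro DE.Fubini_integral[symmetric]) (simp add: split_beta')
    finally have TR: "T s (t + e) = (\<integral>\<zeta>. \<integral>\<xi>. R \<zeta> \<xi> \<partial>?GD \<partial>?GE)" .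
    \<comment> \<open>As integrals over the product space, both sides can be compared pointwise
      through \<open>RQ\<close>.\<close>
    have TR': "T s (t + e) = (\<integral>q. R (snd q) (fst q) \<partial>(?GD \<Otimes>\<^sub>M ?GE))"
      unfolding TR using DE.integral_snd[of "\<lambda>x y. R y x"] intR by (simp add: split_beta')
    have TQ': "T (s + e) t = (\<integral>q. Q (snd q) (fst q) \<partial>(?GD \<Otimes>\<^sub>M ?GE))"
      unfolding TQ using DE.integral_snd[of "\<lambda>x y. Q y x"] intQ by (simp add: split_beta')
    have "(\<integral>q. R (snd q) (fst q) - K * sqrt e ^ 3 \<partial>(?GD \<Otimes>\<^sub>M ?GE)) \<le> (\<integral>q. Q (snd q) (fst q) \<partial>(?GD \<Otimes>\<^sub>M ?GE))"
      using intR intQ by (intro integral_mono RQ) auto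
    then show ?thesis
      unfolding TR' TQ' using intR by (simp add: DE.prob_space)
  qed
  have T_chain: "T (1 - real k / N) (real k / N) - k * (K * sqrt (1 / N) ^ 3) \<le> T 1 0"
    if "0 < N" "k \<le> N" for k N :: nat
    using that(2)
  proof (induction k)
    case (Suc k)
    have "T (1 - real (Suc k) / N) (real k / N + 1 / N) - K * sqrt (1 / N) ^ 3 \<le> T (1 - real (Suc k) / N + 1 / N) (real k / N)"
      using Suc that(1) by (intro T_step) (auto simp: field_simps)
    moreover have "real k / N + 1 / N = real (Suc k) / N" "1 - real (Suc k) / N + 1 / N = 1 - real k / N"
      by (auto simp: add_divide_distrib)
    ultimately have "T (1 - real (Suc k) / N) (real (Suc k) / N) - K * sqrt (1 / N) ^ 3 \<le> T (1 - real k / N) (real k / N)"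
      by (simp only:)
    moreover have "real (Suc k) * (K * sqrt (1 / N) ^ 3) = K * sqrt (1 / N) ^ 3 + k * (K * sqrt (1 / N) ^ 3)"
      by (simp add: distrib_right)
    ultimately show ?case using Suc by linarith
  qed simp
  \<comment> \<open>\<open>Suc N\<close> replacements of variance 1 / \<open>Suc N\<close> cost its
    power -1/2 in total, which tends to 0.\<close>
  have T_N: "T 0 1 - K * sqrt (1 / real (Suc N)) \<le> T 1 0" for N
  proof -
    have "real (Suc N) * sqrt (1 / real (Suc N)) ^ 3 = sqrt (1 / real (Suc N))"
      by (simp add: power3_eq_cube real_sqrt_mult[symmetric] del: of_nat_Suc)
    then show ?thesis using T_chain[of "Suc N" "Suc N"]
      by (simp add: mult.left_commute del: of_nat_Suc)
  qed
  have "(\<lambda>N. T 0 1 - K * sqrt (1 / real (Suc N))) \<longlonglongrightarrow> T 0 1 - K * sqrt 0"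
    by (intro tendsto_intros LIMSEQ_Suc[OF lim_1_over_n])
  then have "T 0 1 \<le> T 1 0"
    using T_N by (intro LIMSEQ_le_const2[of _ "T 0 1"]) auto
  then show ?thesis
    by (simp add: T_def GD.prob_space GE.prob_space)
qed

section \<open>From the smoothed to the exact min-max\<close>

definition logistic_limit :: "real \<Rightarrow> real" where
  "logistic_limit z = (if z < 0 then 1 else if z = 0 then 1 / 2 else 0)"

lemma logistic_limit_bounds: "0 \<le> logistic_limit z" "logistic_limit z \<le> 1"
  by (auto simp: logistic_limit_def)

lemma logistic_scaled_tendsto: "(\<lambda>n. logistic (real n * z)) \<longlonglongrightarrow> logistic_limit z"
proof -
  have pow: "exp (real n * z) = exp z ^ n" for n z by (simp add: exp_of_nat_mult)
  consider "z < 0" | "z = 0" | "z > 0" by linarith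
  then show ?thesis
  proof cases
    case 1
    have lim: "(\<lambda>n. exp z ^ n) \<longlonglongrightarrow> 0" using 1 by (intro LIMSEQ_power_zero) simp
    have "(\<lambda>n. 1 / (1 + exp z ^ n)) \<longlonglongrightarrow> 1 / (1 + 0)"
      by (intro tendsto_divide tendsto_add tendsto_const lim) simp
    then show ?thesis using 1 by (simp add: logistic_def pow logistic_limit_def)
  next
    case 2
    then show ?thesis by (simp add: logistic_def logistic_limit_def)
  next
    case 3
    have lim: "(\<lambda>n. exp (- z) ^ n) \<longlonglongrightarrow> 0" using 3 by (intro LIMSEQ_power_zero) simp
    have le: "logistic (real n * z) \<le> exp (- z) ^ n" for n
    proof -
      have "1 / (1 + exp z ^ n) \<le> 1 / exp z ^ n"
        by (intro divide_left_mono mult_pos_pos add_pos_pos) auto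
      then show ?thesis by (simp add: logistic_def pow exp_minus power_inverse inverse_eq_divide power_one_over)
    qed
    have "(\<lambda>n. logistic (real n * z)) \<longlonglongrightarrow> 0"
      by (rule tendsto_sandwich[OF _ _ tendsto_const lim])
        (intro always_eventually allI le less_imp_le[OF logistic_pos])+
    then show ?thesis using 3 by (simp add: logistic_limit_def)
  qed
qed

text \<open>Because of the value 1 / 2 at zero entries this is no indicator; it lies between the
  indicators for positive and for nonnegative entries. Hence the strict inequality on one side of
  \<open>gordon_finite\<close> and the weak one on the other.\<close>

definition hard_minmax :: "'i set \<Rightarrow> 'j set \<Rightarrow> ('i \<times> 'j \<Rightarrow> real) \<Rightarrow> real" where
  "hard_minmax I J z = (\<Prod>i\<in>I. 1 - (\<Prod>j\<in>J. logistic_limit (z (i, j))))"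

lemma soft_minmax_scaled_tendsto:
  "(\<lambda>n. soft_minmax I J (\<lambda>p. real n * z p)) \<longlonglongrightarrow> hard_minmax I J z"
  unfolding soft_minmax_def soft_row_def hard_minmax_def
  by (intro tendsto_intros tendsto_prod logistic_scaled_tendsto)

lemma hard_minmax_le_indicator:
  assumes I: "finite I" and J: "finite J"
  shows "hard_minmax I J z \<le> of_bool (\<forall>i\<in>I. \<exists>j\<in>J. 0 \<le> z (i, j))"
proof (cases "\<forall>i\<in>I. \<exists>j\<in>J. 0 \<le> z (i, j)")
  case True
  have "hard_minmax I J z \<le> 1"
    unfolding hard_minmax_def using logistic_limit_bounds
    by (intro prod_le_1) (auto intro!: prod_nonneg prod_le_1)
  then show ?thesis using True by simp
next
  case False
  then obtain i where "i \<in> I" "\<forall>j\<in>J. z (i, j) < 0" by force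
  then have "(\<Prod>j\<in>J. logistic_limit (z (i, j))) = 1"
    by (intro prod.neutral) (auto simp: logistic_limit_def)
  then have "hard_minmax I J z = 0"
    unfolding hard_minmax_def using I \<open>i \<in> I\<close> by (intro prod_zero) auto
  then show ?thesis by simp
qed

lemma indicator_le_hard_minmax:
  assumes I: "finite I" and J: "finite J"
  shows "of_bool (\<forall>i\<in>I. \<exists>j\<in>J. 0 < z (i, j)) \<le> hard_minmax I J z"
proof (cases "\<forall>i\<in>I. \<exists>j\<in>J. 0 < z (i, j)")
  case True
  have "hard_minmax I J z = 1"
    unfolding hard_minmax_def
  proof (intro prod.neutral ballI)
    fix i assume "i \<in> I"
    then obtain j where "j \<in> J" "0 < z (i, j)" using True by blast
    then have "(\<Prod>j\<in>J. logistic_limit (z (i, j))) = 0"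
      using J by (intro prod_zero bexI[of _ j]) (auto simp: logistic_limit_def)
    then show "1 - (\<Prod>j\<in>J. logistic_limit (z (i, j))) = 1" by simp
  qed
  then show ?thesis by simp
next
  case False
  have "0 \<le> hard_minmax I J z"
    unfolding hard_minmax_def using logistic_limit_bounds
    by (intro prod_nonneg) (auto intro!: prod_nonneg prod_le_1)
  then show ?thesis using False by (auto simp: of_bool_def)
qed

text \<open>The covariances of pairs with the same first index agree, so no sign of the corresponding second
  derivatives of the smoothed min-max function is needed.\<close>

lemma gordon_finite:
  fixes a :: "'i \<times> 'j \<Rightarrow> 'd \<Rightarrow> real" and b :: "'i \<times> 'j \<Rightarrow> 'e \<Rightarrow> real"
  assumes I: "finite I" and J: "finite J" and D: "finite D" and E: "finite E"
    and same: "\<And>p q. p \<in> I \<times> J \<Longrightarrow> q \<in> I \<times> J \<Longrightarrow> fst p = fst q \<Longrightarrow>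
      (\<Sum>d\<in>D. a p d * a q d) = (\<Sum>e\<in>E. b p e * b q e)"
    and different: "\<And>p q. p \<in> I \<times> J \<Longrightarrow> q \<in> I \<times> J \<Longrightarrow> fst p \<noteq> fst q \<Longrightarrow>
      (\<Sum>e\<in>E. b p e * b q e) \<le> (\<Sum>d\<in>D. a p d * a q d)"
  shows "measure (gaussian E) {\<zeta> \<in> space (gaussian E). \<forall>i\<in>I. \<exists>j\<in>J. 0 < w (i, j) + linear_part E (b (i, j)) \<zeta>} \<le>
    measure (gaussian D) {\<xi> \<in> space (gaussian D). \<forall>i\<in>I. \<exists>j\<in>J. 0 \<le> w (i, j) + linear_part D (a (i, j)) \<xi>}"
proof -
  let ?GD = "gaussian D" and ?GE = "gaussian E"
  interpret GD: prob_space ?GD by (rule prob_space_gaussian)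
  interpret GE: prob_space ?GE by (rule prob_space_gaussian)
  let ?Y = "\<lambda>\<zeta> p. w p + linear_part E (b p) \<zeta>" and ?X = "\<lambda>\<xi> p. w p + linear_part D (a p) \<xi>"
  have scale: "linear_part S (\<lambda>d. k * c d) x = k * linear_part S c x" for S k c and x :: "'z \<Rightarrow> real"
    by (simp add: linear_part_def sum_distrib_left mult_ac)
  \<comment> \<open>Scaling offsets and coefficients by \<open>n\<close> multiplies all covariances
    by the square of \<open>n\<close>, which preserves both hypotheses.\<close>
  have comp: "(\<integral>\<zeta>. soft_minmax I J (\<lambda>p. real n * ?Y \<zeta> p) \<partial>?GE) \<le> (\<integral>\<xi>. soft_minmax I J (\<lambda>p. real n * ?X \<xi> p) \<partial>?GD)" for n
  proof -
    have sc: "(\<Sum>d\<in>S. (n * c p d) * (n * c q d)) = (real n)\<^sup>2 * (\<Sum>d\<in>S. c p d * c q d)"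
      for c :: "'i \<times> 'j \<Rightarrow> 'z \<Rightarrow> real" and S p q
      by (simp add: sum_distrib_left power2_eq_square mult_ac)
    have "(\<integral>\<zeta>. soft_minmax I J (\<lambda>p. real n * w p + linear_part E (\<lambda>d. n * b p d) \<zeta>) \<partial>?GE) \<le>
        (\<integral>\<xi>. soft_minmax I J (\<lambda>p. real n * w p + linear_part D (\<lambda>d. n * a p d) \<xi>) \<partial>?GD)"
    proof (rule soft_minmax_comparison[OF I J D E])
      fix p q assume pq: "p \<in> I \<times> J" "q \<in> I \<times> J"
      show "(\<Sum>d\<in>D. n * a p d * (n * a q d)) = (\<Sum>e\<in>E. n * b p e * (n * b q e))" if "fst p = fst q"
        by (simp only: sc same[OF pq that])
      show "(\<Sum>e\<in>E. n * b p e * (n * b q e)) \<le> (\<Sum>d\<in>D. n * a p d * (n * a q d))" if "fst p \<noteq> fst q"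
        unfolding sc by (intro mult_left_mono different[OF pq that]) simp
    qed
    then show ?thesis by (simp add: scale distrib_left)
  qed
  have bd: "norm (soft_minmax I J z) \<le> 1" for z using soft_minmax_bounds[of I J z] by simp
  have hm: "(\<lambda>\<xi>. hard_minmax I J (\<lambda>p. w p + linear_part S (c p) \<xi>)) \<in> borel_measurable (gaussian S)"
    for S and c :: "'i \<times> 'j \<Rightarrow> 'z \<Rightarrow> real"
    unfolding hard_minmax_def logistic_limit_def by measurable
  have hb: "\<bar>hard_minmax I J z\<bar> \<le> 1" for z
    using soft_minmax_scaled_tendsto[of I J z] bd
    by (intro LIMSEQ_le_const2[OF tendsto_rabs[of _ "hard_minmax I J z"]]) auto
  have limE: "(\<lambda>n. \<integral>\<zeta>. soft_minmax I J (\<lambda>p. real n * ?Y \<zeta> p) \<partial>?GE) \<longlonglongrightarrow> (\<integral>\<zeta>. hard_minmax I J (?Y \<zeta>) \<partial>?GE)"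
    by (rule integral_dominated_convergence[where w = "\<lambda>_. 1"])
      (use hm bd in \<open>auto intro!: soft_minmax_scaled_tendsto\<close>)
  have limD: "(\<lambda>n. \<integral>\<xi>. soft_minmax I J (\<lambda>p. real n * ?X \<xi> p) \<partial>?GD) \<longlonglongrightarrow> (\<integral>\<xi>. hard_minmax I J (?X \<xi>) \<partial>?GD)"
    by (rule integral_dominated_convergence[where w = "\<lambda>_. 1"])
      (use hm bd in \<open>auto intro!: soft_minmax_scaled_tendsto\<close>)
  have mid: "(\<integral>\<zeta>. hard_minmax I J (?Y \<zeta>) \<partial>?GE) \<le> (\<integral>\<xi>. hard_minmax I J (?X \<xi>) \<partial>?GD)"
    using comp by (intro LIMSEQ_le[OF limE limD]) auto
  let ?SE = "{\<zeta> \<in> space ?GE. \<forall>i\<in>I. \<exists>j\<in>J. 0 < ?Y \<zeta> (i, j)}"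
  let ?SD = "{\<xi> \<in> space ?GD. \<forall>i\<in>I. \<exists>j\<in>J. 0 \<le> ?X \<xi> (i, j)}"
  have SE: "?SE \<in> sets ?GE" using I J by measurable
  have SD: "?SD \<in> sets ?GD" using I J by measurable
  have "measure ?GE ?SE = (\<integral>\<zeta>. indicator ?SE \<zeta> \<partial>?GE)" using SE by simp
  also have "\<dots> \<le> (\<integral>\<zeta>. hard_minmax I J (?Y \<zeta>) \<partial>?GE)"
  proof (rule integral_mono)
    show "integrable ?GE (indicator ?SE :: _ \<Rightarrow> real)" using SE by (simp add: integrable_indicator_iff GE.emeasure_finite less_top[symmetric])
    show "integrable ?GE (\<lambda>\<zeta>. hard_minmax I J (?Y \<zeta>))"
      using hb hm by (intro GE.integrable_const_bound[where B = 1]) auto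
    show "indicator ?SE \<zeta> \<le> hard_minmax I J (?Y \<zeta>)" if "\<zeta> \<in> space ?GE" for \<zeta>
      using indicator_le_hard_minmax[OF I J, of "?Y \<zeta>"] that by (simp add: indicator_def of_bool_def)
  qed
  also note mid
  also have "(\<integral>\<xi>. hard_minmax I J (?X \<xi>) \<partial>?GD) \<le> (\<integral>\<xi>. indicator ?SD \<xi> \<partial>?GD)"
  proof (rule integral_mono)
    show "integrable ?GD (indicator ?SD :: _ \<Rightarrow> real)" using SD by (simp add: integrable_indicator_iff GD.emeasure_finite less_top[symmetric])
    show "integrable ?GD (\<lambda>\<xi>. hard_minmax I J (?X \<xi>))"
      using hb hm by (intro GD.integrable_const_bound[where B = 1]) auto
    show "hard_minmax I J (?X \<xi>) \<le> indicator ?SD \<xi>" if "\<xi> \<in> space ?GD" for \<xi>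
      using hard_minmax_le_indicator[OF I J, of "?X \<xi>"] that by (simp add: indicator_def of_bool_def)
  qed
  also have "\<dots> = measure ?GD ?SD" using SD by simp
  finally show ?thesis .
qed

section \<open>Projections onto closed convex cones\<close>

lemma sqnormn_eq_dotn: "sqnormn n x = dotn n x x"
  by (simp add: sqnormn_def dotn_def power2_eq_square)

lemma sqnormn_nonneg: "0 \<le> sqnormn n x"
  by (simp add: sqnormn_def sum_nonneg)

lemma sqdistn_nonneg: "0 \<le> sqdistn n x y"
  by (simp add: sqdistn_def sum_nonneg)

lemma dotn_commute: "dotn n x y = dotn n y x"
  by (simp add: dotn_def mult.commute)

lemma dotn_vadd_left: "dotn n (vadd n x y) z = dotn n x z + dotn n y z"
  by (simp add: dotn_def vadd_def distrib_right sum.distrib)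

lemma dotn_vadd_right: "dotn n z (vadd n x y) = dotn n z x + dotn n z y"
  by (simp add: dotn_def vadd_def distrib_left sum.distrib)

lemma dotn_vscale_left: "dotn n (vscale n c x) z = c * dotn n x z"
  by (simp add: dotn_def vscale_def sum_distrib_left mult_ac)

lemma dotn_vscale_right: "dotn n z (vscale n c x) = c * dotn n z x"
  by (simp add: dotn_def vscale_def sum_distrib_left mult_ac)

lemmas dotn_simps = dotn_vadd_left dotn_vadd_right dotn_vscale_left dotn_vscale_right

lemma sqnormn_vscale: "sqnormn n (vscale n c x) = c\<^sup>2 * sqnormn n x"
  by (simp add: sqnormn_eq_dotn dotn_simps power2_eq_square)

lemma sqdistn_expand: "sqdistn n x y = sqnormn n x - 2 * dotn n x y + sqnormn n y"
  by (simp add: sqdistn_def sqnormn_def dotn_def power2_diff sum.distrib sum_subtractf sum_distrib_left mult.assoc)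

lemma dotn_cauchy_schwarz: "\<bar>dotn n x y\<bar> \<le> sqrt (sqnormn n x) * sqrt (sqnormn n y)"
proof -
  have "(dotn n x y)\<^sup>2 \<le> sqnormn n x * sqnormn n y"
    unfolding dotn_def sqnormn_def by (rule Cauchy_Schwarz_ineq_sum)
  then have "sqrt ((dotn n x y)\<^sup>2) \<le> sqrt (sqnormn n x * sqnormn n y)" by (rule real_sqrt_le_mono)
  then show ?thesis by (simp add: real_sqrt_mult)
qed

lemma two_dotn_le: "2 * dotn n x y \<le> c * sqnormn n x + sqnormn n y / c" if "0 < c"
proof -
  have "2 * (a * b) \<le> c * a\<^sup>2 + b\<^sup>2 / c" for a b :: real
  proof -
    have "0 \<le> (c * a - b)\<^sup>2 / c" using that by simp
    also have "\<dots> = c * a\<^sup>2 + b\<^sup>2 / c - 2 * (a * b)"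
      using that by (simp add: power2_eq_square field_simps)
    finally show ?thesis by simp
  qed
  then have "(\<Sum>i<n. 2 * (x i * y i)) \<le> (\<Sum>i<n. c * (x i)\<^sup>2 + (y i)\<^sup>2 / c)"
    by (intro sum_mono)
  then show ?thesis
    by (simp add: dotn_def sqnormn_def sum_distrib_left sum.distrib sum_divide_distrib)
qed

lemma member_sqdistn_le: "i < n \<Longrightarrow> (x i - y i)\<^sup>2 \<le> sqdistn n x y"
  unfolding sqdistn_def by (rule member_le_sum[of i "{..<n}" "\<lambda>i. (x i - y i)\<^sup>2"]) auto

lemma Rn_eqI:
  assumes "x \<in> Rn n" "y \<in> Rn n" and "sqdistn n x y \<le> 0"
  shows "x = y"
proof
  fix i
  show "x i = y i"
  proof (cases "i < n")
    case True
    then have "(x i - y i)\<^sup>2 \<le> 0" using member_sqdistn_le[of i n x y] assms(3) by linarith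
    then show ?thesis by simp
  qed (use assms in \<open>auto simp: Rn_def PiE_def extensional_def\<close>)
qed

lemma vscale_in_Rn: "vscale n c x \<in> Rn n" and vadd_in_Rn: "vadd n x y \<in> Rn n" and vzero_in_Rn: "vzero n \<in> Rn n"
  by (auto simp: Rn_def vscale_def vadd_def vzero_def)

lemma sqnormn_vzero: "sqnormn n (vzero n) = 0"
  by (simp add: sqnormn_def vzero_def)

section \<open>Topology of extensional functions\<close>

lemma continuous_on_coordinate:
  fixes S :: "(nat \<Rightarrow> real) set"
  shows "continuous_on S (\<lambda>x. x i)"
  by (rule continuous_on_subset[OF continuous_on_product_coordinates]) simp

lemma tendsto_coordinate:
  fixes s :: "nat \<Rightarrow> nat \<Rightarrow> real"
  assumes "s \<longlonglongrightarrow> x"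
  shows "(\<lambda>k. s k i) \<longlonglongrightarrow> x i"
  using continuous_on_tendsto_compose[OF continuous_on_coordinate[of UNIV i] assms] by simp

lemma tendsto_sqdistn_0:
  fixes s :: "nat \<Rightarrow> nat \<Rightarrow> real"
  assumes "s \<longlonglongrightarrow> x"
  shows "(\<lambda>k. sqdistn n (s k) x) \<longlonglongrightarrow> 0"
proof -
  have "(\<lambda>k. sqdistn n (s k) x) \<longlonglongrightarrow> (\<Sum>i<n. (x i - x i)\<^sup>2)"
    unfolding sqdistn_def by (intro tendsto_intros tendsto_coordinate assms)
  then show ?thesis by simp
qed

lemma continuous_on_sqnormn: "continuous_on S (sqnormn n)"
  and continuous_on_sqdistn: "continuous_on S (\<lambda>x. sqdistn n x y)" "continuous_on S (\<lambda>x. sqdistn n y x)"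
  unfolding sqnormn_def sqdistn_def
  by (intro continuous_intros continuous_on_coordinate)+

text \<open>\<open>closed_n\<close> speaks of distances in the first \<open>n\<close> coordinates,
  \<open>closed\<close> of the product topology on \<open>nat \<Rightarrow> real\<close>. Inside
  \<open>Rn n\<close> the other coordinates are frozen at \<open>undefined\<close>, so a pointwise
  limit stays in \<open>Rn n\<close>.\<close>

lemma closed_n_Int_topological:
  assumes K: "K \<subseteq> Rn n" "closed_n n K"
  shows "closed K"
  unfolding closed_sequential_limits
proof (intro allI impI, elim conjE)
  fix s x assume s: "\<forall>k. s k \<in> K" and lim: "s \<longlonglongrightarrow> x"
  have "x i = undefined" if "\<not> i < n" for i
  proof -
    have "(\<lambda>k. s k i) = (\<lambda>k. undefined)"
      using s K that by (auto simp: Rn_def PiE_def extensional_def fun_eq_iff subset_iff)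
    then show ?thesis using tendsto_coordinate[OF lim, of i] LIMSEQ_unique[OF _ tendsto_const] by metis
  qed
  then have "x \<in> Rn n" by (auto simp: Rn_def PiE_def extensional_def)
  then show "x \<in> K" using K(2) s tendsto_sqdistn_0[OF lim] unfolding closed_n_def by blast
qed

text \<open>Tychonoff: the set is closed and contained in a product of \<open>n\<close> compact
  intervals and of singletons.\<close>

lemma compact_Int_sqnormn:
  assumes K: "K \<subseteq> Rn n" "closed_n n K"
  shows "compact (K \<inter> {x. sqnormn n x \<le> r})"
proof -
  define B where "B = PiE UNIV (\<lambda>i. if i < n then {- sqrt r..sqrt r} else {undefined :: real})"
  have "compactin (product_topology (\<lambda>_. euclidean) UNIV) B"
    unfolding B_def compactin_PiE by auto
  then have B: "compact B" by (simp add: euclidean_product_topology)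
  have "closed {x. sqnormn n x \<le> r}"
    by (intro closed_Collect_le continuous_on_sqnormn continuous_on_const)
  then have C: "closed (K \<inter> {x. sqnormn n x \<le> r})"
    by (intro closed_Int closed_n_Int_topological[OF K])
  have "K \<inter> {x. sqnormn n x \<le> r} \<subseteq> B"
  proof
    fix x assume x: "x \<in> K \<inter> {x. sqnormn n x \<le> r}"
    have "x i \<in> (if i < n then {- sqrt r..sqrt r} else {undefined})" for i
    proof (cases "i < n")
      case True
      then have "(x i)\<^sup>2 \<le> sqnormn n x"
        unfolding sqnormn_def by (intro member_le_sum[of i "{..<n}" "\<lambda>i. (x i)\<^sup>2"]) auto
      then have "\<bar>x i\<bar> \<le> sqrt r" using x by (intro real_le_rsqrt) auto
      then show ?thesis using True by auto
    next
      case False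
      then show ?thesis using x K(1) by (auto simp: Rn_def PiE_def extensional_def)
    qed
    then show "x \<in> B" unfolding B_def by (auto simp: PiE_def)
  qed
  then have "K \<inter> {x. sqnormn n x \<le> r} = B \<inter> (K \<inter> {x. sqnormn n x \<le> r})" by auto
  then show ?thesis using compact_Int_closed[OF B C] by simp
qed

text \<open>Let \<open>t\<close> tend to 0. This extracts first-order optimality conditions from
  perturbations of size \<open>t\<close>.\<close>

lemma le_zero_if_le_scaled:
  fixes a b :: real
  assumes "\<And>t. 0 < t \<Longrightarrow> t \<le> 1 \<Longrightarrow> a \<le> t * b"
  shows "a \<le> 0"
proof (rule ccontr)
  assume "\<not> a \<le> 0"
  define t where "t = min 1 (a / (2 * (\<bar>b\<bar> + 1)))"
  have t: "0 < t" "t \<le> 1" using \<open>\<not> a \<le> 0\<close> by (auto simp: t_def)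
  have "t * b \<le> t * (\<bar>b\<bar> + 1)" using t by (intro mult_left_mono) auto
  also have "\<dots> \<le> a / (2 * (\<bar>b\<bar> + 1)) * (\<bar>b\<bar> + 1)"
    by (intro mult_right_mono) (auto simp: t_def)
  also have "\<dots> = a / 2"
    using abs_ge_zero[of b] by (simp add: field_simps)
  finally show False using assms[OF t] \<open>\<not> a \<le> 0\<close> by simp
qed

section \<open>Projection onto a fixed closed convex cone\<close>

context
  fixes n :: nat and K :: "(nat \<Rightarrow> real) set"
  assumes K: "closed_convex_cone_n n K"
begin

lemma cone_subset_Rn: "K \<subseteq> Rn n" and cone_closed_n: "closed_n n K"
  using K by (auto simp: closed_convex_cone_n_def)

lemma cone_vscale: "x \<in> K \<Longrightarrow> 0 \<le> c \<Longrightarrow> vscale n c x \<in> K"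
  using K by (auto simp: closed_convex_cone_n_def cone_n_def)

lemma cone_vadd:
  assumes "x \<in> K" "y \<in> K"
  shows "vadd n x y \<in> K"
proof -
  have "\<forall>u. 0 \<le> u \<and> u \<le> 1 \<longrightarrow> vadd n (vscale n u x) (vscale n (1 - u) y) \<in> K"
    using K assms by (auto simp: closed_convex_cone_n_def convex_n_def)
  then have "vadd n (vscale n (1 / 2) x) (vscale n (1 - 1 / 2) y) \<in> K"
    by (rule allE[where x = "1 / 2"]) simp
  from cone_vscale[OF this, of 2] show ?thesis
    by (simp add: vadd_def vscale_def distrib_left cong: restrict_cong)
qed

lemma cone_vzero: "vzero n \<in> K"
proof -
  obtain x where "x \<in> K" using K by (auto simp: closed_convex_cone_n_def)
  from cone_vscale[OF this, of 0] show ?thesis by (simp add: vscale_def vzero_def)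
qed

text \<open>Moreau's characterisation: g - p is orthogonal to p and lies in the polar cone of
  \<open>K\<close>.\<close>

definition is_projection :: "(nat \<Rightarrow> real) \<Rightarrow> (nat \<Rightarrow> real) \<Rightarrow> bool" where
  "is_projection g p \<longleftrightarrow> p \<in> K \<and> dotn n g p = dotn n p p \<and> (\<forall>q\<in>K. dotn n g q \<le> dotn n p q)"

lemma nearest_point_exists: "\<exists>p\<in>K. \<forall>q\<in>K. sqdistn n g p \<le> sqdistn n g q"
proof -
  \<comment> \<open>A point with norm above twice that of \<open>g\<close> is farther from
    \<open>g\<close> than the origin is.\<close>
  let ?B = "K \<inter> {x. sqnormn n x \<le> 4 * sqnormn n g}"
  have z: "vzero n \<in> ?B"
    using cone_vzero sqnormn_nonneg[of n g] by (simp add: sqnormn_vzero)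
  have "\<exists>p\<in>?B. \<forall>q\<in>?B. sqdistn n g p \<le> sqdistn n g q"
    by (intro continuous_attains_inf compact_Int_sqnormn cone_subset_Rn cone_closed_n continuous_on_sqdistn)
      (use z in auto)
  then obtain p where p: "p \<in> ?B" "\<And>q. q \<in> ?B \<Longrightarrow> sqdistn n g p \<le> sqdistn n g q" by blast
  have "sqdistn n g p \<le> sqdistn n g q" if "q \<in> K" "q \<notin> ?B" for q
  proof -
    have "sqdistn n g p \<le> sqnormn n g"
      using p(2)[OF z] by (simp add: sqdistn_def vzero_def sqnormn_def)
    also have "\<dots> \<le> sqdistn n g q"
      using two_dotn_le[of 2 n g q] that by (simp add: sqdistn_expand)
    finally show ?thesis .
  qed
  then show ?thesis using p by blast
qed

text \<open>Two variations inside the cone: adding t q gives the polar inequality, and shrinking p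
  to (1 - t) p gives the half of orthogonality that the former leaves open.\<close>

lemma is_projection_nearest:
  assumes p: "p \<in> K" and min: "\<And>q. q \<in> K \<Longrightarrow> sqdistn n g p \<le> sqdistn n g q"
  shows "is_projection g p"
proof -
  have le: "dotn n g q \<le> dotn n p q" if q: "q \<in> K" for q
  proof -
    have "2 * (dotn n g q - dotn n p q) \<le> t * sqnormn n q" if t: "0 < t" for t
    proof -
      have "vadd n p (vscale n t q) \<in> K" using p q t by (intro cone_vadd cone_vscale) auto
      from min[OF this] have "t * (2 * (dotn n g q - dotn n p q)) \<le> t * (t * sqnormn n q)"
        by (simp add: sqdistn_expand sqnormn_eq_dotn dotn_simps dotn_commute[of n q p] algebra_simps)
      then show ?thesis using t by simp
    qed
    from le_zero_if_le_scaled[OF this] show ?thesis by simp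
  qed
  have "2 * (dotn n p p - dotn n g p) \<le> t * sqnormn n p" if t: "0 < t" "t \<le> 1" for t
  proof -
    have "vscale n (1 - t) p \<in> K" using p t by (intro cone_vscale) auto
    from min[OF this] have "t * (2 * (dotn n p p - dotn n g p)) \<le> t * (t * sqnormn n p)"
      by (simp add: sqdistn_expand sqnormn_eq_dotn dotn_simps algebra_simps)
    then show ?thesis using t by simp
  qed
  from le_zero_if_le_scaled[OF this] have "dotn n p p \<le> dotn n g p" by simp
  then show ?thesis unfolding is_projection_def using p le le[OF p] by auto
qed

text \<open>The four relations add up to |p - p'|^2 \<le> (g - g') . (p - p'). For equal arguments
  this is also uniqueness of the projection.\<close>

lemma is_projection_nonexpansive:
  assumes p: "is_projection g p" and p': "is_projection g' p'"
  shows "sqdistn n p p' \<le> sqdistn n g g'"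
proof -
  have "dotn n g p' \<le> dotn n p p'" "dotn n g' p \<le> dotn n p' p"
    "dotn n g p = dotn n p p" "dotn n g' p' = dotn n p' p'"
    using p p' by (auto simp: is_projection_def)
  then have "2 * sqdistn n p p' \<le> 2 * (dotn n g p - dotn n g p' - dotn n g' p + dotn n g' p')"
    by (simp add: sqdistn_expand sqnormn_eq_dotn dotn_commute[of n p' p])
  also have "\<dots> = (\<Sum>i<n. 2 * ((g i - g' i) * (p i - p' i)))"
    by (simp add: dotn_def sum_distrib_left sum.distrib sum_subtractf algebra_simps)
  also have "\<dots> \<le> (\<Sum>i<n. (g i - g' i)\<^sup>2 + (p i - p' i)\<^sup>2)"
  proof (rule sum_mono)
    fix i
    show "2 * ((g i - g' i) * (p i - p' i)) \<le> (g i - g' i)\<^sup>2 + (p i - p' i)\<^sup>2"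
      using sum_squares_bound[of "g i - g' i" "p i - p' i"] by (simp only: mult.assoc)
  qed
  also have "\<dots> = sqdistn n g g' + sqdistn n p p'" by (simp add: sqdistn_def sum.distrib)
  finally show ?thesis by simp
qed

lemma is_projection_projn: "is_projection g (projn n K g)"
proof -
  obtain p where p: "p \<in> K" "\<And>q. q \<in> K \<Longrightarrow> sqdistn n g p \<le> sqdistn n g q"
    using nearest_point_exists by blast
  have "projn n K g = p"
    unfolding projn_def
  proof (rule the_equality)
    fix p' assume "p' \<in> K \<and> (\<forall>q\<in>K. sqdistn n g p' \<le> sqdistn n g q)"
    then have p': "p' \<in> K" "is_projection g p'" using is_projection_nearest by auto
    have "sqdistn n p' p \<le> sqdistn n g g"
      by (rule is_projection_nonexpansive[OF p'(2) is_projection_nearest[OF p]])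
    then show "p' = p"
      using p(1) p'(1) cone_subset_Rn by (intro Rn_eqI[of _ n]) (auto simp: sqdistn_def[of n g g])
  qed (use p in auto)
  then show ?thesis using is_projection_nearest[OF p] by simp
qed

lemma projn_eqI: "is_projection g p \<Longrightarrow> projn n K g = p"
  using is_projection_nonexpansive[OF is_projection_projn[of g], of g p] is_projection_projn[of g] cone_subset_Rn
  by (intro Rn_eqI[of _ n]) (auto simp: sqdistn_def[of n g g] is_projection_def)

definition projection_norm :: "(nat \<Rightarrow> real) \<Rightarrow> real" where
  "projection_norm g = sqrt (sqnormn n (projn n K g))"

lemma projn_in_cone: "projn n K g \<in> K"
  and dotn_projn: "dotn n g (projn n K g) = sqnormn n (projn n K g)"
  and dotn_le_dotn_projn: "q \<in> K \<Longrightarrow> dotn n g q \<le> dotn n (projn n K g) q"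
  using is_projection_projn[of g] by (auto simp: is_projection_def sqnormn_eq_dotn)

lemma projection_norm_nonneg: "0 \<le> projection_norm g"
  by (simp add: projection_norm_def sqnormn_nonneg)

lemma projection_norm_sq: "(projection_norm g)\<^sup>2 = sqnormn n (projn n K g)"
  by (simp add: projection_norm_def sqnormn_nonneg)

text \<open>Together with \<open>projection_norm_attained\<close> this makes the norm of the
  projection a maximum of linear functionals over the unit vectors of the cone, the form in which
  Gordon's decoupled process involves it.\<close>

lemma dotn_le_projection_norm:
  assumes "q \<in> K" "sqnormn n q \<le> 1"
  shows "dotn n g q \<le> projection_norm g"
proof -
  have "dotn n g q \<le> dotn n (projn n K g) q" by (rule dotn_le_dotn_projn) fact
  also have "\<dots> \<le> projection_norm g * sqrt (sqnormn n q)"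
    unfolding projection_norm_def using dotn_cauchy_schwarz[of n "projn n K g" q] by linarith
  also have "\<dots> \<le> projection_norm g * 1"
    using assms by (intro mult_left_mono projection_norm_nonneg) auto
  finally show ?thesis by simp
qed

text \<open>The normalised projection is the maximiser. Positivity matters: when the projection is
  zero, all unit vectors of the cone may have a negative product with \<open>g\<close>, or there may
  be none.\<close>

lemma projection_norm_attained:
  assumes "0 < projection_norm g"
  obtains q where "q \<in> K" "sqnormn n q = 1" "dotn n g q = projection_norm g"
proof
  let ?q = "vscale n (1 / projection_norm g) (projn n K g)"
  show "?q \<in> K" using assms by (intro cone_vscale projn_in_cone) auto
  show "sqnormn n ?q = 1" using assms
    by (simp add: sqnormn_vscale projection_norm_sq[symmetric] power_divide)
  show "dotn n g ?q = projection_norm g" using assms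
    by (simp add: dotn_simps dotn_projn projection_norm_sq[symmetric] power2_eq_square)
qed

lemma sqnormn_projn_le: "sqnormn n (projn n K g) \<le> sqnormn n g"
  using two_dotn_le[of 1 n g "projn n K g"] dotn_projn[of g] by simp

lemma projn_nonexpansive: "sqdistn n (projn n K g) (projn n K g') \<le> sqdistn n g g'"
  by (intro is_projection_nonexpansive is_projection_projn)

lemma continuous_on_projn: "continuous_on UNIV (\<lambda>g. projn n K g i)"
proof (cases "i < n")
  case True
  show ?thesis
    unfolding continuous_on_sequentially
  proof (intro allI ballI impI, elim conjE)
    fix s and x :: "nat \<Rightarrow> real" assume lim: "s \<longlonglongrightarrow> x"
    have "(\<lambda>k. (projn n K (s k) i - projn n K x i)\<^sup>2) \<longlonglongrightarrow> 0"
    proof (rule tendsto_sandwich[OF _ _ tendsto_const tendsto_sqdistn_0[OF lim, of n]])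
      show "\<forall>\<^sub>F k in sequentially. (projn n K (s k) i - projn n K x i)\<^sup>2 \<le> sqdistn n (s k) x"
        by (intro always_eventually allI order_trans[OF member_sqdistn_le projn_nonexpansive] True)
    qed simp
    then have "(\<lambda>k. projn n K (s k) i - projn n K x i) \<longlonglongrightarrow> 0"
      using tendsto_real_sqrt[of "\<lambda>k. (projn n K (s k) i - projn n K x i)\<^sup>2" 0 sequentially]
      by (simp add: tendsto_rabs_zero_iff)
    then show "((\<lambda>g. projn n K g i) \<circ> s) \<longlonglongrightarrow> projn n K x i"
      by (simp add: LIM_zero_iff comp_def)
  qed
next
  case False
  have "projn n K g i = undefined" for g
    using projn_in_cone[of g] cone_subset_Rn False by (auto simp: Rn_def PiE_def extensional_def)
  then show ?thesis by simp
qed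

text \<open>Continuity yields measurability for the Borel sets of all of
  \<open>nat \<Rightarrow> real\<close>; the identity carries it over to the finite product, on
  which the coordinates beyond \<open>n\<close> are constant.\<close>

lemma borel_measurable_projn [measurable]:
  "(\<lambda>g. projn n K g i) \<in> borel_measurable (gaussian {..<n})"
proof -
  have "(\<lambda>g. g) \<in> borel_measurable (gaussian {..<n})"
  proof (rule measurable_coordinatewise_then_product)
    fix i
    show "(\<lambda>g. g i) \<in> borel_measurable (gaussian {..<n})"
    proof (cases "i < n")
      case True
      then show ?thesis by simp
    next
      case False
      then have "g i = undefined" if "g \<in> space (gaussian {..<n})" for g
        using that by (auto simp: space_PiM PiE_def extensional_def)
      then show ?thesis by (subst measurable_cong[where g = "\<lambda>_. undefined"]) auto
    qed
  qed
  moreover have "(\<lambda>g. projn n K g i) \<in> borel_measurable borel"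
    by (rule borel_measurable_continuous_onI[OF continuous_on_projn])
  ultimately show ?thesis by (rule measurable_compose)
qed

lemma borel_measurable_projection_norm [measurable]:
  "projection_norm \<in> borel_measurable (gaussian {..<n})"
  unfolding projection_norm_def[abs_def] sqnormn_def by measurable

lemma integrable_projection_norm_sq: "integrable (gaussian {..<n}) (\<lambda>g. (projection_norm g)\<^sup>2)"
proof (rule Bochner_Integration.integrable_bound)
  show "integrable (gaussian {..<n}) (\<lambda>g. sqnormn n g)"
    unfolding sqnormn_def
    by (intro Bochner_Integration.integrable_sum
        integrable_gaussian_component[of _ "{..<n}" "\<lambda>x. x\<^sup>2"] stdnorm_integrable_power)
  show "(\<lambda>g. (projection_norm g)\<^sup>2) \<in> borel_measurable (gaussian {..<n})"
    by measurable
qed (auto simp: projection_norm_sq sqnormn_projn_le sqnormn_nonneg)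

lemma integrable_projection_norm: "integrable (gaussian {..<n}) projection_norm"
proof -
  interpret prob_space "gaussian {..<n}" by (rule prob_space_gaussian)
  show ?thesis by (rule square_integrable_imp_integrable[OF _ integrable_projection_norm_sq]) simp
qed

definition mean_projection_norm :: real where
  "mean_projection_norm = (\<integral>g. projection_norm g \<partial>gaussian {..<n})"

text \<open>The normalised projection. Where the projection is zero, division by zero gives the zero
  vector, a valid subgradient because the norm is minimal there.\<close>

definition subgradient :: "(nat \<Rightarrow> real) \<Rightarrow> nat \<Rightarrow> real" where
  "subgradient g i = projn n K g i / projection_norm g"

lemma subgradient_measurable: "(\<lambda>g. subgradient g i) \<in> borel_measurable (gaussian {..<n})"
  unfolding subgradient_def by measurable

lemma subgradient_sum_squares: "(\<Sum>i<n. (subgradient g i)\<^sup>2) \<le> 1"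
proof -
  have "(\<Sum>i<n. (subgradient g i)\<^sup>2) = (projection_norm g)\<^sup>2 / (projection_norm g)\<^sup>2"
    by (simp add: subgradient_def power_divide sum_divide_distrib[symmetric] sqnormn_def[symmetric] projection_norm_sq)
  then show ?thesis by (cases "projection_norm g = 0") auto
qed

lemma subgradient_ineq: "projection_norm x - projection_norm y \<le> (\<Sum>i<n. subgradient x i * (x i - y i))"
proof -
  let ?q = "vscale n (1 / projection_norm x) (projn n K x)"
  have q: "?q \<in> K" by (intro cone_vscale projn_in_cone) (simp add: projection_norm_nonneg)
  have "sqnormn n ?q \<le> 1" using subgradient_sum_squares[of x]
    by (simp add: sqnormn_def subgradient_def vscale_def)
  then have "dotn n y ?q \<le> projection_norm y" by (rule dotn_le_projection_norm[OF q])
  moreover have "dotn n x ?q = projection_norm x"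
    by (cases "projection_norm x = 0")
      (simp_all add: dotn_simps dotn_projn projection_norm_sq[symmetric] power2_eq_square)
  moreover have "(\<Sum>i<n. subgradient x i * (x i - y i)) = dotn n x ?q - dotn n y ?q"
    by (simp add: dotn_def subgradient_def vscale_def sum_subtractf[symmetric] algebra_simps diff_divide_distrib)
  ultimately show ?thesis by simp
qed

text \<open>Subgradients of norm at most 1 make these tail and variance bounds independent of
  \<open>n\<close>.\<close>

lemmas projection_norm_concentration =
  gaussian_concentration[OF finite_lessThan integrable_projection_norm subgradient_measurable
    subgradient_sum_squares subgradient_ineq mean_projection_norm_def]

lemma stat_dim_eq: "stat_dim n K = (\<integral>g. (projection_norm g)\<^sup>2 \<partial>gaussian {..<n})"
  by (simp add: stat_dim_def gauss_eq_gaussian projection_norm_sq)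

lemma mean_projection_norm_nonneg: "0 \<le> mean_projection_norm"
  unfolding mean_projection_norm_def by (simp add: projection_norm_nonneg)

lemma stat_dim_eq_variance:
  "stat_dim n K = (\<integral>g. (projection_norm g - mean_projection_norm)\<^sup>2 \<partial>gaussian {..<n}) + mean_projection_norm\<^sup>2"
proof -
  interpret prob_space "gaussian {..<n}" by (rule prob_space_gaussian)
  show ?thesis
    using variance_eq[OF integrable_projection_norm integrable_projection_norm_sq]
    by (simp add: stat_dim_eq mean_projection_norm_def)
qed

lemma mean_projection_norm_le: "mean_projection_norm \<le> sqrt (stat_dim n K)"
  by (rule real_le_rsqrt) (simp add: stat_dim_eq_variance)

text \<open>The statistical dimension is variance plus squared mean, and 4 is the square root of the
  variance bound 16.\<close>

lemma sqrt_stat_dim_le: "sqrt (stat_dim n K) \<le> mean_projection_norm + 4"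
proof (rule real_le_lsqrt)
  show "stat_dim n K \<le> (mean_projection_norm + 4)\<^sup>2"
    using projection_norm_concentration(3) mean_projection_norm_nonneg
    by (simp add: stat_dim_eq_variance power2_sum)
qed (use mean_projection_norm_nonneg in auto)

section \<open>Unit vectors of the cone and finite nets\<close>

definition unit_sphere :: "(nat \<Rightarrow> real) set" where
  "unit_sphere = {x \<in> K. sqnormn n x = 1}"

lemma compact_unit_sphere: "compact unit_sphere"
proof -
  have "closed {x. sqnormn n x = 1}"
    by (intro closed_Collect_eq continuous_on_sqnormn continuous_on_const)
  from compact_Int_closed[OF compact_Int_sqnormn[OF cone_subset_Rn cone_closed_n, of 1] this]
  show ?thesis by (rule back_subst[of compact]) (auto simp: unit_sphere_def)
qed

lemma finite_net:
  assumes "0 < e"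
  obtains X where "finite X" "X \<subseteq> unit_sphere" "\<And>x. x \<in> unit_sphere \<Longrightarrow> \<exists>x'\<in>X. sqdistn n x x' < e"
proof -
  have op: "open {y. sqdistn n y x < e}" for x
    by (intro open_Collect_less continuous_on_sqdistn continuous_on_const)
  have cov: "unit_sphere \<subseteq> (\<Union>x\<in>unit_sphere. {y. sqdistn n y x < e})"
    using assms by (auto simp: sqdistn_def)
  obtain X where X: "X \<subseteq> unit_sphere" "finite X" "unit_sphere \<subseteq> (\<Union>x\<in>X. {y. sqdistn n y x < e})"
    using compactE_image[OF compact_unit_sphere op cov] by blast
  show ?thesis by (rule that[OF X(2,1)]) (use X(3) in blast)
qed

end

section \<open>Comparison of two cones\<close>

definition bilinear_form :: "nat \<Rightarrow> nat \<Rightarrow> (nat \<Rightarrow> real) \<Rightarrow> (nat \<times> nat \<Rightarrow> real) \<Rightarrow> (nat \<Rightarrow> real) \<Rightarrow> real" where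
  "bilinear_form m n y A x = (\<Sum>(i, k)\<in>{..<m} \<times> {..<n}. A (i, k) * (y i * x k))"

text \<open>Cauchy-Schwarz over all matrix entries: with their sum of squares at most
  \<open>r\<close>, a net of squared mesh 1 / r costs at most 1.\<close>

lemma bilinear_form_diff_le:
  assumes y: "sqnormn m y \<le> 1" and A: "(\<Sum>p\<in>{..<m} \<times> {..<n}. (A p)\<^sup>2) \<le> r" and r: "0 < r"
    and x: "sqdistn n x x' \<le> 1 / r"
  shows "bilinear_form m n y A x' - 1 \<le> bilinear_form m n y A x"
proof -
  let ?P = "{..<m} \<times> {..<n}"
  let ?z = "\<lambda>k. x' k - x k"
  have "bilinear_form m n y A x' - bilinear_form m n y A x = (\<Sum>p\<in>?P. A p * (y (fst p) * ?z (snd p)))"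
    by (simp add: bilinear_form_def split_beta' sum_subtractf[symmetric] algebra_simps)
  then have "(bilinear_form m n y A x' - bilinear_form m n y A x)\<^sup>2 \<le>
      (\<Sum>p\<in>?P. (A p)\<^sup>2) * (\<Sum>p\<in>?P. (y (fst p) * ?z (snd p))\<^sup>2)"
    by (simp only: Cauchy_Schwarz_ineq_sum)
  also have "(\<Sum>p\<in>?P. (y (fst p) * ?z (snd p))\<^sup>2) = sqnormn m y * sqdistn n x x'"
    by (simp add: sqnormn_def sqdistn_def sum_product sum.cartesian_product split_beta' power_mult_distrib
        power2_commute)
  also have "(\<Sum>p\<in>?P. (A p)\<^sup>2) * (sqnormn m y * sqdistn n x x') \<le> r * (1 * (1 / r))"
    using y A x r by (intro mult_mono) (auto intro: mult_nonneg_nonneg sqnormn_nonneg sqdistn_nonneg)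
  also have "\<dots> = 1" using r by simp
  finally have "\<bar>bilinear_form m n y A x' - bilinear_form m n y A x\<bar> \<le> 1"
    by (simp add: abs_square_le_1)
  then show ?thesis by linarith
qed

lemma dotn_diff_le:
  assumes h: "sqnormn m h \<le> r" and r: "0 < r" and y: "sqdistn m y y' \<le> 1 / r"
  shows "dotn m h y - 1 \<le> dotn m h y'"
proof -
  have "dotn m h y - dotn m h y' = (\<Sum>i<m. h i * (y i - y' i))"
    by (simp add: dotn_def sum_subtractf[symmetric] algebra_simps)
  then have "(dotn m h y - dotn m h y')\<^sup>2 \<le> sqnormn m h * sqdistn m y y'"
    unfolding sqnormn_def sqdistn_def by (simp only: Cauchy_Schwarz_ineq_sum)
  also have "\<dots> \<le> r * (1 / r)"
    using h y r by (intro mult_mono) (auto intro: sqnormn_nonneg sqdistn_nonneg)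
  also have "\<dots> = 1" using r by simp
  finally have "\<bar>dotn m h y - dotn m h y'\<bar> \<le> 1"
    by (simp add: abs_square_le_1)
  then show ?thesis by linarith
qed

text \<open>Markov's inequality is enough, without control of \<open>r\<close>: it only fixes the
  mesh of a net whose cardinality enters no estimate.\<close>

lemma gaussian_sum_squares_tail:
  assumes D: "finite D" and e: "0 < e"
  obtains r where "0 < r" "measure (gaussian D) {\<xi> \<in> space (gaussian D). r \<le> (\<Sum>d\<in>D. (\<xi> d)\<^sup>2)} \<le> e"
proof -
  let ?f = "\<lambda>\<xi> :: 'a \<Rightarrow> real. \<Sum>d\<in>D. (\<xi> d)\<^sup>2"
  have int: "integrable (gaussian D) ?f"
    by (intro Bochner_Integration.integrable_sum
        integrable_gaussian_component[of _ D "\<lambda>x. x\<^sup>2"] stdnorm_integrable_power)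
  define v where "v = (\<integral>\<xi>. ?f \<xi> \<partial>gaussian D)"
  have v: "0 \<le> v" unfolding v_def by (intro Bochner_Integration.integral_nonneg sum_nonneg) simp
  show ?thesis
  proof
    show r: "0 < (v + 1) / e" using v e by simp
    have "measure (gaussian D) {\<xi> \<in> space (gaussian D). (v + 1) / e \<le> ?f \<xi>} \<le> v / ((v + 1) / e)"
      unfolding v_def[symmetric] using integral_Markov_inequality_measure[OF int, of "{}" "(v + 1) / e"] r v_def
      by (auto simp: sum_nonneg)
    also have "\<dots> \<le> e" using v e by (simp add: field_simps)
    finally show "measure (gaussian D) {\<xi> \<in> space (gaussian D). (v + 1) / e \<le> ?f \<xi>} \<le> e" .
  qed
qed

lemma gaussian_coordinate_tail:
  assumes D: "finite D" and d: "d \<in> D" and s: "0 \<le> s"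
  shows "measure (gaussian D) {\<xi> \<in> space (gaussian D). s \<le> \<xi> d} \<le> exp (- s\<^sup>2 / 8)"
proof -
  let ?S = "\<lambda>(\<xi> :: 'a \<Rightarrow> real) d'. if d' = d then 1 else 0 :: real"
  have mean: "0 = (\<integral>\<xi>. \<xi> d \<partial>gaussian D)"
    using integral_gaussian_component[OF d, of "\<lambda>x. x"] stdnorm_mean by simp
  have "measure (gaussian D) {\<xi> \<in> space (gaussian D). \<xi> d \<ge> 0 + s} \<le> exp (- s\<^sup>2 / 8)"
  proof (rule gaussian_upper_tail[OF D _ _ _ _ mean s, where S = ?S])
    show "integrable (gaussian D) (\<lambda>\<xi>. \<xi> d)"
      using integrable_gaussian_component[OF d stdnorm_integrable_power[of 1]] by simp
    show "(\<Sum>d'\<in>D. (?S \<xi> d')\<^sup>2) \<le> 1" for \<xi>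
      using D d by (simp add: if_distrib[of "\<lambda>x. x\<^sup>2"] cong: if_cong)
    show "\<xi> d - \<eta> d \<le> (\<Sum>d'\<in>D. ?S \<xi> d' * (\<xi> d' - \<eta> d'))" for \<xi> \<eta>
      using D d by (simp add: if_distrib[of "\<lambda>x. x * _"] cong: if_cong)
  qed simp
  then show ?thesis by simp
qed

lemma measure_gaussian_marginal:
  assumes f: "inj_on f I" "f \<in> I \<rightarrow> J" and A: "{x \<in> space (gaussian I). P x} \<in> sets (gaussian I)"
  shows "measure (gaussian J) {\<omega> \<in> space (gaussian J). P (\<lambda>i\<in>I. \<omega> (f i))} =
    measure (gaussian I) {x \<in> space (gaussian I). P x}"
    and "{\<omega> \<in> space (gaussian J). P (\<lambda>i\<in>I. \<omega> (f i))} \<in> sets (gaussian J)"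
proof -
  let ?f = "\<lambda>\<omega>. \<lambda>i\<in>I. \<omega> (f i)"
  have m: "?f \<in> measurable (gaussian J) (gaussian I)"
    using f(2) by (intro measurable_restrict measurable_component_singleton) auto
  have eq: "{\<omega> \<in> space (gaussian J). P (?f \<omega>)} = ?f -` {x \<in> space (gaussian I). P x} \<inter> space (gaussian J)"
    using measurable_space[OF m] by auto
  show "{\<omega> \<in> space (gaussian J). P (?f \<omega>)} \<in> sets (gaussian J)"
    unfolding eq by (rule measurable_sets[OF m A])
  have "measure (distr (gaussian J) (gaussian I) ?f) {x \<in> space (gaussian I). P x} =
      measure (gaussian J) {\<omega> \<in> space (gaussian J). P (?f \<omega>)}"
    unfolding eq by (rule measure_distr[OF m A])
  then show "measure (gaussian J) {\<omega> \<in> space (gaussian J). P (?f \<omega>)} = measure (gaussian I) {x \<in> space (gaussian I). P x}"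
    by (simp add: distr_gaussian_reindex[OF f])
qed

text \<open>Encoding of the two Gaussian vectors: \<open>Some (i, k)\<close> carries the matrix
  entries and \<open>None\<close> the extra variable; \<open>Inl\<close> carries h and
  \<open>Inr\<close> carries g.\<close>

lemma gordon_bilinear:
  fixes X Y :: "(nat \<Rightarrow> real) set"
  assumes X: "finite X" "\<And>x. x \<in> X \<Longrightarrow> sqnormn n x = 1" and Y: "finite Y" "\<And>y. y \<in> Y \<Longrightarrow> sqnormn m y = 1"
  defines "GE \<equiv> gaussian ({..<m} <+> {..<n})"
  defines "GD \<equiv> gaussian (insert None (Some ` ({..<m} \<times> {..<n})))"
  shows "measure GE {\<zeta> \<in> space GE. \<forall>x\<in>X. \<exists>y\<in>Y. c < dotn m (\<lambda>i. \<zeta> (Inl i)) y - dotn n (\<lambda>k. \<zeta> (Inr k)) x} \<le>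
    measure GD {\<xi> \<in> space GD. \<forall>x\<in>X. \<exists>y\<in>Y. c \<le> bilinear_form m n y (\<lambda>p. \<xi> (Some p)) x + \<xi> None}"
proof -
  let ?P = "{..<m} \<times> {..<n}"
  let ?D = "insert None (Some ` ?P)" and ?E = "{..<m} <+> {..<n}"
  define a :: "(nat \<Rightarrow> real) \<times> (nat \<Rightarrow> real) \<Rightarrow> (nat \<times> nat) option \<Rightarrow> real" where "a = (\<lambda>(x, y) d. case d of None \<Rightarrow> 1 | Some (i, k) \<Rightarrow> y i * x k)"
  define b :: "(nat \<Rightarrow> real) \<times> (nat \<Rightarrow> real) \<Rightarrow> nat + nat \<Rightarrow> real" where "b = (\<lambda>(x, y) e. case e of Inl i \<Rightarrow> y i | Inr k \<Rightarrow> - x k)"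
  have sumD: "(\<Sum>d\<in>?D. f d) = f None + (\<Sum>p\<in>?P. f (Some p))" for f :: "(nat \<times> nat) option \<Rightarrow> real"
    by (subst sum.insert) (auto simp: sum.reindex)
  have sumE: "(\<Sum>e\<in>?E. f e) = (\<Sum>i<m. f (Inl i)) + (\<Sum>k<n. f (Inr k))" for f :: "nat + nat \<Rightarrow> real"
    by (simp add: sum.Plus)
  have covD: "(\<Sum>d\<in>?D. a (x, y) d * a (x', y') d) = 1 + dotn m y y' * dotn n x x'" for x y x' y'
  proof -
    have "dotn m y y' * dotn n x x' = (\<Sum>p\<in>?P. (y (fst p) * y' (fst p)) * (x (snd p) * x' (snd p)))"
      by (simp add: dotn_def sum_product sum.cartesian_product split_beta')
    then show ?thesis by (simp add: sumD a_def split_beta' mult_ac)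
  qed
  have covE: "(\<Sum>e\<in>?E. b (x, y) e * b (x', y') e) = dotn m y y' + dotn n x x'" for x y x' y'
    by (simp add: sumE b_def dotn_def)
  have linD: "linear_part ?D (a (x, y)) \<xi> = bilinear_form m n y (\<lambda>p. \<xi> (Some p)) x + \<xi> None" for x y \<xi>
    by (simp add: linear_part_def sumD a_def bilinear_form_def split_beta' mult_ac)
  have linE: "linear_part ?E (b (x, y)) \<zeta> = dotn m (\<lambda>i. \<zeta> (Inl i)) y - dotn n (\<lambda>k. \<zeta> (Inr k)) x" for x y \<zeta>
    by (simp add: linear_part_def sumE b_def dotn_def mult.commute sum_negf)
  have le1: "dotn l u v \<le> 1" if "sqnormn l u = 1" "sqnormn l v = 1" for l u v
    using dotn_cauchy_schwarz[of l u v] that by simp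
  have "measure (gaussian ?E) {\<zeta> \<in> space (gaussian ?E). \<forall>x\<in>X. \<exists>y\<in>Y. 0 < - c + linear_part ?E (b (x, y)) \<zeta>} \<le>
    measure (gaussian ?D) {\<xi> \<in> space (gaussian ?D). \<forall>x\<in>X. \<exists>y\<in>Y. 0 \<le> - c + linear_part ?D (a (x, y)) \<xi>}"
  proof (rule gordon_finite[OF X(1) Y(1)])
    fix p q assume pq: "p \<in> X \<times> Y" "q \<in> X \<times> Y"
    obtain x y x' y' where eq: "p = (x, y)" "q = (x', y')" by (metis surj_pair)
    have n: "sqnormn n x = 1" "sqnormn n x' = 1" "sqnormn m y = 1" "sqnormn m y' = 1"
      using pq X(2) Y(2) eq by auto
    show "(\<Sum>d\<in>?D. a p d * a q d) = (\<Sum>e\<in>?E. b p e * b q e)" if "fst p = fst q"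
      using that n by (simp add: eq covD covE sqnormn_eq_dotn)
    show "(\<Sum>e\<in>?E. b p e * b q e) \<le> (\<Sum>d\<in>?D. a p d * a q d)"
    proof -
      have "0 \<le> (1 - dotn m y y') * (1 - dotn n x x')"
        using le1 n by simp
      then show ?thesis unfolding eq covD covE by (simp add: algebra_simps)
    qed
  qed auto
  moreover have "0 < - c + z \<longleftrightarrow> c < z" "0 \<le> - c + z \<longleftrightarrow> c \<le> z" for z by linarith+
  ultimately show ?thesis unfolding GE_def GD_def by (simp only: linD linE)
qed

text \<open>The constant 22 collects three deviations of size \<open>5 * sqrt t\<close>, the gap 4 between
  \<open>sqrt (stat_dim n K)\<close> and the mean of the projection norm, and net errors.\<close>

lemma gordon_cones:
  assumes K: "closed_convex_cone_n n K" and L: "closed_convex_cone_n m L" and t: "1 \<le> t"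
    and gap: "sqrt (stat_dim n K) + 22 * sqrt t \<le> sqrt (stat_dim m L)"
  defines "GA \<equiv> gaussian ({..<m} \<times> {..<n})"
  shows "\<exists>B\<in>sets GA. 1 - exp (- t) \<le> measure GA B \<and>
    (\<forall>A\<in>B. \<forall>x\<in>unit_sphere n K. \<exists>y\<in>unit_sphere m L. 0 < bilinear_form m n y A x)"
proof -
  let ?P = "{..<m} \<times> {..<n}"
  let ?D = "insert None (Some ` ?P)" and ?E = "{..<m} <+> {..<n}"
  let ?GE = "gaussian ?E" and ?GD = "gaussian ?D"
  interpret GA: prob_space GA unfolding GA_def by (rule prob_space_gaussian)
  interpret GD: prob_space ?GD by (rule prob_space_gaussian)
  interpret GE: prob_space ?GE by (rule prob_space_gaussian)
  \<comment> \<open>Here s^2 / 8 = 25 t / 8 \<ge> t + 2, so every tail is at most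
    \<open>\<epsilon>\<close>. The exceptional events \<open>?H1\<close>, \<open>?H2\<close>,
    \<open>?H3\<close>, \<open>?N\<close> and \<open>?F\<close> are five, and 5 \<le> exp 2 pays for
    them.\<close>
  define s where "s = 5 * sqrt t"
  define \<epsilon> where "\<epsilon> = exp (- (t + 2))"
  have s: "5 \<le> s" using t by (simp add: s_def)
  have \<epsilon>: "0 < \<epsilon>" by (simp add: \<epsilon>_def)
  have s_exp: "exp (- s\<^sup>2 / 8) \<le> \<epsilon>"
    using t by (simp add: \<epsilon>_def s_def power_mult_distrib)
  have \<epsilon>5: "5 * \<epsilon> \<le> exp (- t)"
  proof -
    have "(5 :: real) \<le> exp 2" using exp_lower_Taylor_quadratic[of "2::real"] by simp
    then have "5 * (exp (- t) * exp (- 2)) \<le> exp (- t)"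
      by (simp add: exp_minus field_simps)
    then show ?thesis by (simp add: \<epsilon>_def exp_diff exp_minus field_simps exp_add)
  qed
  let ?\<mu>K = "mean_projection_norm n K" and ?\<mu>L = "mean_projection_norm m L"
  \<comment> \<open>Of 22 sqrt t, 15 sqrt t is 3 s and 7 sqrt t \<ge> 7 covers the gap 4 and a
    margin of 3: 1 for the net in \<open>L\<close> and 2 for the threshold s + 2 of
    \<open>?SE\<close>.\<close>
  have mu: "?\<mu>K + 3 * s + 3 \<le> ?\<mu>L"
  proof -
    have "1 \<le> sqrt t" using t by simp
    then show ?thesis
      using mean_projection_norm_le[OF K] sqrt_stat_dim_le[OF L] gap unfolding s_def by linarith
  qed
  have mu0: "0 < ?\<mu>L - s" using mu mean_projection_norm_nonneg[OF K] s by linarith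
  obtain r where r: "0 < r" "measure GA {A \<in> space GA. r \<le> (\<Sum>p\<in>?P. (A p)\<^sup>2)} \<le> \<epsilon>"
    unfolding GA_def by (rule gaussian_sum_squares_tail[of ?P \<epsilon>]) (use \<epsilon> in auto)
  obtain r' where r': "0 < r'" "measure (gaussian {..<m}) {h \<in> space (gaussian {..<m}). r' \<le> (\<Sum>i<m. (h i)\<^sup>2)} \<le> \<epsilon>"
    by (rule gaussian_sum_squares_tail[of "{..<m}" \<epsilon>]) (use \<epsilon> in auto)
  obtain X where X: "finite X" "X \<subseteq> unit_sphere n K" "\<And>x. x \<in> unit_sphere n K \<Longrightarrow> \<exists>x'\<in>X. sqdistn n x x' < 1 / r"
    using finite_net[OF K, of "1 / r"] r(1) by auto
  obtain Y where Y: "finite Y" "Y \<subseteq> unit_sphere m L" "\<And>y. y \<in> unit_sphere m L \<Longrightarrow> \<exists>y'\<in>Y. sqdistn m y y' < 1 / r'"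
    using finite_net[OF L, of "1 / r'"] r'(1) by auto
  let ?h = "\<lambda>\<zeta>. \<lambda>i\<in>{..<m}. \<zeta> (Inl i :: nat + nat) :: real" and ?g = "\<lambda>\<zeta>. \<lambda>k\<in>{..<n}. \<zeta> (Inr k :: nat + nat) :: real"
  let ?H1 = "{\<zeta> \<in> space ?GE. r' \<le> (\<Sum>i<m. (?h \<zeta> i)\<^sup>2)}"
  let ?H2 = "{\<zeta> \<in> space ?GE. projection_norm m L (?h \<zeta>) \<le> ?\<mu>L - s}"
  let ?H3 = "{\<zeta> \<in> space ?GE. projection_norm n K (?g \<zeta>) \<ge> ?\<mu>K + s}"
  let ?SE = "{\<zeta> \<in> space ?GE. \<forall>x\<in>X. \<exists>y\<in>Y. s + 2 < dotn m (\<lambda>i. \<zeta> (Inl i)) y - dotn n (\<lambda>k. \<zeta> (Inr k)) x}"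
  let ?SD = "{\<xi> \<in> space ?GD. \<forall>x\<in>X. \<exists>y\<in>Y. s + 2 \<le> bilinear_form m n y (\<lambda>p. \<xi> (Some p)) x + \<xi> None}"
  let ?N = "{\<xi> \<in> space ?GD. s \<le> \<xi> None}"
  let ?A = "\<lambda>\<xi>. \<lambda>p\<in>?P. \<xi> (Some p) :: real"
  let ?S = "\<lambda>A. \<forall>x\<in>X. \<exists>y\<in>Y. 1 < bilinear_form m n y A x"
  let ?SA = "{A \<in> space GA. ?S A}" and ?SA' = "{\<xi> \<in> space ?GD. ?S (?A \<xi>)}"
  let ?F = "{A \<in> space GA. r \<le> (\<Sum>p\<in>?P. (A p)\<^sup>2)}"
  have projm: "projection_norm m L \<in> borel_measurable (gaussian {..<m})"
    "projection_norm n K \<in> borel_measurable (gaussian {..<n})"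
    using K L by (auto intro: borel_measurable_projection_norm)
  have inl: "inj_on Inl {..<m}" "Inl \<in> {..<m} \<rightarrow> ?E" and inr: "inj_on Inr {..<n}" "Inr \<in> {..<n} \<rightarrow> ?E"
    and some: "inj_on Some ?P" "Some \<in> ?P \<rightarrow> ?D"
    by (auto simp: inj_on_def)
  have H1: "?H1 \<in> sets ?GE" "measure ?GE ?H1 \<le> \<epsilon>"
    using measure_gaussian_marginal[OF inl, of "\<lambda>h. r' \<le> (\<Sum>i<m. (h i)\<^sup>2)"] r'(2) by simp_all
  have H2: "?H2 \<in> sets ?GE" "measure ?GE ?H2 \<le> \<epsilon>"
    using measure_gaussian_marginal[OF inl, of "\<lambda>h. projection_norm m L h \<le> ?\<mu>L - s"] projm(1)
      projection_norm_concentration(2)[OF L, of s] s s_exp by simp_all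
  have H3: "?H3 \<in> sets ?GE" "measure ?GE ?H3 \<le> \<epsilon>"
    using measure_gaussian_marginal[OF inr, of "\<lambda>g. projection_norm n K g \<ge> ?\<mu>K + s"] projm(2)
      projection_norm_concentration(1)[OF K, of s] s s_exp by simp_all
  have compE: "(\<lambda>\<zeta>. \<zeta> e) \<in> borel_measurable ?GE" if "e \<in> ?E" for e
    using that by measurable
  have compD: "(\<lambda>\<xi>. \<xi> d) \<in> borel_measurable ?GD" if "d \<in> ?D" for d
    using that by measurable
  have [measurable]: "(\<lambda>\<zeta>. dotn m (\<lambda>i. \<zeta> (Inl i)) y) \<in> borel_measurable ?GE"
    "(\<lambda>\<zeta>. dotn n (\<lambda>k. \<zeta> (Inr k)) x) \<in> borel_measurable ?GE" for x y
    unfolding dotn_def by (intro borel_measurable_sum borel_measurable_times borel_measurable_const compE; auto)+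
  have [measurable]: "(\<lambda>\<xi>. bilinear_form m n y (\<lambda>p. \<xi> (Some p)) x) \<in> borel_measurable ?GD" for x y
    unfolding bilinear_form_def split_beta'
    by (intro borel_measurable_sum borel_measurable_times borel_measurable_const compD) auto
  have SE: "?SE \<in> sets ?GE" using X(1) Y(1) by measurable
  have SD: "?SD \<in> sets ?GD" using X(1) Y(1) compD[of None] by measurable
  have N: "?N \<in> sets ?GD" "measure ?GD ?N \<le> \<epsilon>"
    using gaussian_coordinate_tail[of ?D None s] s s_exp by auto
  have F: "?F \<in> sets GA" unfolding GA_def by measurable
  have SA: "?SA \<in> sets GA" unfolding bilinear_form_def GA_def using X(1) Y(1) by measurable
  have SA': "?SA' \<in> sets ?GD" "measure ?GD ?SA' = measure GA ?SA"
    using measure_gaussian_marginal[OF some, of ?S] SA unfolding GA_def by simp_all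
  \<comment> \<open>The decoupled process is easy: maximising h . y does not involve x, so a single
    net point \<open>y\<close> near the maximiser serves all of \<open>X\<close>.\<close>
  have "space ?GE \<subseteq> ?SE \<union> (?H1 \<union> (?H2 \<union> ?H3))"
  proof
    fix \<zeta> assume \<zeta>: "\<zeta> \<in> space ?GE"
    show "\<zeta> \<in> ?SE \<union> (?H1 \<union> (?H2 \<union> ?H3))"
    proof (rule ccontr)
      assume not: "\<zeta> \<notin> ?SE \<union> (?H1 \<union> (?H2 \<union> ?H3))"
      then have h1: "sqnormn m (?h \<zeta>) \<le> r'" and h2: "?\<mu>L - s < projection_norm m L (?h \<zeta>)"
        and h3: "projection_norm n K (?g \<zeta>) < ?\<mu>K + s"
        using \<zeta> by (auto simp: sqnormn_def)
      obtain q where q: "q \<in> L" "sqnormn m q = 1" "dotn m (?h \<zeta>) q = projection_norm m L (?h \<zeta>)"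
        using projection_norm_attained[OF L, of "?h \<zeta>"] h2 mu0 by auto
      then obtain y where y: "y \<in> Y" "sqdistn m q y < 1 / r'"
        using Y(3)[of q] by (auto simp: unit_sphere_def[OF L])
      have hy: "projection_norm m L (?h \<zeta>) - 1 \<le> dotn m (?h \<zeta>) y"
        using dotn_diff_le[OF h1 r'(1), of q y] y q by simp
      have "s + 2 < dotn m (\<lambda>i. \<zeta> (Inl i)) y - dotn n (\<lambda>k. \<zeta> (Inr k)) x" if "x \<in> X" for x
      proof -
        have "x \<in> K" "sqnormn n x \<le> 1" using X(2) that by (auto simp: unit_sphere_def[OF K])
        then have "dotn n (?g \<zeta>) x \<le> projection_norm n K (?g \<zeta>)" by (rule dotn_le_projection_norm[OF K])
        then have "s + 2 < dotn m (?h \<zeta>) y - dotn n (?g \<zeta>) x"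
          using hy h2 h3 mu by linarith
        then show ?thesis by (simp add: dotn_def)
      qed
      then show False using not \<zeta> y(1) by auto
    qed
  qed
  then have "measure ?GE (space ?GE) \<le> measure ?GE (?SE \<union> (?H1 \<union> (?H2 \<union> ?H3)))"
    using SE H1 H2 H3 by (intro GE.finite_measure_mono) auto
  also have "\<dots> \<le> measure ?GE ?SE + (measure ?GE ?H1 + (measure ?GE ?H2 + measure ?GE ?H3))"
    using SE H1 H2 H3 by (intro order_trans[OF measure_Un_le] add_mono order_refl) auto
  finally have "1 - 3 * \<epsilon> \<le> measure ?GE ?SE"
    using H1(2) H2(2) H3(2) by (simp add: GE.prob_space)
  also have "\<dots> \<le> measure ?GD ?SD"
    by (rule gordon_bilinear)
      (use X(1,2) Y(1,2) in \<open>auto simp: unit_sphere_def[OF K] unit_sphere_def[OF L]\<close>)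
  also have "\<dots> \<le> measure ?GD (?SA' \<union> ?N)"
  proof (rule GD.finite_measure_mono)
    show "?SD \<subseteq> ?SA' \<union> ?N"
    proof
      fix \<xi> assume \<xi>: "\<xi> \<in> ?SD"
      have "bilinear_form m n y (?A \<xi>) x = bilinear_form m n y (\<lambda>p. \<xi> (Some p)) x" for x y
        unfolding bilinear_form_def by (intro sum.cong) auto
      moreover have "1 < z" if "s + 2 \<le> z + \<xi> None" "\<xi> None < s" for z using that by linarith
      ultimately show "\<xi> \<in> ?SA' \<union> ?N" using \<xi> by (fastforce simp: not_le)
    qed
  qed (use SA' N in auto)
  also have "\<dots> \<le> measure ?GD ?SA' + measure ?GD ?N"
    using SA' N by (intro measure_Un_le)
  finally have PSA: "1 - 4 * \<epsilon> \<le> measure GA ?SA" using SA'(2) N(2) by simp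
  have "measure GA ?SA \<le> measure GA ((?SA - ?F) \<union> ?F)"
    using SA F by (intro GA.finite_measure_mono) auto
  also have "\<dots> \<le> measure GA (?SA - ?F) + measure GA ?F"
    using SA F by (intro measure_Un_le) auto
  finally have "1 - exp (- t) \<le> measure GA (?SA - ?F)" using PSA r(2) \<epsilon>5 by linarith
  moreover have "\<exists>y\<in>unit_sphere m L. 0 < bilinear_form m n y A x" if A: "A \<in> ?SA - ?F" and x: "x \<in> unit_sphere n K" for A x
  proof -
    obtain x' where x': "x' \<in> X" "sqdistn n x x' < 1 / r" using X(3)[OF x] by blast
    obtain y where y: "y \<in> Y" "1 < bilinear_form m n y A x'" using A x'(1) by blast
    have "bilinear_form m n y A x' - 1 \<le> bilinear_form m n y A x"
      by (rule bilinear_form_diff_le[where r = r])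
        (use A x' y Y(2) r in \<open>auto simp: unit_sphere_def[OF L] subset_iff\<close>)
    then show ?thesis using y Y(2) by (intro bexI[of _ y]) auto
  qed
  ultimately show ?thesis using SA F by (intro bexI[of _ "?SA - ?F"]) auto
qed

section \<open>Existence of the cone constrained estimator\<close>

lemma sqdistn_tendsto_coordinate:
  assumes "(\<lambda>k. sqdistn n (s k) x) \<longlonglongrightarrow> 0" and i: "i < n"
  shows "(\<lambda>k. s k i) \<longlonglongrightarrow> x i"
proof -
  have "(\<lambda>k. (s k i - x i)\<^sup>2) \<longlonglongrightarrow> 0"
    by (rule tendsto_sandwich[OF _ _ tendsto_const assms(1)])
      (auto intro!: always_eventually member_sqdistn_le i)
  then have "(\<lambda>k. s k i - x i) \<longlonglongrightarrow> 0"
    using tendsto_real_sqrt[of "\<lambda>k. (s k i - x i)\<^sup>2" 0 sequentially]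
    by (simp add: tendsto_rabs_zero_iff)
  then show ?thesis by (simp add: LIM_zero_iff)
qed

definition orthant :: "real \<Rightarrow> nat \<Rightarrow> (nat \<Rightarrow> real) set" where
  "orthant \<sigma> m = {u \<in> Rn m. \<forall>i<m. 0 \<le> \<sigma> * u i}"

lemma closed_convex_cone_orthant: "closed_convex_cone_n m (orthant \<sigma> m)"
  unfolding closed_convex_cone_n_def
proof (intro conjI)
  show "orthant \<sigma> m \<subseteq> Rn m" by (auto simp: orthant_def)
  have "vzero m \<in> orthant \<sigma> m" by (simp add: orthant_def vzero_in_Rn) (simp add: vzero_def)
  then show "orthant \<sigma> m \<noteq> {}" by auto
  show "closed_n m (orthant \<sigma> m)"
    unfolding closed_n_def
  proof (intro allI impI, elim conjE)
    fix s x assume s: "\<forall>k. s k \<in> orthant \<sigma> m" and x: "x \<in> Rn m" and lim: "(\<lambda>k. sqdistn m (s k) x) \<longlonglongrightarrow> 0"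
    have "0 \<le> \<sigma> * x i" if "i < m" for i
    proof (rule LIMSEQ_le_const[OF tendsto_mult_left[OF sqdistn_tendsto_coordinate[OF lim that]]])
      show "\<exists>N. \<forall>k\<ge>N. 0 \<le> \<sigma> * s k i" using s that by (auto simp: orthant_def)
    qed
    then show "x \<in> orthant \<sigma> m" using x by (simp add: orthant_def)
  qed
  show "convex_n m (orthant \<sigma> m)"
    unfolding convex_n_def
  proof (intro ballI allI impI)
    fix x y and u :: real assume xy: "x \<in> orthant \<sigma> m" "y \<in> orthant \<sigma> m" and u: "0 \<le> u \<and> u \<le> 1"
    have "0 \<le> \<sigma> * (u * x i + (1 - u) * y i)" if "i < m" for i
    proof -
      have "0 \<le> u * (\<sigma> * x i) + (1 - u) * (\<sigma> * y i)"
        using xy u that by (auto simp: orthant_def)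
      then show ?thesis by (simp add: algebra_simps)
    qed
    then show "vadd m (vscale m u x) (vscale m (1 - u) y) \<in> orthant \<sigma> m"
      by (simp add: orthant_def vadd_in_Rn) (simp add: vadd_def vscale_def)
  qed
  show "cone_n m (orthant \<sigma> m)"
    unfolding cone_n_def
  proof (intro ballI allI impI)
    fix x and c :: real assume x: "x \<in> orthant \<sigma> m" and c: "0 \<le> c"
    have "0 \<le> \<sigma> * (c * x i)" if "i < m" for i
    proof -
      have "0 \<le> c * (\<sigma> * x i)" using x c that by (auto simp: orthant_def)
      then show ?thesis by (simp add: mult.left_commute)
    qed
    then show "vscale m c x \<in> orthant \<sigma> m"
      by (simp add: orthant_def vscale_in_Rn) (simp add: vscale_def)
  qed
qed

lemma stdnorm_half_second_moment:
  assumes "\<sigma> = 1 \<or> \<sigma> = -1"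
  shows "(\<integral>x. (if 0 \<le> \<sigma> * x then x else 0)\<^sup>2 \<partial>stdnorm) = 1 / 2"
proof -
  have neg: "(\<integral>x. (if 0 \<le> - 1 * x then x else 0)\<^sup>2 \<partial>stdnorm) = 1 / 2"
    using stdnorm_second_moment_neg_part
    by (subst Bochner_Integration.integral_cong[where g = "\<lambda>x. (min x 0)\<^sup>2"]) (auto simp: min_def)
  have int: "integrable stdnorm (\<lambda>x. (if 0 \<le> - 1 * x then x else 0)\<^sup>2)"
    by (rule Bochner_Integration.integrable_bound[OF stdnorm_integrable_power[of 2]]) auto
  have "(\<integral>x. (if 0 \<le> 1 * x then x else 0)\<^sup>2 \<partial>stdnorm) = (\<integral>x. x\<^sup>2 - (if 0 \<le> - 1 * x then x else 0)\<^sup>2 \<partial>stdnorm)"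
    by (intro Bochner_Integration.integral_cong) auto
  also have "\<dots> = 1 / 2"
    using int stdnorm_integrable_power[of 2] neg by (simp add: stdnorm_second_moment)
  finally show ?thesis using assms neg by auto
qed

lemma stat_dim_orthant:
  assumes \<sigma>: "\<sigma> = 1 \<or> \<sigma> = -1"
  shows "stat_dim m (orthant \<sigma> m) = m / 2"
proof -
  let ?f = "\<lambda>x. if 0 \<le> \<sigma> * x then x else 0"
  let ?p = "\<lambda>g. \<lambda>i\<in>{..<m}. ?f (g i)"
  have proj: "projn m (orthant \<sigma> m) g = ?p g" for g
  proof (rule projn_eqI[OF closed_convex_cone_orthant])
    show "is_projection m (orthant \<sigma> m) g (?p g)"
      unfolding is_projection_def[OF closed_convex_cone_orthant]
    proof (intro conjI ballI)
      show "?p g \<in> orthant \<sigma> m" by (auto simp: orthant_def Rn_def)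
      show "dotn m g (?p g) = dotn m (?p g) (?p g)"
        unfolding dotn_def by (intro sum.cong) auto
      fix q assume q: "q \<in> orthant \<sigma> m"
      show "dotn m g q \<le> dotn m (?p g) q"
        unfolding dotn_def
      proof (rule sum_mono)
        fix i assume i: "i \<in> {..<m}"
        have "g i * q i \<le> 0" if "\<sigma> * g i < 0"
        proof -
          have "0 \<le> \<sigma> * q i" using q i by (simp add: orthant_def)
          then have "(\<sigma> * g i) * (\<sigma> * q i) \<le> 0"
            by (rule mult_nonpos_nonneg[OF less_imp_le[OF that]])
          moreover have "(\<sigma> * g i) * (\<sigma> * q i) = g i * q i" using \<sigma> by auto
          ultimately show ?thesis by simp
        qed
        then show "g i * q i \<le> ?p g i * q i" using i by (auto simp: not_le)
      qed
    qed
  qed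
  have meas: "(\<lambda>x. (?f x)\<^sup>2) \<in> borel_measurable borel" by measurable
  have int: "integrable stdnorm (\<lambda>x. (?f x)\<^sup>2)"
    by (rule Bochner_Integration.integrable_bound[OF stdnorm_integrable_power[of 2]]) auto
  have "stat_dim m (orthant \<sigma> m) = (\<integral>g. (\<Sum>i<m. (?f (g i))\<^sup>2) \<partial>gaussian {..<m})"
    by (simp add: stat_dim_def gauss_eq_gaussian proj sqnormn_def)
  also have "\<dots> = (\<Sum>i<m. \<integral>g. (?f (g i))\<^sup>2 \<partial>gaussian {..<m})"
    by (intro Bochner_Integration.integral_sum integrable_gaussian_component[OF _ int]) auto
  also have "\<dots> = (\<Sum>i<m. 1 / 2)"
    using integral_gaussian_component[of _ "{..<m}", OF _ meas] stdnorm_half_second_moment[OF \<sigma>]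
    by (intro sum.cong) auto
  finally show ?thesis by simp
qed

definition signed_design :: "nat \<Rightarrow> nat \<Rightarrow> (nat \<Rightarrow> (nat \<Rightarrow> real) \<times> real) \<Rightarrow> nat \<times> nat \<Rightarrow> real" where
  "signed_design m n \<omega> = (\<lambda>(i, k)\<in>{..<m} \<times> {..<n}. snd (\<omega> i) * fst (\<omega> i) k)"

lemma distr_gaussian_uminus:
  assumes "finite I"
  shows "distr (gaussian I) (gaussian I) (compose I uminus) = gaussian I"
  using distr_PiM_finite_prob_space'[of I "\<lambda>_. stdnorm" "\<lambda>_. stdnorm" uminus] assms prob_space_stdnorm
  by (simp add: stdnorm_uminus)

lemma prob_space_pair_law: "prob_space (pair_law n)"
  unfolding pair_law_def gauss_eq_gaussian
  by (intro prob_space_pair prob_space_gaussian) (rule measure_pmf.prob_space_axioms)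

lemma vscale_measurable [measurable]:
  "(\<lambda>(x, y). vscale n y x) \<in> measurable (pair_law n) (gaussian {..<n})"
proof -
  have "(\<lambda>p. snd p) \<in> borel_measurable (pair_law n)"
    unfolding pair_law_def by (rule measurable_compose[OF measurable_snd]) simp
  moreover have "(\<lambda>p. fst p i) \<in> borel_measurable (pair_law n)" if "i < n" for i
    unfolding pair_law_def gauss_eq_gaussian
    by (rule measurable_compose[OF measurable_fst]) (use that in simp)
  ultimately show ?thesis
    unfolding vscale_def split_beta' by (intro measurable_restrict) auto
qed

lemma distr_pair_law_vscale:
  "distr (pair_law n) (gaussian {..<n}) (\<lambda>(x, y). vscale n y x) = gaussian {..<n}"
proof (rule measure_eqI)
  let ?G = "gaussian {..<n}" and ?M = "measure_pmf (pmf_of_set {-1 :: real, 1})"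
  let ?v = "\<lambda>(x, y). vscale n y x"
  interpret G: prob_space ?G by (rule prob_space_gaussian)
  interpret GM: pair_sigma_finite ?G ?M by unfold_locales
  fix A assume "A \<in> sets (distr (pair_law n) ?G ?v)"
  then have A: "A \<in> sets ?G" by simp
  have meas: "(\<lambda>z. indicator A (?v z) :: ennreal) \<in> borel_measurable (?G \<Otimes>\<^sub>M ?M)"
    using measurable_compose[OF vscale_measurable[unfolded pair_law_def gauss_eq_gaussian] borel_measurable_indicator[OF A]]
    by simp
  have inner: "(\<integral>\<^sup>+x. indicator A (vscale n y x) \<partial>?G) = emeasure ?G A" if y: "y = -1 \<or> y = 1" for y
  proof (cases "y = 1")
    case True
    have "(\<integral>\<^sup>+x. indicator A (vscale n y x) \<partial>?G) = (\<integral>\<^sup>+x. indicator A x \<partial>?G)"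
      by (intro nn_integral_cong arg_cong[of _ _ "indicator A"])
        (auto simp: True vscale_def space_PiM PiE_def extensional_restrict)
    then show ?thesis using A by simp
  next
    case False
    then have "(\<integral>\<^sup>+x. indicator A (vscale n y x) \<partial>?G) = (\<integral>\<^sup>+x. indicator A (compose {..<n} uminus x) \<partial>?G)"
      using y by (intro nn_integral_cong arg_cong[of _ _ "indicator A"]) (auto simp: vscale_def compose_def)
    also have "\<dots> = (\<integral>\<^sup>+x. indicator A x \<partial>distr ?G ?G (compose {..<n} uminus))"
      using A by (subst nn_integral_distr) (auto simp: compose_def[abs_def])
    also have "\<dots> = emeasure ?G A" using A by (simp add: distr_gaussian_uminus)
    finally show ?thesis .
  qed
  have "emeasure (distr (pair_law n) ?G ?v) A = (\<integral>\<^sup>+z. indicator A z \<partial>distr (pair_law n) ?G ?v)"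
    using A by simp
  also have "\<dots> = (\<integral>\<^sup>+z. indicator A (?v z) \<partial>pair_law n)"
    using A by (subst nn_integral_distr) auto
  also have "\<dots> = (\<integral>\<^sup>+y. \<integral>\<^sup>+x. indicator A (?v (x, y)) \<partial>?G \<partial>?M)"
    unfolding pair_law_def gauss_eq_gaussian by (rule GM.nn_integral_snd[symmetric, OF meas])
  also have "\<dots> = (\<integral>\<^sup>+y. emeasure ?G A \<partial>?M)"
    by (intro nn_integral_cong_AE) (auto simp: AE_measure_pmf_iff inner)
  finally show "emeasure (distr (pair_law n) ?G ?v) A = emeasure ?G A"
    by (simp add: measure_pmf.emeasure_space_1[simplified])
qed simp

lemma signed_design_measurable: "signed_design m n \<in> measurable (sample n m) (gaussian ({..<m} \<times> {..<n}))"
  and distr_signed_design: "distr (sample n m) (gaussian ({..<m} \<times> {..<n})) (signed_design m n) =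
    gaussian ({..<m} \<times> {..<n})"
proof -
  let ?P = "{..<m} \<times> {..<n}" and ?I = "{..<m}"
  let ?G = "gaussian {..<n}" and ?v = "\<lambda>(x, y). vscale n y x"
  let ?u = "\<lambda>\<eta>. \<lambda>(i, k)\<in>?P. \<eta> i k :: real" and ?b = "\<lambda>A. \<lambda>i\<in>?I. \<lambda>k\<in>{..<n}. A (i, k) :: real"
  have u: "?u \<in> measurable (PiM ?I (\<lambda>_. ?G)) (gaussian ?P)"
  proof (rule measurable_restrict)
    fix p assume "p \<in> ?P"
    then obtain i k where p: "p = (i, k)" "i \<in> ?I" "k \<in> {..<n}" by auto
    have "(\<lambda>\<eta>. \<eta> i) \<in> measurable (PiM ?I (\<lambda>_. ?G)) ?G" "(\<lambda>x. x k) \<in> measurable ?G stdnorm"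
      using p by (auto intro: measurable_component_singleton)
    from measurable_compose[OF this]
    show "(\<lambda>\<eta>. case p of (i, k) \<Rightarrow> \<eta> i k) \<in> measurable (PiM ?I (\<lambda>_. ?G)) stdnorm"
      by (simp add: p)
  qed
  have b: "?b \<in> measurable (gaussian ?P) (PiM ?I (\<lambda>_. ?G))"
    by (intro measurable_restrict measurable_component_singleton) auto
  have v: "compose ?I ?v \<in> measurable (sample n m) (PiM ?I (\<lambda>_. ?G))"
    unfolding compose_def sample_def
  proof (rule measurable_restrict)
    fix i assume "i \<in> ?I"
    then have "(\<lambda>\<omega>. \<omega> i) \<in> measurable (PiM ?I (\<lambda>_. pair_law n)) (pair_law n)"
      by (rule measurable_component_singleton)
    then show "(\<lambda>\<omega>. ?v (\<omega> i)) \<in> measurable (PiM ?I (\<lambda>_. pair_law n)) ?G"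
      by (rule measurable_compose[OF _ vscale_measurable])
  qed
  have eq: "signed_design m n = ?u \<circ> compose ?I ?v"
    by (auto simp: fun_eq_iff signed_design_def compose_def vscale_def split: prod.split)
  show "signed_design m n \<in> measurable (sample n m) (gaussian ?P)"
    unfolding eq by (rule measurable_comp[OF v u])
  have "distr (sample n m) (gaussian ?P) (signed_design m n) =
      distr (distr (sample n m) (PiM ?I (\<lambda>_. ?G)) (compose ?I ?v)) (gaussian ?P) ?u"
    unfolding eq by (rule distr_distr[symmetric, OF u v])
  also have "distr (sample n m) (PiM ?I (\<lambda>_. ?G)) (compose ?I ?v) = PiM ?I (\<lambda>_. ?G)"
    unfolding sample_def
    by (subst distr_PiM_finite_prob_space')
      (auto simp: distr_pair_law_vscale intro: prob_space_pair_law prob_space_gaussian)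
  also have "\<dots> = distr (gaussian ?P) (PiM ?I (\<lambda>_. ?G)) ?b"
    by (rule distr_gaussian_blocks[symmetric])
  also have "distr \<dots> (gaussian ?P) ?u = distr (gaussian ?P) (gaussian ?P) (?u \<circ> ?b)"
    by (rule distr_distr[OF u b])
  also have "\<dots> = distr (gaussian ?P) (gaussian ?P) (\<lambda>A. A)"
    by (rule distr_cong) (auto simp: fun_eq_iff space_PiM PiE_def extensional_def split: prod.split)
  finally show "distr (sample n m) (gaussian ?P) (signed_design m n) = gaussian ?P" by simp
qed

lemma whp_signed_design:
  assumes B: "B \<in> sets (gaussian ({..<m} \<times> {..<n}))" and p: "p \<le> measure (gaussian ({..<m} \<times> {..<n})) B"
    and P: "\<And>\<omega>. signed_design m n \<omega> \<in> B \<Longrightarrow> P \<omega>"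
  shows "whp (sample n m) p P"
  unfolding whp_def
proof (intro bexI conjI)
  let ?A = "signed_design m n -` B \<inter> space (sample n m)"
  show "?A \<in> sets (sample n m)" by (rule measurable_sets[OF signed_design_measurable B])
  show "?A \<subseteq> {\<omega> \<in> space (sample n m). P \<omega>}" using P by auto
  show "p \<le> measure (sample n m) ?A"
    using p measure_distr[OF signed_design_measurable B] by (simp add: distr_signed_design)
qed

lemma loglik_signed_design:
  "loglik n m \<omega> \<beta> = - (\<Sum>i<m. ln (1 + exp (- (\<Sum>k<n. signed_design m n \<omega> (i, k) * \<beta> k))))"
  unfolding loglik_def
  by (intro arg_cong[of _ _ uminus] sum.cong refl)
    (simp add: signed_design_def dotn_def sum_distrib_left mult.assoc sum_negf)

lemma max_0_le_ln_1_exp: "max 0 z \<le> ln (1 + exp (z :: real))"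
proof -
  have "0 \<le> ln (1 + exp z)" by (intro ln_ge_zero) simp
  moreover have "z \<le> ln (1 + exp z)"
    using ln_mono[of "exp z" "1 + exp z"] by simp
  ultimately show ?thesis by simp
qed

lemma mle_existsI:
  assumes K: "closed_convex_cone_n n K"
    and neg: "\<And>x. x \<in> unit_sphere n K \<Longrightarrow> \<exists>i<m. (\<Sum>k<n. signed_design m n \<omega> (i, k) * x k) < 0"
  shows "mle_exists n m K \<omega>"
proof -
  let ?row = "\<lambda>i x. \<Sum>k<n. signed_design m n \<omega> (i, k) * x k"
  let ?f = "\<lambda>x. \<Sum>i<m. max 0 (- ?row i x)"
  let ?S = "unit_sphere n K"
  have row_cont: "continuous_on S (?row i)" for S i
    by (intro continuous_intros continuous_on_coordinate)
  have fpos: "0 < ?f x" if x: "x \<in> ?S" for x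
  proof -
    obtain i where "i < m" "?row i x < 0" using neg[OF x] by blast
    then show ?thesis by (intro sum_pos2[of _ i]) auto
  qed
  obtain c where c: "0 < c" "\<And>x. x \<in> ?S \<Longrightarrow> c \<le> ?f x"
  proof (cases "?S = {}")
    case False
    have "\<exists>x\<in>?S. \<forall>y\<in>?S. ?f x \<le> ?f y"
      by (intro continuous_attains_inf compact_unit_sphere[OF K] False continuous_on_sum
          continuous_on_max continuous_on_const continuous_on_minus row_cont)
    then show ?thesis using fpos that by blast
  qed (use that[of 1] in auto)
  have upper: "loglik n m \<omega> \<beta> \<le> - (c * sqrt (sqnormn n \<beta>))" if \<beta>: "\<beta> \<in> K" "0 < sqnormn n \<beta>" for \<beta>
  proof -
    define r where "r = sqrt (sqnormn n \<beta>)"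
    have r: "0 < r" "r\<^sup>2 = sqnormn n \<beta>" using \<beta> by (auto simp: r_def)
    let ?x = "vscale n (1 / r) \<beta>"
    have "?x \<in> ?S"
      unfolding unit_sphere_def[OF K] using r \<beta>
      by (auto intro!: cone_vscale[OF K] simp: sqnormn_vscale power_divide)
    from c(2)[OF this] have "c \<le> (\<Sum>i<m. max 0 (- ?row i \<beta>)) / r"
    proof -
      have row: "?row i ?x = ?row i \<beta> / r" for i
        by (simp add: vscale_def sum_divide_distrib)
      have mx: "max 0 (- (z / r)) = max 0 (- z) / r" for z
        using r by (auto simp: max_def divide_le_0_iff zero_le_divide_iff)
      show ?thesis using \<open>c \<le> ?f ?x\<close> by (simp only: row mx sum_divide_distrib[symmetric])
    qed
    then have "c * r \<le> (\<Sum>i<m. max 0 (- ?row i \<beta>))" using r by (simp add: field_simps)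
    also have "\<dots> \<le> (\<Sum>i<m. ln (1 + exp (- ?row i \<beta>)))" by (intro sum_mono max_0_le_ln_1_exp)
    finally show ?thesis by (simp add: loglik_signed_design r_def)
  qed
  define R where "R = real m * ln 2 / c + 1"
  have R: "0 < R" "real m * ln 2 < c * R" using c by (auto simp: R_def distrib_left add_nonneg_pos)
  let ?B = "K \<inter> {x. sqnormn n x \<le> R\<^sup>2}"
  have z: "vzero n \<in> ?B" using cone_vzero[OF K] by (simp add: sqnormn_vzero)
  have l0: "loglik n m \<omega> (vzero n) = - (real m * ln 2)"
    by (simp add: loglik_signed_design vzero_def)
  have "\<exists>\<beta>\<in>?B. \<forall>\<beta>'\<in>?B. loglik n m \<omega> \<beta>' \<le> loglik n m \<omega> \<beta>"
  proof (rule continuous_attains_sup)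
    show "compact ?B" by (intro compact_Int_sqnormn cone_subset_Rn[OF K] cone_closed_n[OF K])
    show "?B \<noteq> {}" using z by auto
    show "continuous_on ?B (loglik n m \<omega>)"
      unfolding loglik_signed_design
      by (intro continuous_on_minus continuous_on_sum continuous_on_ln continuous_on_add continuous_on_const
          continuous_on_exp row_cont) (smt (verit) exp_gt_zero)
  qed
  then obtain \<beta> where \<beta>: "\<beta> \<in> ?B" "\<And>\<beta>'. \<beta>' \<in> ?B \<Longrightarrow> loglik n m \<omega> \<beta>' \<le> loglik n m \<omega> \<beta>" by blast
  have "loglik n m \<omega> \<beta>' \<le> loglik n m \<omega> \<beta>" if \<beta>': "\<beta>' \<in> K" "\<beta>' \<notin> ?B" for \<beta>'
  proof -
    have big: "R\<^sup>2 < sqnormn n \<beta>'" using \<beta>' by auto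
    then have "R \<le> sqrt (sqnormn n \<beta>')" using R by (intro real_le_rsqrt) auto
    then have "c * R \<le> c * sqrt (sqnormn n \<beta>')" using c by simp
    moreover have "0 < sqnormn n \<beta>'" using big zero_le_power2[of R] by linarith
    ultimately have "loglik n m \<omega> \<beta>' \<le> - (c * R)" using upper[of \<beta>'] \<beta>' by linarith
    then show ?thesis using R l0 \<beta>(2)[OF z] by linarith
  qed
  then show ?thesis unfolding mle_exists_def using \<beta> by blast
qed

lemma not_mle_existsI:
  assumes K: "closed_convex_cone_n n K" and m: "1 \<le> m" and x: "x \<in> K"
    and pos: "\<And>i. i < m \<Longrightarrow> 0 < (\<Sum>k<n. signed_design m n \<omega> (i, k) * x k)"
  shows "\<not> mle_exists n m K \<omega>"
proof
  let ?row = "\<lambda>i x. \<Sum>k<n. signed_design m n \<omega> (i, k) * x k"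
  assume "mle_exists n m K \<omega>"
  then obtain \<beta> where \<beta>: "\<And>\<beta>'. \<beta>' \<in> K \<Longrightarrow> loglik n m \<omega> \<beta>' \<le> loglik n m \<omega> \<beta>"
    unfolding mle_exists_def by blast
  have "0 < (\<Sum>i<m. ln (1 + exp (- ?row i \<beta>)))"
    using m by (intro sum_pos) (auto simp: lessThan_empty_iff intro!: ln_gt_zero)
  then have neg: "loglik n m \<omega> \<beta> < 0" by (simp add: loglik_signed_design)
  have scaled: "loglik n m \<omega> (vscale n (real N) x) = - (\<Sum>i<m. ln (1 + exp (- ?row i x) ^ N))" for N
  proof -
    have "exp (- ?row i (vscale n (real N) x)) = exp (- ?row i x) ^ N" for i
      by (simp add: vscale_def sum_distrib_left mult.left_commute exp_of_nat_mult[symmetric])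
    then show ?thesis by (simp add: loglik_signed_design)
  qed
  have "(\<lambda>N. - (\<Sum>i<m. ln (1 + exp (- ?row i x) ^ N))) \<longlonglongrightarrow> - (\<Sum>i<m. ln (1 + 0))"
    using pos by (intro tendsto_minus tendsto_sum tendsto_ln tendsto_add tendsto_const LIMSEQ_power_zero) auto
  moreover have "- (\<Sum>i<m. ln (1 + exp (- ?row i x) ^ N)) \<le> loglik n m \<omega> \<beta>" for N
    using \<beta>[OF cone_vscale[OF K x, of "real N"]] by (simp add: scaled)
  ultimately have "- (\<Sum>i<m. ln (1 + 0 :: real)) \<le> loglik n m \<omega> \<beta>"
    by (intro LIMSEQ_le_const2) auto
  then show False using neg by simp
qed

lemma sqnormn_projn_smooth:
  assumes K: "closed_convex_cone_n n K"
  shows "sqnormn n (projn n K g') \<le>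
    sqnormn n (projn n K g) + 2 * (dotn n (projn n K g) g' - dotn n (projn n K g) g) + sqdistn n g' g"
proof -
  let ?p = "projn n K g" and ?p' = "projn n K g'"
  let ?w = "\<lambda>k. g' k - g k + ?p k"
  have "sqnormn n ?p' = dotn n g' ?p'" by (rule dotn_projn[OF K, symmetric])
  also have "\<dots> \<le> dotn n g' ?p' - dotn n g ?p' + dotn n ?p ?p'"
    using dotn_le_dotn_projn[OF K projn_in_cone[OF K, of g'], of g] by simp
  also have "\<dots> = dotn n ?w ?p'"
    by (simp add: dotn_def sum_subtractf[symmetric] sum.distrib[symmetric] algebra_simps)
  finally have "sqnormn n ?p' \<le> sqnormn n ?w"
    using two_dotn_le[of 1 n ?w ?p'] by simp
  also have "\<dots> = sqnormn n ?p + 2 * (dotn n ?p g' - dotn n ?p g) + sqdistn n g' g"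
    by (simp add: sqnormn_def dotn_def sqdistn_def power2_eq_square sum_distrib_left
        sum_subtractf[symmetric] sum.distrib[symmetric] algebra_simps)
  finally show ?thesis .
qed

text \<open>The witness is the projection onto \<open>K\<close> of the point of the convex hull of the rows whose
  projection is shortest; its optimality is the required system of strict inequalities.\<close>

lemma strictly_feasible_point:
  fixes A :: "nat \<times> nat \<Rightarrow> real"
  assumes K: "closed_convex_cone_n n K" and m: "1 \<le> m"
    and dual: "\<And>u. u \<in> unit_sphere m (orthant 1 m) \<Longrightarrow> \<exists>y\<in>unit_sphere n K. 0 < bilinear_form n m y A u"
  shows "\<exists>x\<in>K. \<forall>i<m. 0 < (\<Sum>k<n. A (k, i) * x k)"
proof -
  let ?O = "orthant 1 m"
  note O = closed_convex_cone_orthant[of m 1]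
  define g where "g u k = (\<Sum>i<m. A (k, i) * u i)" for u k
  define col where "col i x = (\<Sum>k<n. A (k, i) * x k)" for i and x :: "nat \<Rightarrow> real"
  have g_dot: "dotn n (g u) x = (\<Sum>i<m. u i * col i x)" for u x
    unfolding dotn_def g_def col_def sum_distrib_left sum_distrib_right
    by (subst sum.swap) (simp add: mult_ac)
  have bil: "bilinear_form n m y A u = dotn n (g u) y" for y u
    by (simp add: bilinear_form_def sum.cartesian_product[symmetric] dotn_def g_def sum_distrib_left
        sum_distrib_right mult_ac)
  define S where "S = ?O \<inter> {u. sqnormn m u \<le> 1} \<inter> {u. (\<Sum>i<m. u i) = 1}"
  have S_I: "u \<in> S" if u: "u \<in> ?O" "(\<Sum>i<m. u i) = 1" for u
  proof -
    have u0: "0 \<le> u i" if "i < m" for i using u that by (auto simp: orthant_def)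
    have "(u i)\<^sup>2 \<le> u i" if "i < m" for i
    proof -
      have "u i \<le> (\<Sum>i<m. u i)" using that u0 by (intro member_le_sum) auto
      then show ?thesis using u u0[OF that] by (simp add: power2_eq_square mult_left_le)
    qed
    then have "sqnormn m u \<le> (\<Sum>i<m. u i)" unfolding sqnormn_def by (intro sum_mono) auto
    then show ?thesis using u by (simp add: S_def)
  qed
  have "compact S"
    unfolding S_def
    by (intro compact_Int_closed compact_Int_sqnormn cone_subset_Rn[OF O] cone_closed_n[OF O]
        closed_Collect_eq continuous_intros continuous_on_coordinate)
  moreover have "S \<noteq> {}"
  proof -
    have "(\<lambda>j\<in>{..<m}. if j = 0 then 1 else 0) \<in> S"
      using m by (intro S_I) (auto simp: orthant_def Rn_def)
    then show ?thesis by auto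
  qed
  moreover have "continuous_on S (\<lambda>u. sqnormn n (projn n K (g u)))"
  proof -
    have "continuous_on S g"
      unfolding g_def[abs_def]
      by (intro continuous_on_coordinatewise_then_product continuous_intros continuous_on_coordinate)
    then have "continuous_on S (\<lambda>u. projn n K (g u) k)" for k
      by (rule continuous_on_compose2[OF continuous_on_projn[OF K]]) simp
    then show ?thesis unfolding sqnormn_def by (intro continuous_intros)
  qed
  ultimately obtain u where u: "u \<in> S" and min: "\<And>u'. u' \<in> S \<Longrightarrow> sqnormn n (projn n K (g u)) \<le> sqnormn n (projn n K (g u'))"
    using continuous_attains_inf[of S "\<lambda>u. sqnormn n (projn n K (g u))"] by blast
  let ?p = "projn n K (g u)"
  have uO: "u \<in> ?O" and usum: "(\<Sum>i<m. u i) = 1" using u by (auto simp: S_def)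
  have u0: "0 < sqnormn m u"
  proof (rule ccontr)
    assume "\<not> 0 < sqnormn m u"
    then have "sqnormn m u = 0" using sqnormn_nonneg[of m u] by simp
    then have "\<forall>i<m. u i = 0" by (simp add: sqnormn_def sum_nonneg_eq_0_iff)
    then show False using usum by simp
  qed
  have p0: "0 < sqnormn n ?p"
  proof -
    define r where "r = sqrt (sqnormn m u)"
    have r: "0 < r" "r\<^sup>2 = sqnormn m u" using u0 by (auto simp: r_def)
    have "vscale m (1 / r) u \<in> unit_sphere m ?O"
      unfolding unit_sphere_def[OF O] using r uO
      by (auto intro!: cone_vscale[OF O] simp: sqnormn_vscale power_divide)
    then obtain y where y: "y \<in> K" "0 < bilinear_form n m y A (vscale m (1 / r) u)"
      using dual unfolding unit_sphere_def[OF K] by blast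
    have "bilinear_form n m y A (vscale m (1 / r) u) = dotn n (g u) y / r"
      by (simp add: bil g_dot vscale_def sum_divide_distrib)
    then have "0 < dotn n (g u) y" using y r by (simp add: zero_less_divide_iff)
    also have "\<dots> \<le> dotn n ?p y" by (rule dotn_le_dotn_projn[OF K y(1)])
    also have "\<dots> \<le> sqrt (sqnormn n ?p) * sqrt (sqnormn n y)" using dotn_cauchy_schwarz[of n ?p y] by linarith
    finally show ?thesis using sqnormn_nonneg[of n ?p] by (cases "sqnormn n ?p = 0") auto
  qed
  have "0 < col i ?p" if i: "i < m" for i
  proof -
    let ?d = "\<lambda>k. A (k, i) - g u k"
    have d: "dotn n ?p ?d = col i ?p - sqnormn n ?p"
    proof -
      have "dotn n ?p ?d = col i ?p - dotn n (g u) ?p"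
        by (simp add: dotn_def col_def sum_subtractf[symmetric] algebra_simps)
      then show ?thesis by (simp add: dotn_projn[OF K])
    qed
    have "- 2 * dotn n ?p ?d \<le> t * sqnormn n ?d" if t: "0 < t" "t \<le> 1" for t
    proof -
      let ?u' = "\<lambda>j\<in>{..<m}. (1 - t) * u j + t * (if j = i then 1 else 0)"
      have "?u' \<in> S"
      proof (rule S_I)
        show "?u' \<in> ?O" using uO t by (auto simp: orthant_def Rn_def)
        have "(\<Sum>j<m. ?u' j) = (1 - t) * (\<Sum>j<m. u j) + t * (\<Sum>j<m. if j = i then 1 else 0)"
          using i by (simp add: sum.distrib flip: sum_distrib_left)
        then show "(\<Sum>j<m. ?u' j) = 1" using usum i by simp
      qed
      from min[OF this] have "sqnormn n ?p \<le> sqnormn n ?p + 2 * (dotn n ?p (g ?u') - dotn n ?p (g u)) + sqdistn n (g ?u') (g u)"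
        using sqnormn_projn_smooth[OF K, of "g ?u'" "g u"] by linarith
      moreover have g': "g ?u' k - g u k = t * ?d k" for k
      proof -
        have "g ?u' k = (\<Sum>j<m. (1 - t) * (A (k, j) * u j) + t * (if j = i then A (k, j) else 0))"
          unfolding g_def by (intro sum.cong) (auto simp: algebra_simps)
        also have "\<dots> = (1 - t) * g u k + t * A (k, i)"
          using i by (simp add: g_def sum.distrib sum_distrib_left[symmetric])
        finally show ?thesis by (simp add: algebra_simps)
      qed
      moreover have "dotn n ?p (g ?u') - dotn n ?p (g u) = t * dotn n ?p ?d"
      proof -
        have "dotn n ?p (g ?u') - dotn n ?p (g u) = (\<Sum>k<n. ?p k * (g ?u' k - g u k))"
          by (simp add: dotn_def sum_subtractf[symmetric] right_diff_distrib)
        then show ?thesis by (simp only: g') (simp add: dotn_def sum_distrib_left mult.left_commute)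
      qed
      moreover have "sqdistn n (g ?u') (g u) = t\<^sup>2 * sqnormn n ?d"
        by (simp only: sqdistn_def g') (simp add: sqnormn_def sum_distrib_left power_mult_distrib)
      ultimately have "t * (- 2 * dotn n ?p ?d) \<le> t * (t * sqnormn n ?d)"
        by (simp add: power2_eq_square mult.assoc)
      then show ?thesis using t(1) by (simp only: mult_le_cancel_left_pos)
    qed
    from le_zero_if_le_scaled[OF this] have "0 \<le> dotn n ?p ?d" by simp
    then show ?thesis using d p0 by simp
  qed
  then show ?thesis using projn_in_cone[OF K, of "g u"] unfolding col_def by blast
qed

lemma mle_exists_whp:
  assumes K: "closed_convex_cone_n n K" and t: "1 \<le> t"
    and gap: "sqrt (stat_dim n K) + 22 * sqrt t \<le> sqrt (m / 2)"
  shows "whp (sample n m) (1 - exp (- t)) (mle_exists n m K)"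
proof -
  let ?O = "orthant (-1) m"
  note O = closed_convex_cone_orthant[of m "-1"]
  have half: "stat_dim m ?O = m / 2" by (rule stat_dim_orthant) simp
  have gap': "sqrt (stat_dim n K) + 22 * sqrt t \<le> sqrt (stat_dim m ?O)"
    using gap unfolding half .
  obtain B where B: "B \<in> sets (gaussian ({..<m} \<times> {..<n}))"
    "1 - exp (- t) \<le> measure (gaussian ({..<m} \<times> {..<n})) B"
    "\<forall>A\<in>B. \<forall>x\<in>unit_sphere n K. \<exists>y\<in>unit_sphere m ?O. 0 < bilinear_form m n y A x"
    using gordon_cones[OF K O t gap'] by blast
  show ?thesis
  proof (rule whp_signed_design[OF B(1,2)])
    fix \<omega> assume \<omega>: "signed_design m n \<omega> \<in> B"
    show "mle_exists n m K \<omega>"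
    proof (rule mle_existsI[OF K])
      fix x assume "x \<in> unit_sphere n K"
      then obtain y where y: "y \<in> ?O" "0 < bilinear_form m n y (signed_design m n \<omega>) x"
        using B(3) \<omega> unfolding unit_sphere_def[OF O] by blast
      let ?row = "\<lambda>i. \<Sum>k<n. signed_design m n \<omega> (i, k) * x k"
      have eq: "bilinear_form m n y (signed_design m n \<omega>) x = (\<Sum>i<m. y i * ?row i)"
        by (simp add: bilinear_form_def sum.cartesian_product[symmetric] sum_distrib_left mult_ac)
      have le: "y i * ?row i \<le> 0" if "0 \<le> ?row i" "i < m" for i
        using that y(1) by (intro mult_nonpos_nonneg) (auto simp: orthant_def)
      show "\<exists>i<m. ?row i < 0"
      proof (rule ccontr)
        assume "\<not> (\<exists>i<m. ?row i < 0)"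
        then have "0 \<le> ?row i" if "i < m" for i using that not_less by blast
        then have "(\<Sum>i<m. y i * ?row i) \<le> 0" using le by (meson lessThan_iff sum_nonpos)
        then show False using y(2) eq by simp
      qed
    qed
  qed
qed

lemma not_mle_exists_whp:
  assumes K: "closed_convex_cone_n n K" and t: "1 \<le> t" and m: "1 \<le> m"
    and gap: "sqrt (m / 2) + 22 * sqrt t \<le> sqrt (stat_dim n K)"
  shows "whp (sample n m) (1 - exp (- t)) (\<lambda>\<omega>. \<not> mle_exists n m K \<omega>)"
proof -
  let ?O = "orthant 1 m"
  let ?P = "{..<m} \<times> {..<n}" and ?Q = "{..<n} \<times> {..<m}"
  note O = closed_convex_cone_orthant[of m 1]
  have half: "stat_dim m ?O = m / 2" by (rule stat_dim_orthant) simp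
  have gap': "sqrt (stat_dim m ?O) + 22 * sqrt t \<le> sqrt (stat_dim n K)"
    using gap unfolding half .
  obtain B where B: "B \<in> sets (gaussian ?Q)" "1 - exp (- t) \<le> measure (gaussian ?Q) B"
    "\<forall>A\<in>B. \<forall>u\<in>unit_sphere m ?O. \<exists>y\<in>unit_sphere n K. 0 < bilinear_form n m y A u"
    using gordon_cones[OF O K t gap'] by blast
  let ?T = "\<lambda>A. \<lambda>q\<in>?Q. A (prod.swap q) :: real"
  let ?B' = "{A \<in> space (gaussian ?P). ?T A \<in> B}"
  have swap: "inj_on prod.swap ?Q" "prod.swap \<in> ?Q \<rightarrow> ?P" by (auto simp: inj_on_def)
  have BB: "{x \<in> space (gaussian ?Q). x \<in> B} = B" using sets.sets_into_space[OF B(1)] by auto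
  have B': "measure (gaussian ?P) ?B' = measure (gaussian ?Q) B" "?B' \<in> sets (gaussian ?P)"
    using measure_gaussian_marginal[OF swap, of "\<lambda>x. x \<in> B"] B(1) by (simp_all add: BB)
  show ?thesis
  proof (rule whp_signed_design[OF B'(2)])
    show "1 - exp (- t) \<le> measure (gaussian ?P) ?B'" using B(2) B'(1) by simp
    fix \<omega> assume "signed_design m n \<omega> \<in> ?B'"
    then have "?T (signed_design m n \<omega>) \<in> B" by simp
    then obtain x where x: "x \<in> K" "\<And>i. i < m \<Longrightarrow> 0 < (\<Sum>k<n. ?T (signed_design m n \<omega>) (k, i) * x k)"
      using strictly_feasible_point[OF K m, of "?T (signed_design m n \<omega>)"] B(3) by blast
    show "\<not> mle_exists n m K \<omega>"
      by (rule not_mle_existsI[OF K m x(1)]) (use x(2) in simp)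
  qed
qed

theorem theorem1p3:
  "\<exists>C>0. \<forall>(n::nat) (m::nat) (K::(nat \<Rightarrow> real) set) (t::real).
     closed_convex_cone_n n K \<and> K \<noteq> {vzero n} \<and> m \<ge> 1 \<and> t \<ge> 1 \<longrightarrow>
     (sqrt (real m) \<le> sqrt (2 * stat_dim n K) - C * sqrt t \<longrightarrow>
        whp (sample n m) (1 - exp (- t)) (\<lambda>\<omega>. \<not> mle_exists n m K \<omega>)) \<and>
     (sqrt (real m) \<ge> sqrt (2 * stat_dim n K) + C * sqrt t \<longrightarrow>
        whp (sample n m) (1 - exp (- t)) (\<lambda>\<omega>. mle_exists n m K \<omega>))"
proof (intro exI[of _ "sqrt 2 * 22"] conjI allI impI; (elim conjE)?)
  fix n m :: nat and K :: "(nat \<Rightarrow> real) set" and t :: real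
  assume K: "closed_convex_cone_n n K" and m: "m \<ge> 1" and t: "t \<ge> 1"
  have sqrt_m: "sqrt (real m) = sqrt 2 * sqrt (m / 2)"
    by (simp add: real_sqrt_mult[symmetric])
  have sqrt_d: "sqrt (2 * stat_dim n K) = sqrt 2 * sqrt (stat_dim n K)"
    by (rule real_sqrt_mult)
  have cancel: "a \<le> b" if "sqrt 2 * a \<le> sqrt 2 * b" for a b :: real
    using that by simp
  show "whp (sample n m) (1 - exp (- t)) (\<lambda>\<omega>. \<not> mle_exists n m K \<omega>)"
    if "sqrt (real m) \<le> sqrt (2 * stat_dim n K) - sqrt 2 * 22 * sqrt t"
  proof (rule not_mle_exists_whp[OF K t m], rule cancel)
    show "sqrt 2 * (sqrt (m / 2) + 22 * sqrt t) \<le> sqrt 2 * sqrt (stat_dim n K)"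
      using that unfolding sqrt_m sqrt_d by (simp add: distrib_left)
  qed
  show "whp (sample n m) (1 - exp (- t)) (mle_exists n m K)"
    if "sqrt (real m) \<ge> sqrt (2 * stat_dim n K) + sqrt 2 * 22 * sqrt t"
  proof (rule mle_exists_whp[OF K t], rule cancel)
    show "sqrt 2 * (sqrt (stat_dim n K) + 22 * sqrt t) \<le> sqrt 2 * sqrt (m / 2)"
      using that unfolding sqrt_m sqrt_d by (simp add: distrib_left)
  qed
qed simp

end
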